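(* There exists a sequence $\{Q_n\}_n$ of unitary matrices $Q_n\in\mathbb C^{n\times n}$ with the following property: for every measurable $\kappa:[0,1]\times[-\pi,\pi]\to\mathbb C$ and every GLT sequence $\{A_n\}_n\sim_{\rm GLT}\kappa$ there exists a sequence $\{D_n\}_n$ of diagonal matrices $D_n\in\mathbb C^{n\times n}$ such that $\{A_n\}_n\equiv_{\rm a.c.s.}\{Q_nD_nQ_n^*\}_n$, $\{D_n\}_n\sim_\lambda\kappa$, and $D_n$ is real for every $n$ if $\kappa$ is real. Moreover, if $\{m(n)\}_n$ is any sequence of positive integers such that $m(n)\le n$, $m(n)\to\infty$ and $m(n)=o(n)$ as $n\to\infty$, then $Q_n$ can be chosen as $Q_n=Q_{n,m(n)}$.
   Context: A matrix-sequence is a sequence $\{A_n\}_n$ with $A_n\in\mathbb C^{n\times n}$ for every $n$. All measure-theoretic notions refer to Lebesgue measure; $\mu_k$ is the Lebesgue measure in $\mathbb R^k$; $\|\cdot\|$ is the spectral norm. The matrices $Q_{n,m}$: let $F_n=\frac1{\sqrt n}[e^{-2\pi \mathrm i jk/n}]_{j,k=0}^{n-1}$ be the unitary discrete Fourier transform of size $n$. For $m,n\in\mathbb N$ with $m\le n$, $Q_{n,m}$ is the $n\times n$ block diagonal matrix with $m$ diagonal blocks equal to $F_{\lfloor n/m\rfloor}$ followed by a last diagonal block equal to the identity $I_{n\bmod m}$ (absent if $m$ divides $n$). Spectral distribution: for a matrix-sequence $\{A_n\}_n$ and a measurable $f:D\subset\mathbb R^k\to\mathbb C$ with $0<\mu_k(D)<\infty$,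 $\{A_n\}_n\sim_\lambda f$ means $\lim_{n\to\infty}\frac1n\sum_{i=1}^nF(\lambda_i(A_n))=\frac1{\mu_k(D)}\int_DF(f(\mathbf x))\,d\mathbf x$ for all continuous $F:\mathbb C\to\mathbb C$ with bounded support, where $\lambda_i(A_n)$ are the eigenvalues of $A_n$. Zero-distributed sequences: a matrix-sequence $\{Z_n\}_n$ is zero-distributed if $Z_n=R_n+N_n$ with $\lim_{n\to\infty}n^{-1}\mathrm{rank}(R_n)=\lim_{n\to\infty}\|N_n\|=0$. We write $\{A_n\}_n\equiv_{\rm a.c.s.}\{B_n\}_n$ if $\{A_n-B_n\}_n$ is zero-distributed. Approximating class of sequences (a.c.s.): given a matrix-sequence $\{A_n\}_n$ and matrix-sequences $\{B_{n,m}\}_n$ ($m\in\mathbb N$), we write $\{B_{n,m}\}_n\xrightarrow{\rm a.c.s.}\{A_n\}_n$ if for every $m$ there exists $n_m$ such that, for $n\ge n_m$, $A_n=B_{n,m}+R_{n,m}+N_{n,m}$ with $\mathrm{rank}(R_{n,m})\le c(m)n$ and $\|N_{n,m}\|\le\omega(m)$, where $n_m,c(m),\omega(m)$ depend only on $m$ and $\lim_{m\to\infty}c(m)=\lim_{m\to\infty}\omega(m)=0$. Diagonal sampling and Toeplitz matrices: for $a:[0,1]\to\mathbb C$, $D_n(a)=\mathrm{diag}_{i=1,\ldots,n}a(i/n)$. For $f\in L^1([-\pi,\pi])$, $T_n(f)=[f_{i-j}]_{i,j=1}^n$ with $f_k=\frac1{2\pi}\int_{-\pi}^\pi f(\theta)e^{-\mathrm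 i k\theta}d\theta$. GLT sequences: for a matrix-sequence $\{A_n\}_n$ and a measurable $\kappa:[0,1]\times[-\pi,\pi]\to\mathbb C$, $\{A_n\}_n$ is a GLT sequence with symbol $\kappa$, written $\{A_n\}_n\sim_{\rm GLT}\kappa$, if there exist functions $a_{i,m},f_{i,m}$, $i=1,\ldots,N_m$, with $a_{i,m}:[0,1]\to\mathbb C$ continuous a.e. and $f_{i,m}\in L^1([-\pi,\pi])$, such that $\sum_{i=1}^{N_m}a_{i,m}(x)f_{i,m}(\theta)\to\kappa(x,\theta)$ in measure over $[0,1]\times[-\pi,\pi]$ as $m\to\infty$, and $\{\sum_{i=1}^{N_m}D_n(a_{i,m})T_n(f_{i,m})\}_n\xrightarrow{\rm a.c.s.}\{A_n\}_n$. *)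

theory Defs
  imports
    "HOL-Analysis.Analysis"
    "HOL-Library.Landau_Symbols"
    "Jordan_Normal_Form.Schur_Decomposition"
    "Jordan_Normal_Form.DL_Rank"
begin

unbundle no vec_syntax
hide_const (open) Finite_Cartesian_Product.vec Finite_Cartesian_Product.row
  Determinants.det Finite_Cartesian_Product.mat Cartesian_Space.rank

text \<open>A matrix-sequence has an entry also for \<open>n = 0\<close>, which is forced to be the empty matrix.\<close>

definition matrix_seq :: "(nat \<Rightarrow> complex mat) \<Rightarrow> bool" where
  "matrix_seq A \<longleftrightarrow> (\<forall>n. A n \<in> carrier_mat n n)"

definition unitary_mat :: "complex mat \<Rightarrow> bool" where
  "unitary_mat Q \<longleftrightarrow> square_mat Q \<and>
     Q * mat_adjoint Q = 1\<^sub>m (dim_row Q) \<and> mat_adjoint Q * Q = 1\<^sub>m (dim_row Q)"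

definition mat_rank :: "complex mat \<Rightarrow> nat" where
  "mat_rank A = vec_space.rank (dim_row A) A"

definition vec_norm2 :: "complex vec \<Rightarrow> real" where
  "vec_norm2 v = L2_set (\<lambda>i. cmod (v $ i)) {..<dim_vec v}"

definition spectral_norm :: "complex mat \<Rightarrow> real" where
  "spectral_norm A = (SUP v\<in>{v \<in> carrier_vec (dim_col A). vec_norm2 v \<le> 1}. vec_norm2 (A *\<^sub>v v))"

text \<open>Eigenvalues are counted with algebraic multiplicity.\<close>

definition eigvals :: "complex mat \<Rightarrow> complex multiset" where
  "eigvals A = proots (char_poly A)"

text \<open>The sum of the \<open>n \<times> n\<close> matrices \<open>B i\<close>; the type of matrices of arbitrary size has no
  zero, so \<^const>\<open>sum\<close> itself does not apply.\<close>

definition mat_sum :: "nat \<Rightarrow> ('i \<Rightarrow> complex mat) \<Rightarrow> 'i set \<Rightarrow> complex mat" where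
  "mat_sum n B I = Matrix.mat n n (\<lambda>(j, k). \<Sum>i\<in>I. B i $$ (j, k))"

definition dft_mat :: "nat \<Rightarrow> complex mat" where
  "dft_mat n = Matrix.mat n n
     (\<lambda>(j, k). exp (- 2 * of_real pi * \<i> * of_nat j * of_nat k / of_nat n) / of_real (sqrt (real n)))"

text \<open>If \<open>m\<close> divides \<open>n\<close>, the last block is the empty matrix.\<close>

definition Q_mat :: "nat \<Rightarrow> nat \<Rightarrow> complex mat" where
  "Q_mat n m = diag_block_mat (replicate m (dft_mat (n div m)) @ [1\<^sub>m (n mod m)])"

definition spectral_distribution ::
  "(nat \<Rightarrow> complex mat) \<Rightarrow> 'a::euclidean_space set \<Rightarrow> ('a \<Rightarrow> complex) \<Rightarrow> bool" where
  "spectral_distribution A D f \<longleftrightarrow>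
     (\<forall>F :: complex \<Rightarrow> complex. continuous_on UNIV F \<longrightarrow> bounded {z. F z \<noteq> 0} \<longrightarrow>
        (\<lambda>n. (\<Sum>z\<in>#eigvals (A n). F z) / of_nat n) \<longlonglongrightarrow>
          (LINT x|lebesgue_on D. F (f x)) / of_real (measure lebesgue D))"

definition zero_distributed :: "(nat \<Rightarrow> complex mat) \<Rightarrow> bool" where
  "zero_distributed Z \<longleftrightarrow>
     (\<exists>R N. matrix_seq R \<and> matrix_seq N \<and> (\<forall>n. Z n = R n + N n) \<and>
        (\<lambda>n. real (mat_rank (R n)) / real n) \<longlonglongrightarrow> 0 \<and>
        (\<lambda>n. spectral_norm (N n)) \<longlonglongrightarrow> 0)"

definition acs_equiv :: "(nat \<Rightarrow> complex mat) \<Rightarrow> (nat \<Rightarrow> complex mat) \<Rightarrow> bool" where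
  "acs_equiv A B \<longleftrightarrow> zero_distributed (\<lambda>n. A n - B n)"

text \<open>Here \<open>B m\<close> is the \<open>m\<close>-th matrix-sequence.\<close>

definition acs_conv :: "(nat \<Rightarrow> nat \<Rightarrow> complex mat) \<Rightarrow> (nat \<Rightarrow> complex mat) \<Rightarrow> bool" where
  "acs_conv B A \<longleftrightarrow>
     (\<exists>(n0 :: nat \<Rightarrow> nat) (c :: nat \<Rightarrow> real) (\<omega> :: nat \<Rightarrow> real).
        c \<longlonglongrightarrow> 0 \<and> \<omega> \<longlonglongrightarrow> 0 \<and>
        (\<forall>m. \<forall>n\<ge>n0 m. \<exists>R\<in>carrier_mat n n. \<exists>N\<in>carrier_mat n n.
           A n = B m n + R + N \<and>
           real (mat_rank R) \<le> c m * real n \<and> spectral_norm N \<le> \<omega> m))"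

definition diag_sampling :: "nat \<Rightarrow> (real \<Rightarrow> complex) \<Rightarrow> complex mat" where
  "diag_sampling n a = mat_diag n (\<lambda>i. a (real (i + 1) / real n))"

definition fourier_coeff :: "(real \<Rightarrow> complex) \<Rightarrow> int \<Rightarrow> complex" where
  "fourier_coeff f k =
     (LINT \<theta>|lebesgue_on {-pi..pi}. f \<theta> * exp (- \<i> * of_int k * of_real \<theta>)) / of_real (2 * pi)"

definition toeplitz_mat :: "nat \<Rightarrow> (real \<Rightarrow> complex) \<Rightarrow> complex mat" where
  "toeplitz_mat n f = Matrix.mat n n (\<lambda>(i, j). fourier_coeff f (int i - int j))"

definition converges_in_measure ::
  "'a measure \<Rightarrow> (nat \<Rightarrow> 'a \<Rightarrow> complex) \<Rightarrow> ('a \<Rightarrow> complex) \<Rightarrow> bool" where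
  "converges_in_measure M g f \<longleftrightarrow>
     (\<forall>m. g m \<in> borel_measurable M) \<and> f \<in> borel_measurable M \<and>
     (\<forall>\<epsilon>>0. (\<lambda>m. emeasure M {x \<in> space M. \<epsilon> < cmod (g m x - f x)}) \<longlonglongrightarrow> 0)"

abbreviation GLT_domain :: "(real \<times> real) set" where
  "GLT_domain \<equiv> {0..1} \<times> {-pi..pi}"

definition GLT_sequence :: "(nat \<Rightarrow> complex mat) \<Rightarrow> (real \<times> real \<Rightarrow> complex) \<Rightarrow> bool" where
  "GLT_sequence A \<kappa> \<longleftrightarrow>
     matrix_seq A \<and> \<kappa> \<in> borel_measurable (lebesgue_on GLT_domain) \<and>
     (\<exists>(N :: nat \<Rightarrow> nat) (a :: nat \<Rightarrow> nat \<Rightarrow> real \<Rightarrow> complex) (f :: nat \<Rightarrow> nat \<Rightarrow> real \<Rightarrow> complex).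
        (\<forall>m. \<forall>i\<in>{1..N m}.
           (AE x in lebesgue_on {0..1}. continuous (at x within {0..1}) (a i m)) \<and>
           integrable (lebesgue_on {-pi..pi}) (f i m)) \<and>
        converges_in_measure (lebesgue_on GLT_domain)
          (\<lambda>m (x, \<theta>). \<Sum>i\<in>{1..N m}. a i m x * f i m \<theta>) \<kappa> \<and>
        acs_conv
          (\<lambda>m n. mat_sum n (\<lambda>i. diag_sampling n (a i m) * toeplitz_mat n (f i m)) {1..N m}) A)"

definition asymptotically_diagonalizes_GLT :: "(nat \<Rightarrow> complex mat) \<Rightarrow> bool" where
  "asymptotically_diagonalizes_GLT Q \<longleftrightarrow>
     (\<forall>\<kappa> A. \<kappa> \<in> borel_measurable (lebesgue_on GLT_domain) \<longrightarrow> GLT_sequence A \<kappa> \<longrightarrow>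
        (\<exists>D. matrix_seq D \<and> (\<forall>n. diagonal_mat (D n)) \<and>
           acs_equiv A (\<lambda>n. Q n * D n * mat_adjoint (Q n)) \<and>
           spectral_distribution D GLT_domain \<kappa> \<and>
           ((\<forall>z\<in>GLT_domain. \<kappa> z \<in> \<real>) \<longrightarrow> (\<forall>n. elements_mat (D n) \<subseteq> \<real>))))"

end

theory Submission
  imports Defs
begin

text \<open>Approximate the symbol \<open>\<kappa>\<close> in measure by functions \<open>h\<close> that are continuous and
  \<open>2\<pi>\<close>-periodic in the second variable, so that simultaneously \<open>A\<^sub>n - Q\<^sub>n S\<^sub>n(h) Q\<^sub>n\<^sup>*\<close> is a matrix of
  small relative rank plus a matrix of small norm, where \<open>S\<^sub>n(h)\<close> is the diagonal matrix of the values of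
  \<open>h\<close> on a uniform grid adapted to the blocks of \<open>Q\<^sub>n\<close>. For \<open>h(x, \<theta>) = a(x) e\<^sup>i\<^sup>k\<^sup>\<theta>\<close> this holds because
  \<open>D\<^sub>n(a) T\<^sub>n(e\<^sup>i\<^sup>k\<^sup>\<theta>)\<close> and the block circulant matrix \<open>Q\<^sub>n S\<^sub>n(h) Q\<^sub>n\<^sup>*\<close> differ, outside \<open>O(m)\<close> rows,
  only by the oscillation of \<open>a\<close>; the general case follows since both sides are stable under small
  perturbations: an a.e. continuous \<open>a\<close> is close to a continuous function, an integrable \<open>f\<close> is
  \<open>L\<^sup>1\<close>-close to a trigonometric polynomial, and the Toeplitz matrix of an \<open>L\<^sup>1\<close>-small nonnegative
  function is positive semidefinite with small trace. Finally let \<open>h = h\<^sub>k\<close> run through better and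
  better approximations with an index \<open>k = k(n)\<close> growing slowly, and put \<open>D\<^sub>n = S\<^sub>n(h\<^sub>k\<^sub>(\<^sub>n\<^sub>))\<close>.
  Riemann sums of \<open>F \<circ> h\<^sub>k\<close> give the spectral distribution, and for real \<open>\<kappa>\<close> one may take
  \<open>Re h\<^sub>k\<close>.\<close>

subsection \<open>Low rank plus small norm\<close>

text \<open>The two limits required of \<open>m n\<close> act on opposite sides. When it tends to
  infinity, a block covers a short part of [0,1], on which a continuous coefficient hardly varies;
  when it is o(n), the rows near block boundaries are a vanishing fraction of all rows. The
  eigenvalues of the matrices in the GLT sequence never enter, since these need not be normal: what
  ties the spectrum of the diagonal matrices to \<kappa> is that one and the same \<open>h\<close>
  approximates both the matrices and the symbol. Neither factor of D_n(a) T_n(f) is bounded in norm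
  uniformly in n, because \<open>a\<close> may be unbounded and \<open>f\<close> is only integrable.
  Each is bounded after removal of a small rank part, and under multiplication ranks add while norms
  multiply; so the accuracy for one factor is chosen after the bound for the other. Passing to the
  real part of \<open>h\<close> needs an implication in the reverse direction, from a small symbol
  to small matrices. It holds for conjugated grid matrices, whose large eigenvalues are counted by a
  Riemann sum of a continuous cutoff.\<close>

text \<open>An \<open>n \<times> n\<close> matrix is represented here by its entry function, whose values outside the index
  range are irrelevant; this avoids carrier conditions.\<close>

type_synonym cmfun = "nat \<Rightarrow> nat \<Rightarrow> complex"

definition nrm :: "nat \<Rightarrow> (nat \<Rightarrow> complex) \<Rightarrow> real" where
  "nrm n v = L2_set (\<lambda>i. cmod (v i)) {..<n}"

definition mv :: "nat \<Rightarrow> cmfun \<Rightarrow> (nat \<Rightarrow> complex) \<Rightarrow> nat \<Rightarrow> complex" where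
  "mv n M v i = (\<Sum>j<n. M i j * v j)"

definition mm :: "nat \<Rightarrow> cmfun \<Rightarrow> cmfun \<Rightarrow> cmfun" where
  "mm n A B i j = (\<Sum>l<n. A i l * B l j)"

text \<open>The conjunct \<open>0 \<le> w\<close> covers \<open>n = 0\<close>, where the inequality
  alone would admit negative \<open>w\<close>; products of bounds rely on the sign.\<close>

definition op_bounded :: "nat \<Rightarrow> real \<Rightarrow> cmfun \<Rightarrow> bool" where
  "op_bounded n w N \<longleftrightarrow> 0 \<le> w \<and> (\<forall>v. nrm n (mv n N v) \<le> w * nrm n v)"

text \<open>A sum of at most \<open>r\<close> dyads. With explicit factors, sums and products are
  handled without rank theory, and a real \<open>r\<close> allows bounds such as
  \<open>c * real n\<close> without rounding.\<close>

definition low_rank :: "nat \<Rightarrow> real \<Rightarrow> cmfun \<Rightarrow> bool" where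
  "low_rank n r R \<longleftrightarrow> (\<exists>(k::nat) x y. real k \<le> r \<and> (\<forall>i<n. \<forall>j<n. R i j = (\<Sum>l<k. x l i * y l j)))"

definition splits :: "nat \<Rightarrow> real \<Rightarrow> real \<Rightarrow> cmfun \<Rightarrow> bool" where
  "splits n r w M \<longleftrightarrow>
     (\<exists>R N. (\<forall>i<n. \<forall>j<n. M i j = R i j + N i j) \<and> low_rank n r R \<and> op_bounded n w N)"

lemma nrm_nonneg [simp]: "0 \<le> nrm n v"
  by (simp add: nrm_def)

lemma nrm_power2: "(nrm n v)\<^sup>2 = (\<Sum>i<n. (cmod (v i))\<^sup>2)"
  by (simp add: nrm_def L2_set_def sum_nonneg)

lemma nrm_cong: "(\<And>i. i < n \<Longrightarrow> u i = v i) \<Longrightarrow> nrm n u = nrm n v"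
  unfolding nrm_def by (rule L2_set_cong) auto

lemma nrm_triangle: "nrm n (\<lambda>i. u i + v i) \<le> nrm n u + nrm n v"
proof -
  have "nrm n (\<lambda>i. u i + v i) \<le> L2_set (\<lambda>i. cmod (u i) + cmod (v i)) {..<n}"
    unfolding nrm_def by (rule L2_set_mono) (auto simp: norm_triangle_ineq)
  also have "\<dots> \<le> nrm n u + nrm n v"
    unfolding nrm_def by (rule L2_set_triangle_ineq)
  finally show ?thesis .
qed

lemma nrm_scale: "nrm n (\<lambda>i. c * v i) = cmod c * nrm n v"
  unfolding nrm_def by (simp add: norm_mult L2_set_right_distrib)

lemma mv_cong: "(\<And>i j. i < n \<Longrightarrow> j < n \<Longrightarrow> A i j = B i j) \<Longrightarrow> i < n \<Longrightarrow> mv n A v i = mv n B v i"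
  by (simp add: mv_def)

lemma op_bounded_cong:
  assumes "\<And>i j. i < n \<Longrightarrow> j < n \<Longrightarrow> A i j = B i j" "op_bounded n w A"
  shows "op_bounded n w B"
proof -
  have "nrm n (mv n A v) = nrm n (mv n B v)" for v
    by (rule nrm_cong, rule mv_cong) (use assms in auto)
  then show ?thesis using assms(2) by (simp add: op_bounded_def)
qed

lemma op_bounded_add:
  assumes "op_bounded n w A" "op_bounded n w' B"
  shows "op_bounded n (w + w') (\<lambda>i j. A i j + B i j)"
proof -
  have "nrm n (mv n (\<lambda>i j. A i j + B i j) v) \<le> (w + w') * nrm n v" for v
  proof -
    have "mv n (\<lambda>i j. A i j + B i j) v = (\<lambda>i. mv n A v i + mv n B v i)"
      by (rule ext) (simp add: mv_def algebra_simps sum.distrib)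
    then have "nrm n (mv n (\<lambda>i j. A i j + B i j) v) \<le> nrm n (mv n A v) + nrm n (mv n B v)"
      by (simp add: nrm_triangle)
    also have "\<dots> \<le> w * nrm n v + w' * nrm n v"
      using assms by (intro add_mono) (auto simp: op_bounded_def)
    finally show ?thesis by (simp add: algebra_simps)
  qed
  then show ?thesis using assms by (auto simp: op_bounded_def)
qed

lemma op_bounded_scale:
  assumes "op_bounded n w A"
  shows "op_bounded n (cmod c * w) (\<lambda>i j. c * A i j)"
proof -
  have "nrm n (mv n (\<lambda>i j. c * A i j) v) \<le> (cmod c * w) * nrm n v" for v
  proof -
    have "mv n (\<lambda>i j. c * A i j) v = (\<lambda>i. c * mv n A v i)"
      by (rule ext) (simp add: mv_def sum_distrib_left mult_ac)
    then show ?thesis using assms by (simp add: nrm_scale op_bounded_def mult.assoc mult_left_mono)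
  qed
  then show ?thesis using assms by (auto simp: op_bounded_def)
qed

lemma mv_mm: "mv n (mm n A B) v i = mv n A (mv n B v) i"
proof -
  have "mv n (mm n A B) v i = (\<Sum>j<n. \<Sum>l<n. A i l * B l j * v j)"
    by (simp add: mv_def mm_def sum_distrib_right)
  also have "\<dots> = (\<Sum>l<n. \<Sum>j<n. A i l * B l j * v j)"
    by (rule sum.swap)
  also have "\<dots> = mv n A (mv n B v) i"
    by (simp add: mv_def sum_distrib_left mult.assoc)
  finally show ?thesis .
qed

lemma op_bounded_mult:
  assumes "op_bounded n w A" "op_bounded n w' B"
  shows "op_bounded n (w * w') (mm n A B)"
proof -
  have "nrm n (mv n (mm n A B) v) \<le> (w * w') * nrm n v" for v
  proof -
    have "nrm n (mv n (mm n A B) v) = nrm n (mv n A (mv n B v))"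
      by (rule nrm_cong) (rule mv_mm)
    also have "\<dots> \<le> w * nrm n (mv n B v)" using assms by (simp add: op_bounded_def)
    also have "\<dots> \<le> w * (w' * nrm n v)" using assms by (simp add: op_bounded_def mult_left_mono)
    finally show ?thesis by simp
  qed
  then show ?thesis using assms by (simp add: op_bounded_def)
qed

lemma op_bounded_mono:
  assumes "op_bounded n w A" "w \<le> w'"
  shows "op_bounded n w' A"
proof -
  have "nrm n (mv n A v) \<le> w' * nrm n v" for v
  proof -
    have "nrm n (mv n A v) \<le> w * nrm n v" using assms by (simp add: op_bounded_def)
    also have "\<dots> \<le> w' * nrm n v" using assms by (intro mult_right_mono) auto
    finally show ?thesis .
  qed
  then show ?thesis using assms by (simp add: op_bounded_def)
qed

lemma op_bounded_zero: "0 \<le> w \<Longrightarrow> op_bounded n w (\<lambda>i j. 0)"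
  by (simp add: op_bounded_def mv_def nrm_def L2_set_def sum_nonneg)

text \<open>Every row and every column has at most one nonzero entry, so the squared norm of the
  image is a weighted sum of distinct terms of the squared norm of \<open>v\<close>. Diagonal
  matrices and shifts are the intended instances.\<close>

lemma op_bounded_weighted_partial_injection:
  assumes inj: "inj_on \<tau> G" and w: "0 \<le> w" and c: "\<And>i. i < n \<Longrightarrow> i \<in> G \<Longrightarrow> cmod (c i) \<le> w"
  shows "op_bounded n w (\<lambda>i j. if i \<in> G \<and> j = \<tau> i then c i else 0)"
proof -
  let ?N = "\<lambda>i j. if i \<in> G \<and> j = \<tau> i then c i else 0"
  have "nrm n (mv n ?N v) \<le> w * nrm n v" for v
  proof (rule power2_le_imp_le)
    let ?G = "{i\<in>G. i < n \<and> \<tau> i < n}"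
    have mvi: "mv n ?N v i = (if i \<in> G \<and> \<tau> i < n then c i * v (\<tau> i) else 0)" for i
    proof -
      have "mv n ?N v i = (\<Sum>j<n. if \<tau> i = j then (if i \<in> G then c i * v j else 0) else 0)"
        unfolding mv_def by (rule sum.cong) auto
      then show ?thesis by simp
    qed
    have "(nrm n (mv n ?N v))\<^sup>2 = (\<Sum>i<n. if i \<in> G \<and> \<tau> i < n then (cmod (c i * v (\<tau> i)))\<^sup>2 else 0)"
      unfolding nrm_power2 mvi by (rule sum.cong) auto
    also have "\<dots> = (\<Sum>i\<in>?G. (cmod (c i * v (\<tau> i)))\<^sup>2)"
      by (rule sum.mono_neutral_cong_right) auto
    also have "\<dots> \<le> (\<Sum>i\<in>?G. w\<^sup>2 * (cmod (v (\<tau> i)))\<^sup>2)"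
      by (rule sum_mono) (auto simp: norm_mult power_mult_distrib intro!: mult_right_mono power_mono c)
    also have "\<dots> = w\<^sup>2 * (\<Sum>j\<in>\<tau> ` ?G. (cmod (v j))\<^sup>2)"
      by (subst sum.reindex) (auto simp: sum_distrib_left intro: inj_on_subset[OF inj])
    also have "\<dots> \<le> w\<^sup>2 * (\<Sum>j<n. (cmod (v j))\<^sup>2)"
      by (intro mult_left_mono sum_mono2) auto
    also have "\<dots> = (w * nrm n v)\<^sup>2"
      by (simp add: nrm_power2 power_mult_distrib)
    finally show "(nrm n (mv n ?N v))\<^sup>2 \<le> (w * nrm n v)\<^sup>2" .
  qed (use w in simp)
  then show ?thesis using w by (simp add: op_bounded_def)
qed

lemma op_bounded_diag:
  assumes "0 \<le> w" "\<And>i. i < n \<Longrightarrow> cmod (c i) \<le> w"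
  shows "op_bounded n w (\<lambda>i j. if i = j then c i else 0)"
proof -
  have "op_bounded n w (\<lambda>i j. if i \<in> UNIV \<and> j = i then c i else 0)"
    by (rule op_bounded_weighted_partial_injection) (use assms in auto)
  moreover have "(\<lambda>i j. if i \<in> UNIV \<and> j = i then c i else 0) = (\<lambda>i j. if i = j then c i else 0)"
    by (intro ext) auto
  ultimately show ?thesis by simp
qed

lemma low_rank_cong:
  "(\<And>i j. i < n \<Longrightarrow> j < n \<Longrightarrow> A i j = B i j) \<Longrightarrow> low_rank n r A \<Longrightarrow> low_rank n r B"
  by (simp add: low_rank_def)

lemma low_rank_mono:
  assumes "low_rank n r A" "r \<le> r'"
  shows "low_rank n r' A"
proof -
  from assms(1) obtain k x y where "real k \<le> r" "\<forall>i<n. \<forall>j<n. A i j = (\<Sum>l<k. x l i * y l j)"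
    unfolding low_rank_def by blast
  then show ?thesis unfolding low_rank_def using assms(2)
    by (intro exI[of _ k] exI[of _ x] exI[of _ y]) auto
qed

lemma low_rank_zero: "0 \<le> r \<Longrightarrow> low_rank n r (\<lambda>i j. 0)"
  unfolding low_rank_def by (intro exI[of _ "0::nat"]) auto

lemma low_rank_scale: "low_rank n r A \<Longrightarrow> low_rank n r (\<lambda>i j. c * A i j)"
proof -
  assume "low_rank n r A"
  then obtain k x y where "real k \<le> r" "\<forall>i<n. \<forall>j<n. A i j = (\<Sum>l<k. x l i * y l j)"
    unfolding low_rank_def by blast
  then show ?thesis unfolding low_rank_def
    by (intro exI[of _ k] exI[of _ "\<lambda>l i. c * x l i"] exI[of _ y]) (auto simp: sum_distrib_left mult_ac)
qed

lemma low_rank_add: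
  assumes "low_rank n r A" "low_rank n r' B"
  shows "low_rank n (r + r') (\<lambda>i j. A i j + B i j)"
proof -
  from assms obtain k x y k' x' y' where
    A: "real k \<le> r" "\<forall>i<n. \<forall>j<n. A i j = (\<Sum>l<k. x l i * y l j)" and
    B: "real k' \<le> r'" "\<forall>i<n. \<forall>j<n. B i j = (\<Sum>l<k'. x' l i * y' l j)"
    unfolding low_rank_def by blast
  let ?x = "\<lambda>l. if l < k then x l else x' (l - k)"
  let ?y = "\<lambda>l. if l < k then y l else y' (l - k)"
  have "A i j + B i j = (\<Sum>l<k + k'. ?x l i * ?y l j)" if "i < n" "j < n" for i j
  proof -
    have *: "(\<Sum>l<k + k'. g l) = (\<Sum>l<k. g l) + (\<Sum>l<k'. g (k + l))" for g :: "nat \<Rightarrow> complex"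
      by (induction k') (auto simp: algebra_simps)
    show ?thesis unfolding * using A B that by simp
  qed
  then show ?thesis unfolding low_rank_def
    by (intro exI[of _ "k + k'"] exI[of _ ?x] exI[of _ ?y]) (use A B in auto)
qed

lemma low_rank_mult_right: 
  assumes "low_rank n r A"
  shows "low_rank n r (mm n A B)"
proof -
  from assms obtain k x y where A: "real k \<le> r" "\<forall>i<n. \<forall>j<n. A i j = (\<Sum>l<k. x l i * y l j)"
    unfolding low_rank_def by blast
  have "mm n A B i j = (\<Sum>l<k. x l i * (\<Sum>p<n. y l p * B p j))" if "i < n" "j < n" for i j
  proof -
    have "mm n A B i j = (\<Sum>p<n. \<Sum>l<k. x l i * y l p * B p j)"
      using A that by (simp add: mm_def sum_distrib_right)
    also have "\<dots> = (\<Sum>l<k. \<Sum>p<n. x l i * y l p * B p j)" by (rule sum.swap)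
    finally show ?thesis by (simp add: sum_distrib_left mult.assoc)
  qed
  then show ?thesis unfolding low_rank_def using A(1)
    by (intro exI[of _ k] exI[of _ x] exI[of _ "\<lambda>l j. \<Sum>p<n. y l p * B p j"]) auto
qed

lemma low_rank_mult_left: 
  assumes "low_rank n r B"
  shows "low_rank n r (mm n A B)"
proof -
  from assms obtain k x y where B: "real k \<le> r" "\<forall>i<n. \<forall>j<n. B i j = (\<Sum>l<k. x l i * y l j)"
    unfolding low_rank_def by blast
  have "mm n A B i j = (\<Sum>l<k. (\<Sum>p<n. A i p * x l p) * y l j)" if "i < n" "j < n" for i j
  proof -
    have "mm n A B i j = (\<Sum>p<n. \<Sum>l<k. A i p * x l p * y l j)"
      using B that by (simp add: mm_def sum_distrib_left mult.assoc)
    also have "\<dots> = (\<Sum>l<k. \<Sum>p<n. A i p * x l p * y l j)" by (rule sum.swap)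
    finally show ?thesis by (simp add: sum_distrib_right)
  qed
  then show ?thesis unfolding low_rank_def using B(1)
    by (intro exI[of _ k] exI[of _ "\<lambda>l i. \<Sum>p<n. A i p * x l p"] exI[of _ y]) auto
qed

text \<open>\<open>R\<close> is the sum over \<open>s\<close> in \<open>S\<close> of the unit vector
  at \<open>s\<close> times the row \<open>s\<close>, one dyad for each row that may be
  nonzero.\<close>

lemma low_rank_rows:
  assumes "finite S" "real (card S) \<le> r" "\<And>i j. i < n \<Longrightarrow> j < n \<Longrightarrow> i \<notin> S \<Longrightarrow> R i j = 0"
  shows "low_rank n r R"
proof -
  from ex_bij_betw_nat_finite[OF assms(1)] obtain e where e: "bij_betw e {..<card S} S"
    by (auto simp: atLeast0LessThan)
  have "R i j = (\<Sum>l<card S. (if e l = i then 1 else 0) * R (e l) j)" if "i < n" "j < n" for i j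
  proof -
    have "(\<Sum>l<card S. (if e l = i then 1 else 0) * R (e l) j) = (\<Sum>s\<in>S. (if s = i then 1 else 0) * R s j)"
      by (rule sum.reindex_bij_betw[OF e])
    also have "\<dots> = (\<Sum>s\<in>S. if i = s then R s j else 0)"
      by (rule sum.cong) auto
    also have "\<dots> = R i j"
      using assms(1,3) that by simp
    finally show ?thesis by simp
  qed
  then show ?thesis unfolding low_rank_def
    by (intro exI[of _ "card S"] exI[of _ "\<lambda>l i. if e l = i then 1 else 0"] exI[of _ "\<lambda>l. R (e l)"])
      (use assms in auto)
qed

lemma splits_cong:
  "(\<And>i j. i < n \<Longrightarrow> j < n \<Longrightarrow> A i j = B i j) \<Longrightarrow> splits n r w A \<Longrightarrow> splits n r w B"
  by (simp add: splits_def)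

lemma splits_low_rank_op_bounded: "low_rank n r R \<Longrightarrow> op_bounded n w N \<Longrightarrow> splits n r w (\<lambda>i j. R i j + N i j)"
  unfolding splits_def by (intro exI[of _ R] exI[of _ N]) simp

lemma splits_mono: "splits n r w A \<Longrightarrow> r \<le> r' \<Longrightarrow> w \<le> w' \<Longrightarrow> splits n r' w' A"
  unfolding splits_def by (blast intro: low_rank_mono op_bounded_mono)

lemma splits_zero: "0 \<le> r \<Longrightarrow> 0 \<le> w \<Longrightarrow> splits n r w (\<lambda>i j. 0)"
  unfolding splits_def by (intro exI[of _ "\<lambda>i j. 0"]) (auto simp: low_rank_zero op_bounded_zero)

lemma splits_op_bounded: "op_bounded n w A \<Longrightarrow> 0 \<le> r \<Longrightarrow> splits n r w A"
  unfolding splits_def by (intro exI[of _ "\<lambda>i j. 0"] exI[of _ A]) (auto simp: low_rank_zero)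

lemma splits_add:
  assumes "splits n r w A" "splits n r' w' B"
  shows "splits n (r + r') (w + w') (\<lambda>i j. A i j + B i j)"
proof -
  from assms obtain R N R' N' where
    A: "\<forall>i<n. \<forall>j<n. A i j = R i j + N i j" "low_rank n r R" "op_bounded n w N" and
    B: "\<forall>i<n. \<forall>j<n. B i j = R' i j + N' i j" "low_rank n r' R'" "op_bounded n w' N'"
    unfolding splits_def by blast
  then show ?thesis unfolding splits_def
    by (intro exI[of _ "\<lambda>i j. R i j + R' i j"] exI[of _ "\<lambda>i j. N i j + N' i j"] conjI low_rank_add op_bounded_add)
       auto
qed

lemma splits_scale:
  assumes "splits n r w A"
  shows "splits n r (cmod c * w) (\<lambda>i j. c * A i j)"
proof -
  from assms obtain R N where
    A: "\<forall>i<n. \<forall>j<n. A i j = R i j + N i j" "low_rank n r R" "op_bounded n w N"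
    unfolding splits_def by blast
  then show ?thesis unfolding splits_def
    by (intro exI[of _ "\<lambda>i j. c * R i j"] exI[of _ "\<lambda>i j. c * N i j"] conjI low_rank_scale op_bounded_scale)
       (auto simp: algebra_simps)
qed

text \<open>In (R + N)(R' + N') = R B + N R' + N N' the first two products inherit low rank from
  \<open>R\<close> and \<open>R'\<close>, however large the other factors are; only N N' has to be
  bounded in norm.\<close>

lemma splits_mult:
  assumes "splits n r w A" "splits n r' w' B"
  shows "splits n (r + r') (w * w') (mm n A B)"
proof -
  from assms obtain R N R' N' where
    A: "\<forall>i<n. \<forall>j<n. A i j = R i j + N i j" "low_rank n r R" "op_bounded n w N" and
    B: "\<forall>i<n. \<forall>j<n. B i j = R' i j + N' i j" "low_rank n r' R'" "op_bounded n w' N'"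
    unfolding splits_def by blast
  have "mm n A B i j = (mm n R B i j + mm n N R' i j) + mm n N N' i j" if "i < n" "j < n" for i j
    using A B that by (simp add: mm_def algebra_simps sum.distrib)
  then show ?thesis unfolding splits_def
    by (intro exI[of _ "\<lambda>i j. mm n R B i j + mm n N R' i j"] exI[of _ "mm n N N'"] conjI
        low_rank_add op_bounded_mult low_rank_mult_left low_rank_mult_right A B) auto
qed

text \<open>The entries larger than \<open>w\<close> go to the low rank part, one row for
  each.\<close>

lemma splits_diag:
  assumes "0 \<le> w" "real (card {i. i < n \<and> w < cmod (d i)}) \<le> r"
  shows "splits n r w (\<lambda>i j. if i = j then d i else 0)"
proof -
  let ?S = "{i. i < n \<and> w < cmod (d i)}"
  have "low_rank n r (\<lambda>i j. if i = j \<and> i \<in> ?S then d i else 0)"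
    by (rule low_rank_rows[of ?S]) (use assms in auto)
  moreover have "op_bounded n w (\<lambda>i j. if i = j then (if i \<in> ?S then 0 else d i) else 0)"
    by (rule op_bounded_diag) (use assms in auto)
  ultimately show ?thesis unfolding splits_def
    by (intro exI[of _ "\<lambda>i j. if i = j \<and> i \<in> ?S then d i else 0"]
      exI[of _ "\<lambda>i j. if i = j then (if i \<in> ?S then 0 else d i) else 0"]) auto
qed

subsection \<open>Positive semidefinite matrices of small trace\<close>

definition hform :: "nat \<Rightarrow> cmfun \<Rightarrow> (nat \<Rightarrow> complex) \<Rightarrow> (nat \<Rightarrow> complex) \<Rightarrow> complex" where
  "hform n M u v = (\<Sum>i<n. \<Sum>j<n. cnj (u i) * M i j * v j)"

definition psd :: "nat \<Rightarrow> cmfun \<Rightarrow> bool" where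
  "psd n M \<longleftrightarrow> (\<forall>i<n. \<forall>j<n. M j i = cnj (M i j)) \<and> (\<forall>v. 0 \<le> Re (hform n M v v))"

lemma psd_form_nonneg: "psd n M \<Longrightarrow> 0 \<le> Re (hform n M v v)"
  unfolding psd_def by blast

lemma psd_hermitian: "psd n M \<Longrightarrow> i < n \<Longrightarrow> j < n \<Longrightarrow> M j i = cnj (M i j)"
  unfolding psd_def by blast

lemma hform_mv: "hform n M u v = (\<Sum>i<n. cnj (u i) * mv n M v i)"
  by (simp add: hform_def mv_def sum_distrib_left mult.assoc)

lemma hform_diff_scale:
  "hform n M (\<lambda>i. u i - s * v i) (\<lambda>i. u i - s * v i) =
   hform n M u u - s * hform n M u v - cnj s * hform n M v u + s * cnj s * hform n M v v"
  by (simp add: hform_def algebra_simps sum.distrib sum_subtractf sum_distrib_left)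

lemma psd_hform_cnj:
  assumes "psd n M"
  shows "hform n M v u = cnj (hform n M u v)"
proof -
  have "cnj (hform n M u v) = (\<Sum>i<n. \<Sum>j<n. u i * M j i * cnj (v j))"
    unfolding hform_def cnj_sum using assms by (intro sum.cong refl) (simp add: psd_hermitian[OF assms, symmetric])
  also have "\<dots> = (\<Sum>j<n. \<Sum>i<n. u i * M j i * cnj (v j))" by (rule sum.swap)
  finally show ?thesis by (simp add: hform_def mult_ac)
qed

lemma psd_hform_real:
  assumes "psd n M"
  shows "hform n M v v = of_real (Re (hform n M v v))"
  using psd_hform_cnj[OF assms, of v v] by (metis Reals_cnj_iff of_real_Re)

text \<open>The diagonal entries are the values of the form at the unit vectors. This lower bound is
  what stops the repeated reduction of the trace below.\<close>

lemma psd_trace_nonneg: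
  assumes "psd n M"
  shows "0 \<le> (\<Sum>i<n. Re (M i i))"
proof (rule sum_nonneg)
  fix i assume i: "i \<in> {..<n}"
  have "hform n M (\<lambda>j. if j = i then 1 else 0) (\<lambda>j. if j = i then 1 else 0) =
      (\<Sum>a<n. \<Sum>b<n. if b = i then (if a = i then M a b else 0) else 0)"
    unfolding hform_def by (intro sum.cong refl) auto
  also have "\<dots> = M i i" using i by simp
  finally have "hform n M (\<lambda>j. if j = i then 1 else 0) (\<lambda>j. if j = i then 1 else 0) = M i i" .
  then show "0 \<le> Re (M i i)" using psd_form_nonneg[OF assms] by metis
qed

lemma hform_self_mv: "hform n M (mv n M v) v = of_real ((nrm n (mv n M v))\<^sup>2)"
  unfolding hform_mv nrm_power2 of_real_sum
  by (intro sum.cong refl) (simp add: complex_norm_square mult.commute del: of_real_power)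

text \<open>Apply positivity to the form at \<open>M v - x v\<close> for a suitable real \<open>x\<close>.\<close>

lemma psd_op_bounded:
  assumes psd: "psd n M" and t: "0 < t" and q: "\<And>v. Re (hform n M v v) \<le> t * (nrm n v)\<^sup>2"
  shows "op_bounded n t M"
proof -
  have "nrm n (mv n M v) \<le> t * nrm n v" for v
  proof (rule power2_le_imp_le)
    let ?u = "mv n M v"
    let ?H = "(nrm n ?u)\<^sup>2" and ?V = "(nrm n v)\<^sup>2"
    have key: "0 \<le> t * ?H - 2 * x * ?H + x\<^sup>2 * (t * ?V)" for x :: real
    proof -
      have uv: "hform n M ?u v = of_real ?H" "hform n M v ?u = of_real ?H"
        using psd_hform_cnj[OF psd, of v ?u] by (simp_all add: hform_self_mv)
      have "0 \<le> Re (hform n M (\<lambda>i. ?u i - of_real x * v i) (\<lambda>i. ?u i - of_real x * v i))"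
        by (rule psd_form_nonneg[OF psd])
      then have "0 \<le> Re (hform n M ?u ?u) - 2 * x * ?H + x\<^sup>2 * Re (hform n M v v)"
        unfolding hform_diff_scale uv power2_eq_square[of x] by (simp del: of_real_power)
      moreover have "x\<^sup>2 * Re (hform n M v v) \<le> x\<^sup>2 * (t * ?V)"
        by (rule mult_left_mono[OF q]) simp
      ultimately show ?thesis using q[of ?u] by linarith
    qed
    show "?H \<le> (t * nrm n v)\<^sup>2"
    proof (cases "?V = 0")
      case True
      then have "\<forall>j<n. v j = 0" by (simp add: nrm_power2 sum_nonneg_eq_0_iff)
      then have "\<And>i. ?u i = 0" by (simp add: mv_def)
      then show ?thesis by (simp add: nrm_power2)
    next
      case False
      then have V: "?V > 0" by simp
      \<comment> \<open>At \<open>x = t\<close> the inequality reduces to t |Mv|^2 <= t^3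
        |v|^2.\<close>
      have "0 \<le> t * ?H - 2 * t * ?H + t\<^sup>2 * (t * ?V)" using key[of t] by simp
      then have "t * ?H \<le> t * (t\<^sup>2 * ?V)" by (simp add: algebra_simps)
      then show ?thesis using t by (simp add: power_mult_distrib)
    qed
  qed (use t in simp)
  then show ?thesis using t by (simp add: op_bounded_def)
qed

text \<open>If \<open>\<langle>M v, v\<rangle> > t |v|\<^sup>2\<close>, the Schur complement
  \<open>M - (M v)(M v)\<^sup>*/\<langle>M v, v\<rangle>\<close> is again positive semidefinite and its trace
  is smaller by at least \<open>t\<close>.\<close>

lemma psd_step:
  assumes psd: "psd n M" and t: "0 < t" and v: "t * (nrm n v)\<^sup>2 < Re (hform n M v v)"
  obtains M' where "psd n M'" "(\<Sum>i<n. Re (M' i i)) \<le> (\<Sum>i<n. Re (M i i)) - t"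
    "low_rank n 1 (\<lambda>i j. M i j - M' i j)"
proof -
  define q where "q = Re (hform n M v v)"
  define u where "u = mv n M v"
  define M' where "M' i j = M i j - u i * cnj (u j) / of_real q" for i j
  have q: "0 < q" using v t le_less_trans[of 0 "t * (nrm n v)\<^sup>2"] by (simp add: q_def)
  have qc: "hform n M v v = of_real q" using psd_hform_real[OF psd] by (simp add: q_def)
  have u: "hform n M w v = (\<Sum>i<n. cnj (w i) * u i)" for w
    by (simp add: hform_mv u_def)
  \<comment> \<open>Completing the square: the form of \<open>M'\<close> at \<open>w\<close> is the
    form of \<open>M\<close> at the component of \<open>w\<close> that is orthogonal to
    \<open>v\<close> with respect to \<open>M\<close>. Positivity of \<open>M'\<close> follows at
    once.\<close>
  have M'_form: "hform n M' w w = hform n M (\<lambda>i. w i - cnj (hform n M w v) / of_real q * v i)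
      (\<lambda>i. w i - cnj (hform n M w v) / of_real q * v i)" for w
  proof -
    have "hform n M' w w = hform n M w w - (\<Sum>i<n. \<Sum>j<n. (cnj (w i) * u i) * (w j * cnj (u j))) / of_real q"
      by (simp add: hform_def M'_def algebra_simps sum_subtractf sum_divide_distrib)
    also have "(\<Sum>i<n. \<Sum>j<n. (cnj (w i) * u i) * (w j * cnj (u j))) =
        (\<Sum>i<n. cnj (w i) * u i) * (\<Sum>j<n. w j * cnj (u j))"
      by (simp add: sum_product)
    also have "(\<Sum>j<n. w j * cnj (u j)) = cnj (hform n M w v)"
      by (simp add: u)
    also have "(\<Sum>i<n. cnj (w i) * u i) = hform n M w v" by (simp add: u)
    finally show ?thesis
      unfolding hform_diff_scale psd_hform_cnj[OF psd, of v w] qc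
      using q by (simp add: field_simps) (metis distrib_left)
  qed
  have "psd n M'"
    unfolding psd_def
  proof (intro conjI allI impI)
    show "M' j i = cnj (M' i j)" if "i < n" "j < n" for i j
      using psd_hermitian[OF psd that] by (simp add: M'_def mult.commute)
    show "0 \<le> Re (hform n M' w w)" for w
      unfolding M'_form by (rule psd_form_nonneg[OF psd])
  qed
  moreover have "(\<Sum>i<n. Re (M' i i)) \<le> (\<Sum>i<n. Re (M i i)) - t"
  proof -
    \<comment> \<open>The trace drops by |u|^2 / q. Cauchy-Schwarz gives q <= |v| |u|, and the
      hypothesis t |v|^2 < q turns this into t <= |u|^2 / q.\<close>
    have "q = cmod (hform n M v v)" using qc q by simp
    also have "\<dots> \<le> (\<Sum>i<n. cmod (v i) * cmod (u i))"
      unfolding u by (rule order_trans[OF norm_sum]) (simp add: norm_mult)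
    also have "\<dots> \<le> nrm n v * nrm n u"
      unfolding nrm_def using L2_set_mult_ineq[of "\<lambda>i. cmod (v i)" "\<lambda>i. cmod (u i)" "{..<n}"] by simp
    finally have "q\<^sup>2 \<le> (nrm n v * nrm n u)\<^sup>2" using q by (intro power_mono) auto
    then have "t * q\<^sup>2 \<le> (t * (nrm n v)\<^sup>2) * (nrm n u)\<^sup>2"
      using t by (simp add: power_mult_distrib)
    also have "\<dots> \<le> q * (nrm n u)\<^sup>2"
      using v by (intro mult_right_mono) (auto simp: q_def)
    finally have "t \<le> (nrm n u)\<^sup>2 / q" using q by (simp add: power2_eq_square field_simps)
    also have "(nrm n u)\<^sup>2 / q = (\<Sum>i<n. Re (u i * cnj (u i) / of_real q))"
      unfolding nrm_power2 sum_divide_distrib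
      by (intro sum.cong refl) (simp add: cmod_power2 Re_divide_of_real, simp add: power2_eq_square)
    finally show ?thesis by (simp add: M'_def sum_subtractf)
  qed
  moreover have "low_rank n 1 (\<lambda>i j. M i j - M' i j)"
    unfolding low_rank_def
    by (intro exI[of _ "1::nat"] exI[of _ "\<lambda>_. u"] exI[of _ "\<lambda>_ j. cnj (u j) / of_real q"]) (auto simp: M'_def)
  ultimately show thesis by (rule that)
qed

text \<open>Each vector at which the form exceeds t |v|^2 costs one dyad and lowers the trace by at
  least \<open>t\<close>. With trace below (k + 1) t this can happen at most \<open>k\<close> times:
  in the base case one more reduction would make the trace negative.\<close>

lemma psd_splits_nat:
  assumes "psd n M" "0 < t" "(\<Sum>i<n. Re (M i i)) < (real k + 1) * t"
  shows "splits n k t M"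
  using assms
proof (induction k arbitrary: M)
  case (0 M)
  show ?case
  proof (rule splits_op_bounded[OF psd_op_bounded[OF 0(1) 0(2)]])
    fix v
    show "Re (hform n M v v) \<le> t * (nrm n v)\<^sup>2"
    proof (rule ccontr)
      assume "\<not> Re (hform n M v v) \<le> t * (nrm n v)\<^sup>2"
      then have "t * (nrm n v)\<^sup>2 < Re (hform n M v v)" by (simp add: not_le)
      then obtain M' where M': "psd n M'" "(\<Sum>i<n. Re (M' i i)) \<le> (\<Sum>i<n. Re (M i i)) - t"
        "low_rank n 1 (\<lambda>i j. M i j - M' i j)"
        by (rule psd_step[OF 0(1,2)])
      then show False using psd_trace_nonneg[OF M'(1)] 0(3) by simp
    qed
  qed simp
next
  case (Suc k M)
  show ?case
  proof (cases "\<forall>v. Re (hform n M v v) \<le> t * (nrm n v)\<^sup>2")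
    case True
    then show ?thesis using Suc.prems by (intro splits_op_bounded[OF psd_op_bounded]) auto
  next
    case False
    then obtain v where "t * (nrm n v)\<^sup>2 < Re (hform n M v v)" by (auto simp: not_le)
    then obtain M' where M': "psd n M'" "(\<Sum>i<n. Re (M' i i)) \<le> (\<Sum>i<n. Re (M i i)) - t"
      "low_rank n 1 (\<lambda>i j. M i j - M' i j)"
      by (rule psd_step[OF Suc.prems(1,2)])
    have "splits n k t M'"
      using M'(2) Suc.prems by (intro Suc.IH[OF M'(1)]) (auto simp: algebra_simps)
    moreover have "splits n 1 0 (\<lambda>i j. M i j - M' i j)"
      unfolding splits_def using M'(3)
      by (intro exI[of _ "\<lambda>i j. M i j - M' i j"] exI[of _ "\<lambda>i j. 0"]) (auto simp: op_bounded_zero)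
    ultimately have "splits n (real k + 1) (t + 0) (\<lambda>i j. M' i j + (M i j - M' i j))"
      by (rule splits_add)
    then show ?thesis by (simp add: add.commute)
  qed
qed

text \<open>A matrix version of Markov's inequality: at most trace / t eigenvalues exceed
  \<open>t\<close>. It is obtained by the greedy reduction, so no spectral decomposition
  enters.\<close>

lemma psd_splits:
  assumes "psd n M" "0 < t" "(\<Sum>i<n. Re (M i i)) \<le> r * t"
  shows "splits n r t M"
proof -
  have "0 \<le> r * t" using psd_trace_nonneg[OF assms(1)] assms(3) by linarith
  then have r: "0 \<le> r" using assms(2) by (simp add: zero_le_mult_iff)
  have "(\<Sum>i<n. Re (M i i)) < (real (nat \<lfloor>r\<rfloor>) + 1) * t"
  proof -
    have "r < real (nat \<lfloor>r\<rfloor>) + 1" using r by linarith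
    then show ?thesis using assms(2,3) by (meson le_less_trans mult_strict_right_mono)
  qed
  then have "splits n (nat \<lfloor>r\<rfloor>) t M" by (rule psd_splits_nat[OF assms(1,2)])
  then show ?thesis by (rule splits_mono) (use r in auto)
qed

section \<open>Translation to the spectral norm and the rank of matrices\<close>

text \<open>A crude bound suffices: it serves to show that the set under the supremum in
  \<open>spectral_norm\<close> is bounded above.\<close>

lemma op_bounded_exists: "\<exists>w. op_bounded n w M"
proof -
  let ?w = "\<Sum>i<n. \<Sum>j<n. cmod (M i j)"
  have "nrm n (mv n M v) \<le> ?w * nrm n v" for v
  proof -
    have "nrm n (mv n M v) \<le> (\<Sum>i<n. cmod (mv n M v i))"
      unfolding nrm_def by (rule L2_set_le_sum) simp
    also have "\<dots> \<le> (\<Sum>i<n. \<Sum>j<n. cmod (M i j) * nrm n v)"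
    proof (rule sum_mono)
      fix i
      have "cmod (mv n M v i) \<le> (\<Sum>j<n. cmod (M i j * v j))"
        unfolding mv_def by (rule norm_sum)
      also have "\<dots> \<le> (\<Sum>j<n. cmod (M i j) * nrm n v)"
      proof (rule sum_mono)
        fix j assume "j \<in> {..<n}"
        then have "cmod (v j) \<le> nrm n v"
          unfolding nrm_def by (intro member_le_L2_set) auto
        then show "cmod (M i j * v j) \<le> cmod (M i j) * nrm n v"
          by (simp add: norm_mult mult_left_mono)
      qed
      finally show "cmod (mv n M v i) \<le> (\<Sum>j<n. cmod (M i j) * nrm n v)" .
    qed
    finally show ?thesis by (simp add: sum_distrib_right)
  qed
  then have "op_bounded n ?w M" by (simp add: op_bounded_def sum_nonneg)
  then show ?thesis by blast
qed

lemma vec_norm2_nrm: "v \<in> carrier_vec n \<Longrightarrow> vec_norm2 v = nrm n (\<lambda>i. v $ i)"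
  by (simp add: vec_norm2_def nrm_def)

lemma vec_norm2_mult_mat_vec:
  assumes "N \<in> carrier_mat n n" "v \<in> carrier_vec n"
  shows "vec_norm2 (N *\<^sub>v v) = nrm n (mv n (\<lambda>i j. N $$ (i, j)) (\<lambda>i. v $ i))"
proof -
  have "vec_norm2 (N *\<^sub>v v) = nrm n (\<lambda>i. (N *\<^sub>v v) $ i)"
    using assms by (intro vec_norm2_nrm) auto
  also have "\<dots> = nrm n (mv n (\<lambda>i j. N $$ (i, j)) (\<lambda>i. v $ i))"
    by (rule nrm_cong) (use assms in \<open>simp add: mv_def scalar_prod_def atLeast0LessThan\<close>)
  finally show ?thesis .
qed

lemma spectral_norm_le:
  assumes N: "N \<in> carrier_mat n n" and w: "op_bounded n w (\<lambda>i j. N $$ (i, j))"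
  shows "spectral_norm N \<le> w"
  unfolding spectral_norm_def
proof (rule cSUP_least)
  have "vec_norm2 (0\<^sub>v n) = 0" by (simp add: vec_norm2_def L2_set_def)
  then show "{v \<in> carrier_vec (dim_col N). vec_norm2 v \<le> 1} \<noteq> {}"
    using N by (auto intro!: exI[of _ "0\<^sub>v n"])
next
  fix v assume "v \<in> {v \<in> carrier_vec (dim_col N). vec_norm2 v \<le> 1}"
  then have v: "v \<in> carrier_vec n" "nrm n (\<lambda>i. v $ i) \<le> 1" using N by (auto simp: vec_norm2_nrm)
  have "vec_norm2 (N *\<^sub>v v) \<le> w * nrm n (\<lambda>i. v $ i)"
    using w by (simp add: vec_norm2_mult_mat_vec[OF N v(1)] op_bounded_def)
  also have "\<dots> \<le> w * 1" using v w by (intro mult_left_mono) (auto simp: op_bounded_def)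
  finally show "vec_norm2 (N *\<^sub>v v) \<le> w" by simp
qed

text \<open>By homogeneity it is enough to look at vectors of norm 1. Together with
  \<open>spectral_norm_le\<close> this makes \<open>spectral_norm\<close> the least bound in the
  sense of \<open>op_bounded\<close>.\<close>

lemma op_bounded_spectral_norm:
  assumes N: "N \<in> carrier_mat n n"
  shows "op_bounded n (spectral_norm N) (\<lambda>i j. N $$ (i, j))"
proof -
  let ?N = "\<lambda>i j. N $$ (i, j)"
  let ?B = "{v \<in> carrier_vec (dim_col N). vec_norm2 v \<le> 1}"
  obtain c where c: "op_bounded n c ?N" using op_bounded_exists by blast
  have "bdd_above ((\<lambda>v. vec_norm2 (N *\<^sub>v v)) ` ?B)"
  proof (rule bdd_aboveI2)
    fix v assume "v \<in> ?B"
    then have v: "v \<in> carrier_vec n" "nrm n (\<lambda>i. v $ i) \<le> 1" using N by (auto simp: vec_norm2_nrm)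
    have "vec_norm2 (N *\<^sub>v v) \<le> c * nrm n (\<lambda>i. v $ i)"
      using c by (simp add: vec_norm2_mult_mat_vec[OF N v(1)] op_bounded_def)
    also have "\<dots> \<le> c * 1" using v c by (intro mult_left_mono) (auto simp: op_bounded_def)
    finally show "vec_norm2 (N *\<^sub>v v) \<le> c" by simp
  qed
  then have up: "vec_norm2 (N *\<^sub>v v) \<le> spectral_norm N" if "v \<in> ?B" for v
    unfolding spectral_norm_def using that by (intro cSUP_upper) auto
  have zero: "0 \<le> spectral_norm N"
    using up[of "0\<^sub>v n"] N by (auto simp: vec_norm2_def L2_set_def elim!: order_trans[rotated] intro!: sum_nonneg)
  have "nrm n (mv n ?N v) \<le> spectral_norm N * nrm n v" for v
  proof (cases "nrm n v = 0")
    case True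
    then have "(nrm n v)\<^sup>2 = 0" by simp
    then have "\<forall>j<n. v j = 0" by (simp add: nrm_power2 sum_nonneg_eq_0_iff)
    then have "\<And>i. mv n ?N v i = 0" by (simp add: mv_def)
    then have "(nrm n (mv n ?N v))\<^sup>2 = 0" by (simp add: nrm_power2)
    then show ?thesis using True by simp
  next
    case False
    then have pos: "0 < nrm n v" using nrm_nonneg[of n v] by linarith
    define s where "s = complex_of_real (1 / nrm n v)"
    define x where "x = vec n (\<lambda>i. s * v i)"
    have x: "x \<in> carrier_vec n" by (simp add: x_def)
    have s: "cmod s = 1 / nrm n v" using pos by (simp add: s_def norm_divide)
    have "nrm n (\<lambda>i. x $ i) = nrm n (\<lambda>i. s * v i)"
      by (rule nrm_cong) (simp add: x_def)
    also have "\<dots> = 1" using pos by (simp add: nrm_scale s)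
    finally have "x \<in> ?B" using x N by (simp add: vec_norm2_nrm)
    then have "nrm n (mv n ?N (\<lambda>i. x $ i)) \<le> spectral_norm N"
      using up[of x] by (simp add: vec_norm2_mult_mat_vec[OF N x])
    moreover have "nrm n (mv n ?N (\<lambda>i. x $ i)) = nrm n (\<lambda>i. s * mv n ?N v i)"
      by (rule nrm_cong) (simp add: mv_def x_def sum_distrib_left mult_ac)
    ultimately show ?thesis using pos by (simp add: nrm_scale s field_simps)
  qed
  then show ?thesis using zero by (simp add: op_bounded_def)
qed

lemma spectral_norm_triangle:
  assumes "M \<in> carrier_mat n n" "N \<in> carrier_mat n n"
  shows "spectral_norm (M + N) \<le> spectral_norm M + spectral_norm N"
proof (rule spectral_norm_le)
  show "op_bounded n (spectral_norm M + spectral_norm N) (\<lambda>i j. (M + N) $$ (i, j))"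
    by (rule op_bounded_cong[OF _ op_bounded_add[OF op_bounded_spectral_norm[OF assms(1)] op_bounded_spectral_norm[OF assms(2)]]])
      (use assms in auto)
qed (use assms in auto)

lemma mat_rank_add:
  assumes "A \<in> carrier_mat n n" "B \<in> carrier_mat n n"
  shows "mat_rank (A + B) \<le> mat_rank A + mat_rank B"
  using vec_space.rank_subadditive[OF assms] assms by (simp add: mat_rank_def)

lemma mat_rank_sum_product:
  "mat_rank (Matrix.mat n n (\<lambda>(i, j). \<Sum>l<k. x l i * y l j)) \<le> k"
proof (induction k)
  case 0
  have *: "Matrix.mat n n (\<lambda>(i, j). \<Sum>l<0. x l i * y l j) = 0\<^sub>m n n" by (rule eq_matI) auto
  show ?case unfolding * by (simp add: mat_rank_def vec_space.rank_0I)
next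
  case (Suc k)
  let ?A = "Matrix.mat n n (\<lambda>(i, j). \<Sum>l<k. x l i * y l j)"
  let ?B = "Matrix.mat n n (\<lambda>(i, j). x k i * y k j)"
  have "Matrix.mat n n (\<lambda>(i, j). \<Sum>l<Suc k. x l i * y l j) = ?A + ?B" by (rule eq_matI) auto
  moreover have "mat_rank ?B \<le> 1"
    unfolding mat_rank_def dim_row_mat
    by (rule vec_space.rank_le_1_product_entries[where nc = n and f = "x k" and g = "y k"]) auto
  ultimately show ?case using Suc mat_rank_add[of ?A n ?B] by simp
qed

lemma mat_rank_le:
  assumes "R \<in> carrier_mat n n" "low_rank n r (\<lambda>i j. R $$ (i, j))"
  shows "real (mat_rank R) \<le> r"
proof -
  from assms(2) obtain k x y where
    k: "real k \<le> r" "\<forall>i<n. \<forall>j<n. R $$ (i, j) = (\<Sum>l<k. x l i * y l j)"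
    unfolding low_rank_def by blast
  have "R = Matrix.mat n n (\<lambda>(i, j). \<Sum>l<k. x l i * y l j)"
    by (rule eq_matI) (use k assms in auto)
  then have "mat_rank R \<le> k" using mat_rank_sum_product[where n = n and k = k and x = x and y = y] by simp
  then show ?thesis using k(1) by linarith
qed

lemma splits_mat:
  assumes "M \<in> carrier_mat n n" "splits n r w (\<lambda>i j. M $$ (i, j))"
  obtains R N where "R \<in> carrier_mat n n" "N \<in> carrier_mat n n" "M = R + N"
    "real (mat_rank R) \<le> r" "spectral_norm N \<le> w"
proof -
  from assms(2) obtain R N where RN: "\<forall>i<n. \<forall>j<n. M $$ (i, j) = R i j + N i j" "low_rank n r R" "op_bounded n w N"
    unfolding splits_def by blast
  let ?R = "Matrix.mat n n (\<lambda>(i, j). R i j)" and ?N = "Matrix.mat n n (\<lambda>(i, j). N i j)"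
  have "real (mat_rank ?R) \<le> r"
    by (rule mat_rank_le[of _ n]) (auto intro: low_rank_cong[OF _ RN(2)])
  moreover have "spectral_norm ?N \<le> w"
    by (rule spectral_norm_le[of _ n]) (auto intro: op_bounded_cong[OF _ RN(3)])
  moreover have "M = ?R + ?N" by (rule eq_matI) (use RN assms in auto)
  ultimately show thesis by (intro that[of ?R ?N]) auto
qed

subsection \<open>The block Fourier matrices\<close>

lemma sum_roots_of_unity:
  fixes q :: nat and s :: int
  assumes "0 < q"
  shows "(\<Sum>p<q. cis (2 * pi * of_int s * real p / real q)) = (if int q dvd s then of_nat q else 0)"
proof -
  define z where "z = cis (2 * pi * of_int s / real q)"
  have "(\<Sum>p<q. cis (2 * pi * of_int s * real p / real q)) = (\<Sum>p<q. z ^ p)"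
    by (intro sum.cong refl) (simp add: z_def Complex.DeMoivre mult_ac)
  moreover have "z ^ q = 1"
  proof -
    have "z ^ q = cis (2 * pi * of_int s)"
      using assms by (simp add: z_def Complex.DeMoivre)
    also have "\<dots> = 1" by (rule cis_multiple_2pi) simp
    finally show ?thesis .
  qed
  moreover have "z = 1 \<longleftrightarrow> int q dvd s"
  proof -
    have "z = exp (\<i> * of_real (2 * pi * of_int s / real q))" by (simp add: z_def cis_conv_exp)
    then have "z = 1 \<longleftrightarrow> (\<exists>n::int. 2 * pi * of_int s / real q = of_int (2 * n) * pi)"
      by (simp add: exp_eq_1)
    also have "\<dots> \<longleftrightarrow> (\<exists>n::int. real_of_int s = real_of_int (int q * n))"
      using assms by (intro arg_cong[of _ _ Ex] ext) (simp add: field_simps)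
    also have "\<dots> \<longleftrightarrow> int q dvd s" unfolding of_int_eq_iff dvd_def by simp
    finally show ?thesis .
  qed
  ultimately show ?thesis
    by (cases "z = 1") (simp_all add: geometric_sum)
qed

text \<open>The indices of block \<open>b\<close> are \<open>b * q + p\<close> with
  \<open>p < q\<close>; for \<open>q = 0\<close> there are none, and both sides vanish.\<close>

lemma sum_block:
  fixes g :: "nat \<Rightarrow> 'a::comm_monoid_add"
  assumes "b < m" "m * q \<le> n"
  shows "(\<Sum>l<n. if l < m * q \<and> l div q = b then g l else 0) = (\<Sum>p<q. g (b * q + p))"
proof (cases "q = 0")
  case False
  have "(Suc b) * q \<le> m * q" using assms by (intro mult_right_mono) auto
  then have bq: "b * q + q \<le> m * q" by simp
  have "(\<Sum>l<n. if l < m * q \<and> l div q = b then g l else 0) = (\<Sum>l\<in>{b*q..<b*q+q}. g l)"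
  proof (rule sum.mono_neutral_cong_right)
    show "\<forall>i\<in>{..<n} - {b * q..<b * q + q}. (if i < m * q \<and> i div q = b then g i else 0) = 0"
      using False by (auto simp: div_nat_eqI) (metis add.commute div_less_iff_less_mult dividend_less_div_times
        leD less_eq_div_iff_mult_less_eq linorder_not_less mult.commute mult_Suc order_refl not_gr_zero lessI times_div_less_eq_dividend)
    show "(if l < m * q \<and> l div q = b then g l else 0) = g l" if "l \<in> {b*q..<b*q+q}" for l
    proof -
      have "l div q = b" using that by (intro div_nat_eqI) (auto simp: mult.commute)
      moreover have "l < m * q" using that bq by auto
      ultimately show ?thesis by simp
    qed
  qed (use assms bq in auto)
  also have "\<dots> = (\<Sum>p<q. g (b * q + p))"
    using sum.shift_bounds_nat_ivl[of g 0 "b * q" q] by (simp add: atLeast0LessThan add.commute)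
  finally show ?thesis .
qed simp

text \<open>The induction strips the first block. The remaining indices are shifted by
  \<open>q\<close>, which lowers their \<open>div q\<close> by one and keeps their
  \<open>mod q\<close>.\<close>

lemma diag_block_replicate:
  assumes B: "B \<in> carrier_mat q q"
  shows "diag_block_mat (replicate m B @ [1\<^sub>m r]) \<in> carrier_mat (m * q + r) (m * q + r) \<and>
    (\<forall>i<m * q + r. \<forall>j<m * q + r. diag_block_mat (replicate m B @ [1\<^sub>m r]) $$ (i, j) =
      (if i < m * q \<and> j < m * q then (if i div q = j div q then B $$ (i mod q, j mod q) else 0)
       else if i = j then 1 else 0))"
proof (induction m)
  case 0
  then show ?case by (auto simp: one_mat_def)
next
  case (Suc m)
  let ?D = "diag_block_mat (replicate m B @ [1\<^sub>m r])"
  have D: "?D \<in> carrier_mat (m * q + r) (m * q + r)" using Suc by blast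
  have eq: "diag_block_mat (replicate (Suc m) B @ [1\<^sub>m r]) =
      four_block_mat B (0\<^sub>m q (m * q + r)) (0\<^sub>m (m * q + r) q) ?D"
    using B D by (simp add: Let_def)
  have "diag_block_mat (replicate (Suc m) B @ [1\<^sub>m r]) $$ (i, j) =
      (if i < Suc m * q \<and> j < Suc m * q then (if i div q = j div q then B $$ (i mod q, j mod q) else 0)
       else if i = j then 1 else 0)" if i: "i < Suc m * q + r" and j: "j < Suc m * q + r" for i j
  proof -
    have "diag_block_mat (replicate (Suc m) B @ [1\<^sub>m r]) $$ (i, j) =
       (if i < q then if j < q then B $$ (i, j) else 0 else if j < q then 0 else ?D $$ (i - q, j - q))"
      unfolding eq using i j B D by (subst index_mat_four_block) auto
    also have "\<dots> = (if i < Suc m * q \<and> j < Suc m * q then (if i div q = j div q then B $$ (i mod q, j mod q) else 0)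
       else if i = j then 1 else 0)"
    proof (cases "i < q")
      case True
      then have "i div q = 0" "i mod q = i" by auto
      then show ?thesis using True by (cases "j < q") (auto simp: div_eq_0_iff)
    next
      case False
      show ?thesis
      proof (cases "j < q")
        case True
        then have "j div q = 0" "j mod q = j" by auto
        then show ?thesis using True False by (auto simp: div_eq_0_iff)
      next
        case j2: False
        have *: "?D $$ (i - q, j - q) = (if i - q < m * q \<and> j - q < m * q then (if (i - q) div q = (j - q) div q then B $$ ((i - q) mod q, (j - q) mod q) else 0)
           else if i - q = j - q then 1 else 0)"
          using Suc i j False j2 by auto
        show ?thesis
        proof (cases "q = 0")
          case True
          then show ?thesis using False j2 D Suc i j by auto
        next
          case q: False
          have "i div q = Suc ((i - q) div q)" "j div q = Suc ((j - q) div q)"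
            using False j2 q by (auto simp: le_div_geq)
          moreover have "i mod q = (i - q) mod q" "j mod q = (j - q) mod q"
            using False j2 by (auto simp: le_mod_geq)
          moreover have "i < Suc m * q \<longleftrightarrow> i - q < m * q" "j < Suc m * q \<longleftrightarrow> j - q < m * q" "i - q = j - q \<longleftrightarrow> i = j"
            using False j2 by auto
          ultimately show ?thesis
            unfolding * using False j2 by (simp only: if_False nat.inject)
        qed
      qed
    qed
    finally show ?thesis .
  qed
  moreover have "diag_block_mat (replicate (Suc m) B @ [1\<^sub>m r]) \<in> carrier_mat (Suc m * q + r) (Suc m * q + r)"
    unfolding eq using four_block_carrier_mat[OF B D] by (simp add: add.assoc)
  ultimately show ?case by blast
qed

definition Q_entry :: "nat \<Rightarrow> nat \<Rightarrow> cmfun" where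
  "Q_entry n m i j = Q_mat n m $$ (i, j)"

lemma Q_mat_carrier: "Q_mat n m \<in> carrier_mat n n"
proof -
  have "dft_mat (n div m) \<in> carrier_mat (n div m) (n div m)" by (simp add: dft_mat_def)
  from diag_block_replicate[OF this, of m "n mod m"] show ?thesis by (simp add: Q_mat_def)
qed

lemma Q_entry_eq:
  assumes "i < n" "j < n"
  shows "Q_entry n m i j =
    (if i < m * (n div m) \<and> j < m * (n div m) then
       (if i div (n div m) = j div (n div m)
        then cis (- 2 * pi * real (i mod (n div m)) * real (j mod (n div m)) / real (n div m)) / of_real (sqrt (real (n div m)))
        else 0)
     else if i = j then 1 else 0)"
proof -
  let ?q = "n div m"
  have c: "dft_mat ?q \<in> carrier_mat ?q ?q" by (simp add: dft_mat_def)
  have "dft_mat ?q $$ (i mod ?q, j mod ?q) =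
      cis (- 2 * pi * real (i mod ?q) * real (j mod ?q) / real ?q) / of_real (sqrt (real ?q))"
    if "i < m * ?q"
  proof -
    have "0 < ?q" using that by (cases "?q = 0") auto
    then show ?thesis by (simp add: dft_mat_def cis_conv_exp mult_ac)
  qed
  then show ?thesis
    using diag_block_replicate[OF c, of m "n mod m"] assms by (auto simp: Q_mat_def Q_entry_def)
qed

text \<open>The entries of Q diag(d) Q^* for Q = \<open>Q_mat n m\<close>.\<close>

definition Q_conj :: "nat \<Rightarrow> nat \<Rightarrow> (nat \<Rightarrow> complex) \<Rightarrow> cmfun" where
  "Q_conj n m d i j = (\<Sum>l<n. Q_entry n m i l * d l * cnj (Q_entry n m j l))"

text \<open>A diagonal matrix conjugated by a Fourier matrix is circulant: inside a block the entry
  depends on j - i only and is an inverse discrete Fourier transform of the values of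
  \<open>d\<close> in that block. The trailing identity block leaves \<open>d\<close>
  unchanged.\<close>

lemma Q_conj_eq:
  assumes "i < n" "j < n"
  shows "Q_conj n m d i j =
    (if i < m * (n div m) \<and> j < m * (n div m) then
       (if i div (n div m) = j div (n div m)
        then (\<Sum>p<n div m. cis (2 * pi * of_int (int j - int i) * real p / real (n div m)) * d (i div (n div m) * (n div m) + p)) / of_nat (n div m)
        else 0)
     else if i = j then d i else 0)"
proof -
  let ?q = "n div m" and ?Q = "Q_entry n m"
  have mq: "m * ?q \<le> n" by simp
  show ?thesis
  proof (cases "i < m * ?q \<and> j < m * ?q \<and> i div ?q = j div ?q")
    case True
    then have q: "0 < ?q" by (cases "?q = 0") auto
    have b: "i div ?q < m" using True q by (simp add: div_less_iff_less_mult)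
    have "Q_conj n m d i j = (\<Sum>l<n. if l < m * ?q \<and> l div ?q = i div ?q then 
        cis (2 * pi * (real (j mod ?q) - real (i mod ?q)) * real (l mod ?q) / real ?q) * d l / of_nat ?q else 0)"
      unfolding Q_conj_def
    proof (rule sum.cong)
      fix l assume l: "l \<in> {..<n}"
      show "?Q i l * d l * cnj (?Q j l) = (if l < m * ?q \<and> l div ?q = i div ?q then 
        cis (2 * pi * (real (j mod ?q) - real (i mod ?q)) * real (l mod ?q) / real ?q) * d l / of_nat ?q else 0)"
      proof (cases "l < m * ?q \<and> l div ?q = i div ?q")
        case l2: True
        have "of_real (sqrt (real ?q)) * of_real (sqrt (real ?q)) = (of_nat ?q :: complex)"
          by (simp flip: of_real_mult)
        moreover have "cis (- 2 * pi * real (i mod ?q) * real (l mod ?q) / real ?q) *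
            cis (2 * pi * real (j mod ?q) * real (l mod ?q) / real ?q) =
            cis (2 * pi * (real (j mod ?q) - real (i mod ?q)) * real (l mod ?q) / real ?q)"
          unfolding cis_mult by (intro arg_cong[of _ _ cis]) (simp add: field_simps flip: add_divide_distrib)
        ultimately show ?thesis
          using Q_entry_eq[OF assms(1), of l m] Q_entry_eq[OF assms(2), of l m] True l2 l
          by (simp add: cis_cnj mult_ac)
      next
        case l2: False
        then show ?thesis
          using Q_entry_eq[OF assms(1), of l m] Q_entry_eq[OF assms(2), of l m] True l by auto
      qed
    qed simp
    also have "\<dots> = (\<Sum>p<?q. cis (2 * pi * (real (j mod ?q) - real (i mod ?q)) * real ((i div ?q * ?q + p) mod ?q) / real ?q) *
        d (i div ?q * ?q + p) / of_nat ?q)"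
      by (rule sum_block[OF b mq])
    also have "\<dots> = (\<Sum>p<?q. cis (2 * pi * of_int (int j - int i) * real p / real ?q) * d (i div ?q * ?q + p) / of_nat ?q)"
    proof -
      have "real j = real (j div ?q * ?q) + real (j mod ?q)" "real i = real (i div ?q * ?q) + real (i mod ?q)"
        by (metis div_mult_mod_eq of_nat_add)+
      then have "real (j mod ?q) - real (i mod ?q) = of_int (int j - int i)" using True by simp
      then show ?thesis by simp
    qed
    finally show ?thesis using True by (simp add: sum_divide_distrib)
  next
    case False
    have zero: "?Q i l * d l * cnj (?Q j l) = (if l = i \<and> l = j then d i else 0)" if l: "l < n" for l
      using Q_entry_eq[OF assms(1) l, of m] Q_entry_eq[OF assms(2) l, of m] False by auto
    have "Q_conj n m d i j = (\<Sum>l<n. if l = i then (if l = j then d i else 0) else 0)"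
      unfolding Q_conj_def by (rule sum.cong) (auto simp: zero)
    also have "\<dots> = (if i = j then d i else 0)" using assms by simp
    finally show ?thesis using False by auto
  qed
qed

text \<open>This is Q Q^* = I. Inside one block of size q, a difference j - i divisible by q is
  zero, so only the diagonal survives the sum over roots of unity.\<close>

lemma Q_conj_one:
  assumes "i < n" "j < n"
  shows "Q_conj n m (\<lambda>_. 1) i j = (if i = j then 1 else 0)"
proof -
  let ?q = "n div m"
  have "i = j" if "i div ?q = j div ?q" "int ?q dvd int j - int i"
  proof -
    from that(2) have "int j mod int ?q = int i mod int ?q" by (simp add: mod_eq_dvd_iff)
    then have "j mod ?q = i mod ?q" by (metis of_nat_eq_iff of_nat_mod)
    then show ?thesis using that(1) by (metis div_mult_mod_eq)
  qed
  moreover have "0 < ?q" if "i < m * ?q" using that by (cases "?q = 0") auto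
  ultimately show ?thesis
    using sum_roots_of_unity[of ?q "int j - int i"] by (auto simp: Q_conj_eq[OF assms])
qed

lemma mat_adjoint_carrier: "A \<in> carrier_mat nr nc \<Longrightarrow> mat_adjoint A \<in> carrier_mat nc nr"
  unfolding mat_adjoint_def by (intro carrier_matI) auto

lemma mat_adjoint_index:
  "i < dim_col A \<Longrightarrow> j < dim_row A \<Longrightarrow> mat_adjoint A $$ (i, j) = cnj (A $$ (j, i))"
  by (simp add: mat_adjoint_def mat_of_rows_index)

lemma Q_diag_adjoint_index:
  assumes "i < n" "j < n"
  shows "(Q_mat n m * mat_diag n d * mat_adjoint (Q_mat n m)) $$ (i, j) = Q_conj n m d i j"
proof -
  have Q: "Q_mat n m \<in> carrier_mat n n" by (rule Q_mat_carrier)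
  have adj: "mat_adjoint (Q_mat n m) \<in> carrier_mat n n" using Q by (rule mat_adjoint_carrier)
  have "(Q_mat n m * mat_diag n d) $$ (i, l) = Q_entry n m i l * d l" if "l < n" for l
    using Q assms that by (subst mat_diag_mult_right[OF Q]) (simp add: Q_entry_def)
  moreover have "mat_adjoint (Q_mat n m) $$ (l, j) = cnj (Q_entry n m j l)" if "l < n" for l
    using Q assms that by (simp add: mat_adjoint_index Q_entry_def)
  moreover have "(Q_mat n m * mat_diag n d * mat_adjoint (Q_mat n m)) $$ (i, j) =
      (\<Sum>l<n. (Q_mat n m * mat_diag n d) $$ (i, l) * mat_adjoint (Q_mat n m) $$ (l, j))"
  proof -
    have "dim_col (mat_diag n d) = n" by (simp add: mat_diag_def)
    then show ?thesis
      using Q adj assms by (subst index_mult_mat) (auto simp: scalar_prod_def atLeast0LessThan intro!: sum.cong)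
  qed
  ultimately show ?thesis by (simp add: Q_conj_def)
qed

lemma unitary_Q_mat: "unitary_mat (Q_mat n m)"
proof -
  let ?Q = "Q_mat n m"
  have Q: "?Q \<in> carrier_mat n n" by (rule Q_mat_carrier)
  have adj: "mat_adjoint ?Q \<in> carrier_mat n n" using Q by (rule mat_adjoint_carrier)
  have "mat_diag n (\<lambda>_. 1) = (1\<^sub>m n :: complex mat)" by (rule eq_matI) (auto simp: mat_diag_def)
  then have "?Q * mat_adjoint ?Q = ?Q * mat_diag n (\<lambda>_. 1) * mat_adjoint ?Q" using Q by simp
  also have "\<dots> = 1\<^sub>m n"
  proof (rule eq_matI)
    fix i j assume "i < dim_row (1\<^sub>m n :: complex mat)" "j < dim_col (1\<^sub>m n :: complex mat)"
    then have ij: "i < n" "j < n" by auto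
    show "(?Q * mat_diag n (\<lambda>_. 1) * mat_adjoint ?Q) $$ (i, j) = 1\<^sub>m n $$ (i, j)"
      unfolding Q_diag_adjoint_index[OF ij] Q_conj_one[OF ij] using ij by simp
  qed (use Q adj in auto)
  finally have "?Q * mat_adjoint ?Q = 1\<^sub>m n" .
  then show ?thesis
    using mat_mult_left_right_inverse[OF Q adj] Q by (simp add: unitary_mat_def)
qed

text \<open>The last \<open>n mod m\<close> diagonal positions, which belong to the identity block, get the value \<open>0\<close>.\<close>

definition gridval :: "nat \<Rightarrow> nat \<Rightarrow> (real \<times> real \<Rightarrow> complex) \<Rightarrow> nat \<Rightarrow> complex" where
  "gridval n m h l = (if l < m * (n div m)
     then h (real (l div (n div m) + 1) / real m, 2 * pi * real (l mod (n div m)) / real (n div m)) else 0)"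

text \<open>Samples of e^(ik\<theta>) at the q-th roots of unity turn each block into the k-th power
  of the cyclic shift, by orthogonality of the roots; the factor is the value of \<open>a\<close> at
  the right end of the subinterval belonging to the block.\<close>

lemma Q_conj_monomial:
  fixes k :: int and a :: "real \<Rightarrow> complex"
  assumes "i < m * (n div m)" "i < n" "j < n"
  shows "Q_conj n m (gridval n m (\<lambda>(x, \<theta>). a x * cis (of_int k * \<theta>))) i j =
    (if j < m * (n div m) \<and> i div (n div m) = j div (n div m) \<and> int (n div m) dvd k + int j - int i
     then a (real (i div (n div m) + 1) / real m) else 0)"
proof -
  let ?q = "n div m"
  have q: "0 < ?q" using assms(1) by (cases "?q = 0") auto
  define b where "b = i div ?q"
  have b: "b < m" using assms(1) q by (simp add: b_def div_less_iff_less_mult)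
  define x where "x = a (real (b + 1) / real m)"
  have g: "gridval n m (\<lambda>(x, \<theta>). a x * cis (of_int k * \<theta>)) (b * ?q + p) =
      x * cis (of_int k * (2 * pi * real p / real ?q))" if "p < ?q" for p
  proof -
    have "b * ?q + p < (b + 1) * ?q" using that by simp
    also have "\<dots> \<le> m * ?q" using b by (intro mult_right_mono) auto
    finally show ?thesis using that by (simp add: gridval_def x_def)
  qed
  have "(\<Sum>p<?q. cis (2 * pi * of_int (int j - int i) * real p / real ?q) *
        gridval n m (\<lambda>(x, \<theta>). a x * cis (of_int k * \<theta>)) (b * ?q + p)) =
      (\<Sum>p<?q. x * cis (2 * pi * of_int (k + int j - int i) * real p / real ?q))"
  proof (intro sum.cong refl)
    fix p assume "p \<in> {..<?q}"
    then have p: "p < ?q" by simp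
    have "cis (2 * pi * of_int (int j - int i) * real p / real ?q) * cis (of_int k * (2 * pi * real p / real ?q)) =
        cis (2 * pi * of_int (k + int j - int i) * real p / real ?q)"
      unfolding cis_mult by (intro arg_cong[of _ _ cis]) (simp add: algebra_simps flip: add_divide_distrib diff_divide_distrib)
    then show "cis (2 * pi * of_int (int j - int i) * real p / real ?q) *
        gridval n m (\<lambda>(x, \<theta>). a x * cis (of_int k * \<theta>)) (b * ?q + p) =
        x * cis (2 * pi * of_int (k + int j - int i) * real p / real ?q)"
      unfolding g[OF p] by (metis mult.left_commute)
  qed
  also have "\<dots> = x * (if int ?q dvd k + int j - int i then of_nat ?q else 0)"
    unfolding sum_distrib_left[symmetric] sum_roots_of_unity[OF q] ..
  finally show ?thesis
    unfolding Q_conj_eq[OF assms(2,3)] b_def[symmetric] x_def[symmetric] using q assms(1) by auto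
qed

text \<open>The counted rows are the \<open>n mod m\<close> trailing ones and the first and last
  \<open>K\<close> rows of each of the \<open>m\<close> blocks, that is, those in which a shift by
  up to \<open>K\<close> may leave the block.\<close>

lemma card_shift_exceptions:
  fixes K n m :: nat
  shows "card {i. i < n \<and> \<not> (i < m * (n div m) \<and> K \<le> i mod (n div m) \<and> i mod (n div m) + K < n div m)}
    \<le> n mod m + m * (2 * K)"
proof -
  let ?q = "n div m"
  let ?P = "{p. p < ?q \<and> (p < K \<or> ?q \<le> p + K)}"
  let ?S = "{i. i < n \<and> \<not> (i < m * ?q \<and> K \<le> i mod ?q \<and> i mod ?q + K < ?q)}"
  have "?S \<subseteq> {m * ?q..<n} \<union> (\<Union>b<m. (\<lambda>p. b * ?q + p) ` ?P)"
  proof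
    fix i assume i: "i \<in> ?S"
    show "i \<in> {m * ?q..<n} \<union> (\<Union>b<m. (\<lambda>p. b * ?q + p) ` ?P)"
    proof (cases "i < m * ?q")
      case True
      then have q: "0 < ?q" by (cases "?q = 0") auto
      have "i div ?q < m" using True q by (simp add: div_less_iff_less_mult)
      moreover have "i mod ?q \<in> ?P" using i True q by auto
      moreover have "i = i div ?q * ?q + i mod ?q" by (rule div_mult_mod_eq[symmetric])
      ultimately show ?thesis by blast
    qed (use i in auto)
  qed
  then have "card ?S \<le> card ({m * ?q..<n} \<union> (\<Union>b<m. (\<lambda>p. b * ?q + p) ` ?P))"
    by (intro card_mono) auto
  also have "\<dots> \<le> card {m * ?q..<n} + card (\<Union>b<m. (\<lambda>p. b * ?q + p) ` ?P)" by (rule card_Un_le)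
  also have "card (\<Union>b<m. (\<lambda>p. b * ?q + p) ` ?P) \<le> (\<Sum>b<m. card ((\<lambda>p. b * ?q + p) ` ?P))"
    by (rule card_UN_le) simp
  also have "\<dots> \<le> (\<Sum>b<m. 2 * K)"
  proof (rule sum_mono)
    fix b
    have "card ((\<lambda>p. b * ?q + p) ` ?P) \<le> card ?P" by (rule card_image_le) simp
    also have "card ?P \<le> card ({..<K} \<union> {?q - K..<?q})" by (rule card_mono) auto
    also have "\<dots> \<le> card {..<K} + card {?q - K..<?q}" by (rule card_Un_le)
    finally show "card ((\<lambda>p. b * ?q + p) ` ?P) \<le> 2 * K" by simp
  qed
  also have "card {m * ?q..<n} = n mod m" by (simp add: minus_mult_div_eq_mod)
  finally show ?thesis by simp
qed

text \<open>In a row of \<open>G\<close> the Toeplitz shift stays inside the block and the cyclic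
  shift does not wrap around, so both matrices have their only nonzero entry in the same column
  \<open>\<tau> i\<close>, and the difference there is an oscillation of \<open>a\<close>. All other
  rows are declared low rank; there are at most m + 2 |k| m of them.\<close>

lemma splits_monomial:
  fixes k :: int and a :: "real \<Rightarrow> complex"
  assumes m: "1 \<le> m" and w: "0 \<le> w"
    and osc: "\<And>i. i < m * (n div m) \<Longrightarrow> cmod (a (real (i + 1) / real n) - a (real (i div (n div m) + 1) / real m)) \<le> w"
  shows "splits n (real m * (2 * real (nat \<bar>k\<bar>) + 1)) w (\<lambda>i j. (if int i - int j = k then a (real (i + 1) / real n) else 0) -
    Q_conj n m (gridval n m (\<lambda>(x, \<theta>). a x * cis (of_int k * \<theta>))) i j)"
proof -
  let ?q = "n div m" and ?K = "nat \<bar>k\<bar>"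
  let ?E = "\<lambda>i j. (if int i - int j = k then a (real (i + 1) / real n) else 0) -
    Q_conj n m (gridval n m (\<lambda>(x, \<theta>). a x * cis (of_int k * \<theta>))) i j"
  define G where "G = {i. i < n \<and> i < m * ?q \<and> ?K \<le> i mod ?q \<and> i mod ?q + ?K < ?q}"
  define S where "S = {i. i < n \<and> \<not> (i < m * ?q \<and> ?K \<le> i mod ?q \<and> i mod ?q + ?K < ?q)}"
  define c where "c i = a (real (i + 1) / real n) - a (real (i div ?q + 1) / real m)" for i
  define \<tau> where "\<tau> i = nat (int i - k)" for i
  have G_ge: "k \<le> int i" if "i \<in> G" for i
  proof -
    have "?K \<le> i" using that by (auto simp: G_def intro: order_trans[OF _ mod_less_eq_dividend])
    then show ?thesis by linarith
  qed
  have E_G: "?E i j = (if j = \<tau> i then c i else 0)" if i: "i \<in> G" and j: "j < n" for i j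
  proof -
    have q: "0 < ?q" using i by (auto simp: G_def)
    have i2: "i < n" "i < m * ?q" using i by (auto simp: G_def)
    have b: "i div ?q < m" using i2 q by (simp add: div_less_iff_less_mult)
    have T: "int i - int j = k \<longleftrightarrow> j = \<tau> i" using G_ge[OF i] by (auto simp: \<tau>_def)
    \<comment> \<open>For \<open>i\<close> in \<open>G\<close> both \<open>j mod ?q\<close> and
      \<open>i mod ?q - k\<close> lie in [0, q), so that their congruence modulo q is equality. This
      is where wrapping around is excluded.\<close>
    have "j < m * ?q \<and> i div ?q = j div ?q \<and> int ?q dvd k + int j - int i \<longleftrightarrow> j = \<tau> i"
    proof
      assume j2: "j < m * ?q \<and> i div ?q = j div ?q \<and> int ?q dvd k + int j - int i"
      have ij: "int i = int (j div ?q * ?q) + int (i mod ?q)" "int j = int (j div ?q * ?q) + int (j mod ?q)"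
        using j2 by (metis div_mult_mod_eq of_nat_add)+
      then have "int ?q dvd int (j mod ?q) - (int (i mod ?q) - k)" using j2 by (simp add: algebra_simps)
      then have "int (j mod ?q) mod int ?q = (int (i mod ?q) - k) mod int ?q" by (simp add: mod_eq_dvd_iff)
      moreover have "0 \<le> int (i mod ?q) - k" "int (i mod ?q) - k < int ?q" using i by (auto simp: G_def)
      ultimately have "int (j mod ?q) = int (i mod ?q) - k" using q by simp
      then have "int i - int j = k" using ij by linarith
      then show "j = \<tau> i" by (simp add: T)
    next
      assume "j = \<tau> i"
      then have eq: "int i - int j = k" using T by blast
      define p where "p = nat (int (i mod ?q) - k)"
      have p: "int p = int (i mod ?q) - k" "p < ?q" using i by (auto simp: G_def p_def)
      have "int i = int (i div ?q * ?q) + int (i mod ?q)" by (metis div_mult_mod_eq of_nat_add)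
      then have "int j = int (i div ?q * ?q + p)" using eq p by simp
      then have jp: "j = i div ?q * ?q + p" by linarith
      then have "j div ?q = i div ?q" using p by simp
      moreover have "j < m * ?q"
      proof -
        have "j < (i div ?q + 1) * ?q" using jp p by simp
        also have "\<dots> \<le> m * ?q" using b by (intro mult_right_mono) auto
        finally show ?thesis .
      qed
      ultimately show "j < m * ?q \<and> i div ?q = j div ?q \<and> int ?q dvd k + int j - int i" using eq by auto
    qed
    then show ?thesis unfolding Q_conj_monomial[OF i2(2,1) j] T c_def by auto
  qed
  have L: "low_rank n (real m * (2 * real ?K + 1)) (\<lambda>i j. if i \<in> S then ?E i j else 0)"
  proof (rule low_rank_rows)
    have "card S \<le> n mod m + m * (2 * ?K)" unfolding S_def by (rule card_shift_exceptions)
    also have "\<dots> \<le> m + m * (2 * ?K)" using m by (simp add: less_imp_le)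
    finally have "real (card S) \<le> real (m + m * (2 * ?K))" by (rule of_nat_mono)
    then show "real (card S) \<le> real m * (2 * real ?K + 1)" by (simp add: algebra_simps)
  qed (auto simp: S_def)
  have O: "op_bounded n w (\<lambda>i j. if i \<in> G \<and> j = \<tau> i then c i else 0)"
  proof (rule op_bounded_weighted_partial_injection)
    show "inj_on \<tau> G"
    proof (rule inj_onI)
      fix x y assume "x \<in> G" "y \<in> G" "\<tau> x = \<tau> y"
      then show "x = y" using G_ge[of x] G_ge[of y] by (simp add: \<tau>_def)
    qed
    show "cmod (c i) \<le> w" if "i \<in> G" for i using that osc[of i] by (simp add: c_def G_def)
  qed (rule w)
  have D: "?E i j = (if i \<in> S then ?E i j else 0) + (if i \<in> G \<and> j = \<tau> i then c i else 0)"
    if "i < n" "j < n" for i j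
  proof (cases "i \<in> G")
    case True
    then have "i \<notin> S" by (simp add: S_def G_def)
    then show ?thesis using E_G[OF True that(2)] True by simp
  next
    case False
    then have "i \<in> S" using that by (auto simp: S_def G_def)
    then show ?thesis using False by simp
  qed
  show ?thesis
    by (rule splits_cong[OF D[symmetric] splits_low_rank_op_bounded[OF L O]])
qed

subsection \<open>Riemann sums\<close>

text \<open>Arbitrary values \<open>c i\<close> close to \<open>f\<close> on the cells, instead of
  values at sample points, let the lemma be applied also to an outer integral whose sample values
  are themselves Riemann sums.\<close>

lemma integral_riemann_sum:
  fixes f :: "real \<Rightarrow> 'a::euclidean_space"
  assumes "continuous_on {a..a + real N * s} f" "0 \<le> s"
    and "\<And>i x. i < N \<Longrightarrow> x \<in> {a + real i * s..a + real (i + 1) * s} \<Longrightarrow> norm (f x - c i) \<le> \<delta>"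
  shows "norm (integral {a..a + real N * s} f - s *\<^sub>R (\<Sum>i<N. c i)) \<le> real N * s * \<delta>"
  using assms
proof (induction N)
  case 0
  then show ?case by simp
next
  case (Suc N)
  let ?b = "a + real N * s" and ?c = "a + real (Suc N) * s"
  have le: "a \<le> ?b" "?b \<le> ?c" using Suc.prems(2) by (auto simp: algebra_simps)
  have cont: "continuous_on {a..?b} f" "continuous_on {?b..?c} f"
    using le by (auto intro: continuous_on_subset[OF Suc.prems(1)])
  have "norm (integral {a..?b} f - s *\<^sub>R (\<Sum>i<N. c i)) \<le> real N * s * \<delta>"
    by (rule Suc.IH) (use cont Suc.prems in auto)
  moreover have "norm (integral {?b..?c} f - s *\<^sub>R c N) \<le> s * \<delta>"
  proof -
    have A: "norm (integral {?b..?c} (\<lambda>x. f x - c N)) \<le> \<delta> * (?c - ?b)"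
    proof (rule integral_bound)
      show "norm (f x - c N) \<le> \<delta>" if "x \<in> {?b..?c}" for x
        using Suc.prems(3)[of N x] that by simp
    qed (use le cont in \<open>auto intro!: continuous_intros\<close>)
    have B: "integral {?b..?c} (\<lambda>x. f x - c N) = integral {?b..?c} f - s *\<^sub>R c N"
      using cont le by (subst integral_diff) (auto intro!: integrable_continuous_interval simp: algebra_simps)
    have C: "?c - ?b = s" by (simp add: algebra_simps)
    show ?thesis using A unfolding B C by (simp only: mult.commute)
  qed
  moreover have "integral {a..?c} f = integral {a..?b} f + integral {?b..?c} f"
    by (rule Henstock_Kurzweil_Integration.integral_combine[symmetric])
      (use le Suc.prems(1) in \<open>auto intro!: integrable_continuous_interval\<close>)
  moreover have "integral {a..?c} f - s *\<^sub>R (\<Sum>i<Suc N. c i) =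
      (integral {a..?b} f - s *\<^sub>R (\<Sum>i<N. c i)) + (integral {?b..?c} f - s *\<^sub>R c N)"
    unfolding calculation(3) by (simp add: algebra_simps)
  ultimately have "norm (integral {a..?c} f - s *\<^sub>R (\<Sum>i<Suc N. c i)) \<le> real N * s * \<delta> + s * \<delta>"
    using norm_triangle_le by (metis add_mono)
  then show ?case by (simp add: algebra_simps)
qed

lemma GLT_domain_cbox: "GLT_domain = cbox (0, -pi) (1, pi)"
  by (simp only: cbox_Pair_eq interval_cbox)

lemma compact_GLT_domain: "compact GLT_domain"
  unfolding GLT_domain_cbox by (rule compact_cbox)

text \<open>The one-dimensional estimate is used twice. The inner sums \<open>d b\<close> are within
  2 pi \<delta> of the inner integral for every \<open>x\<close> in cell \<open>b\<close>, hence
  they are legitimate values for the outer sum.\<close>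

lemma integral_riemann_sum_2d:
  fixes u :: "real \<times> real \<Rightarrow> complex"
  assumes cont: "continuous_on (cbox (0, -pi) (1, pi)) u" and m: "0 < m" and q: "0 < q"
    and osc: "\<And>b l x \<theta>. b < m \<Longrightarrow> l < q \<Longrightarrow> x \<in> {real b / real m..real (b + 1) / real m} \<Longrightarrow>
      \<theta> \<in> {- pi + real l * (2 * pi / real q)..- pi + real (l + 1) * (2 * pi / real q)} \<Longrightarrow>
      cmod (u (x, \<theta>) - c b l) \<le> \<delta>"
  shows "cmod (integral (cbox (0, -pi) (1, pi)) u - (\<Sum>b<m. \<Sum>l<q. c b l) * of_real (2 * pi / (real m * real q))) \<le> 2 * pi * \<delta>"
proof -
  define I where "I = (\<lambda>x. integral {-pi..pi} (\<lambda>\<theta>. u (x, \<theta>)))"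
  have I: "integral (cbox (0, -pi) (1, pi)) u = integral {0..1} I"
    using integral_prod_continuous[OF cont] by (simp only: I_def interval_cbox)
  have box: "cbox (0 :: real, -pi) (1, pi) = {0..1} \<times> cbox (-pi) pi" by (simp only: cbox_Pair_eq interval_cbox)
  have contI: "continuous_on {0..1} I"
    unfolding I_def interval_cbox[of "-pi"]
    by (rule integral_continuous_on_param) (use cont in \<open>simp add: box\<close>)
  define d where "d b = (2 * pi / real q) *\<^sub>R (\<Sum>l<q. c b l)" for b
  have eqm: "real m * (1 / real m) = 1" using m by simp
  have eqq: "- pi + real q * (2 * pi / real q) = pi" using q by simp
  have dI: "cmod (I x - d b) \<le> 2 * pi * \<delta>" if b: "b < m" and x: "x \<in> {0 + real b * (1 / real m)..0 + real (b + 1) * (1 / real m)}" for b x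
  proof -
    have x1: "x \<in> {real b / real m..real (b + 1) / real m}" using x by simp
    have x01: "x \<in> {0..1}"
    proof -
      have "real (b + 1) / real m \<le> 1" using b by (simp add: field_simps)
      moreover have "0 \<le> real b / real m" by simp
      ultimately show ?thesis using x1 by (meson atLeastAtMost_iff order_trans)
    qed
    have "norm (integral {-pi..-pi + real q * (2 * pi / real q)} (\<lambda>\<theta>. u (x, \<theta>)) - (2 * pi / real q) *\<^sub>R (\<Sum>l<q. c b l))
        \<le> real q * (2 * pi / real q) * \<delta>"
    proof (rule integral_riemann_sum)
      show "continuous_on {- pi..- pi + real q * (2 * pi / real q)} (\<lambda>\<theta>. u (x, \<theta>))"
        unfolding eqq by (rule continuous_on_compose2[OF cont]) (use x01 in \<open>auto simp: box intro!: continuous_intros\<close>)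
    qed (use osc[OF b _ x1] in auto)
    then show ?thesis using q by (simp add: eqq I_def d_def)
  qed
  have "norm (integral {0..0 + real m * (1 / real m)} I - (1 / real m) *\<^sub>R (\<Sum>b<m. d b)) \<le> real m * (1 / real m) * (2 * pi * \<delta>)"
  proof (rule integral_riemann_sum)
    show "continuous_on {0..0 + real m * (1 / real m)} I" unfolding eqm by (simp add: contI)
  qed (use dI in auto)
  moreover have "(1 / real m) *\<^sub>R (\<Sum>b<m. d b) = (\<Sum>b<m. \<Sum>l<q. c b l) * of_real (2 * pi / (real m * real q))"
    by (simp add: d_def scaleR_conv_of_real sum_distrib_left sum_distrib_right sum_divide_distrib mult_ac)
  ultimately show ?thesis unfolding eqm I by simp
qed

lemma riemann_sum_unit_interval:
  fixes f :: "real \<Rightarrow> real"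
  assumes "continuous_on {0..1} f"
  shows "(\<lambda>n. (\<Sum>i<n. f (real (i + 1) / real n)) / real n) \<longlonglongrightarrow> integral {0..1} f"
proof (rule LIMSEQ_I)
  fix r :: real assume r: "0 < r"
  have "uniformly_continuous_on {0..1} f" using assms by (simp add: compact_uniformly_continuous)
  then obtain d where d: "0 < d" "\<And>x y. x \<in> {0..1} \<Longrightarrow> y \<in> {0..1} \<Longrightarrow> dist y x < d \<Longrightarrow> dist (f y) (f x) < r / 2"
    using r unfolding uniformly_continuous_on_def by (meson half_gt_zero)
  obtain N :: nat where N: "1 / d < real N" using reals_Archimedean2 by blast
  show "\<exists>no. \<forall>n\<ge>no. norm ((\<Sum>i<n. f (real (i + 1) / real n)) / real n - integral {0..1} f) < r"
  proof (intro exI allI impI)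
    fix n assume n: "N + 1 \<le> n"
    then have n0: "0 < real n" by simp
    have "1 / d < real n" using N n by linarith
    then have nd: "1 / real n < d" using d(1) n0 by (simp add: field_simps)
    have eqn: "real n * (1 / real n) = 1" using n0 by simp
    have "norm (integral {0..0 + real n * (1 / real n)} f - (1 / real n) *\<^sub>R (\<Sum>i<n. f (real (i + 1) / real n))) \<le> real n * (1 / real n) * (r / 2)"
    proof (rule integral_riemann_sum)
      show "continuous_on {0..0 + real n * (1 / real n)} f" unfolding eqn using assms by simp
      fix i x assume i: "i < n" and "x \<in> {0 + real i * (1 / real n)..0 + real (i + 1) * (1 / real n)}"
      then have x: "real i / real n \<le> x" "x \<le> real (i + 1) / real n" by auto
      have 1: "real (i + 1) / real n \<le> 1" using i by (simp add: field_simps)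
      have "0 \<le> real i / real n" by simp
      then have "0 \<le> x" "x \<le> 1" "0 \<le> real (i + 1) / real n" using x 1 by (linarith, linarith, simp)
      then have "x \<in> {0..1}" "real (i + 1) / real n \<in> {0..1}" using 1 unfolding atLeastAtMost_iff by blast+
      moreover have "real (i + 1) / real n - real i / real n = 1 / real n" by (simp flip: diff_divide_distrib)
      then have "dist x (real (i + 1) / real n) < d" using x nd unfolding dist_real_def by linarith
      ultimately have "dist (f x) (f (real (i + 1) / real n)) < r / 2" using d(2) by blast
      then show "norm (f x - f (real (i + 1) / real n)) \<le> r / 2" by (simp add: dist_norm)
    qed simp
    then have "norm (integral {0..1} f - (\<Sum>i<n. f (real (i + 1) / real n)) / real n) \<le> r / 2"
      unfolding eqn by simp
    then show "norm ((\<Sum>i<n. f (real (i + 1) / real n)) / real n - integral {0..1} f) < r"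
      using r by (subst norm_minus_commute) linarith
  qed
qed

section \<open>Grid values of continuous periodic functions\<close>

text \<open>Continuity on the whole plane and periodicity allow evaluation at abscissae in [0, 2
  pi), where \<open>gridval\<close> samples, although the symbol lives on [-pi, pi].\<close>

definition nice :: "(real \<times> real \<Rightarrow> complex) \<Rightarrow> bool" where
  "nice h \<longleftrightarrow> continuous_on UNIV h \<and> (\<forall>x \<theta>. h (x, \<theta> + 2 * pi) = h (x, \<theta>))"

text \<open>The abscissae \<open>2\<pi> l / q\<close>, \<open>0 \<le> l < q\<close>, are shifted by \<open>q div 2\<close> indices so that each of them lies in the
  \<open>l\<close>-th cell of \<open>[-\<pi>, \<pi>]\<close>; for periodic \<open>h\<close> this only permutes the grid values.\<close>

definition mesh_osc :: "nat \<Rightarrow> nat \<Rightarrow> (real \<times> real \<Rightarrow> complex) \<Rightarrow> real \<Rightarrow> bool" where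
  "mesh_osc n m h \<eta> \<longleftrightarrow> (\<forall>b<m. \<forall>l<n div m. \<forall>x\<in>{real b / real m..real (b + 1) / real m}.
     \<forall>\<theta>\<in>{- pi + real l * (2 * pi / real (n div m))..- pi + real (l + 1) * (2 * pi / real (n div m))}.
       cmod (h (x, \<theta>) - h (real (b + 1) / real m, 2 * pi * (real l - real (n div m div 2)) / real (n div m))) \<le> \<eta>)"

text \<open>A cyclic rotation: the first \<open>s\<close> terms on the left, moved by one period,
  are the last \<open>s\<close> terms on the right, and the other \<open>q - s\<close> terms match
  after an index shift.\<close>

lemma sum_periodic_shift:
  fixes g :: "real \<Rightarrow> complex"
  assumes "\<And>z. g (z + real q) = g z" "s \<le> q"
  shows "(\<Sum>l<q. g (real l - real s)) = (\<Sum>l<q. g (real l))"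
proof -
  have 1: "(\<Sum>l<q. f l) = (\<Sum>l<s. f l) + (\<Sum>l<q - s. f (l + s))" for f :: "nat \<Rightarrow> complex"
  proof -
    have "(\<Sum>l<q. f l) = (\<Sum>l<s. f l) + (\<Sum>l=s..<q. f l)"
      using assms(2) by (simp add: sum.atLeastLessThan_concat flip: atLeast0LessThan)
    also have "(\<Sum>l=s..<q. f l) = (\<Sum>l<q - s. f (l + s))"
      using sum.shift_bounds_nat_ivl[of f 0 s "q - s"] assms(2) by (simp add: atLeast0LessThan)
    finally show ?thesis .
  qed
  have 2: "(\<Sum>l<q. f l) = (\<Sum>l<q - s. f l) + (\<Sum>l<s. f (l + (q - s)))" for f :: "nat \<Rightarrow> complex"
  proof -
    have "(\<Sum>l<q. f l) = (\<Sum>l<q - s. f l) + (\<Sum>l=q - s..<q. f l)"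
      by (simp add: sum.atLeastLessThan_concat flip: atLeast0LessThan)
    also have "(\<Sum>l=q-s..<q. f l) = (\<Sum>l<s. f (l + (q - s)))"
      using sum.shift_bounds_nat_ivl[of f 0 "q - s" s] assms(2) by (simp add: atLeast0LessThan)
    finally show ?thesis .
  qed
  have "g (real l - real s) = g (real (l + (q - s)))" for l
  proof -
    have "real (l + (q - s)) = (real l - real s) + real q" using assms(2) by (simp add: of_nat_diff)
    then show ?thesis using assms(1) by metis
  qed
  then show ?thesis
    unfolding 1[of "\<lambda>l. g (real l - real s)"] 2[of "\<lambda>l. g (real l)"] by simp
qed

lemma sum_gridval:
  fixes \<Phi> :: "complex \<Rightarrow> complex"
  assumes "nice h"
  shows "(\<Sum>i<m * (n div m). \<Phi> (gridval n m h i)) =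
    (\<Sum>b<m. \<Sum>l<n div m. \<Phi> (h (real (b + 1) / real m, 2 * pi * (real l - real (n div m div 2)) / real (n div m))))"
proof (cases "n div m = 0")
  case False
  let ?q = "n div m"
  have "(\<Sum>i<m * ?q. \<Phi> (gridval n m h i)) = (\<Sum>b<m. \<Sum>i=b * ?q..<b * ?q + ?q. \<Phi> (gridval n m h i))"
    by (rule sum.nat_group[symmetric])
  also have "\<dots> = (\<Sum>b<m. \<Sum>l<?q. \<Phi> (gridval n m h (l + b * ?q)))"
  proof (rule sum.cong[OF refl])
    fix b
    show "(\<Sum>i=b * ?q..<b * ?q + ?q. \<Phi> (gridval n m h i)) = (\<Sum>l<?q. \<Phi> (gridval n m h (l + b * ?q)))"
      using sum.shift_bounds_nat_ivl[of "\<lambda>i. \<Phi> (gridval n m h i)" 0 "b * ?q" ?q]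
      by (simp add: atLeast0LessThan add.commute)
  qed
  also have "\<dots> = (\<Sum>b<m. \<Sum>l<?q. \<Phi> (h (real (b + 1) / real m, 2 * pi * real l / real ?q)))"
  proof (intro sum.cong refl)
    fix b l assume b: "b \<in> {..<m}" and l: "l \<in> {..<?q}"
    have "l + b * ?q < (b + 1) * ?q" using l by simp
    also have "\<dots> \<le> m * ?q" using b by (intro mult_right_mono) auto
    finally show "\<Phi> (gridval n m h (l + b * ?q)) = \<Phi> (h (real (b + 1) / real m, 2 * pi * real l / real ?q))"
      using l False by (simp add: gridval_def)
  qed
  also have "\<dots> = (\<Sum>b<m. \<Sum>l<?q. \<Phi> (h (real (b + 1) / real m, 2 * pi * (real l - real (?q div 2)) / real ?q)))"
  proof (rule sum.cong[OF refl])
    fix b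
    have "2 * pi * (z + real ?q) / real ?q = 2 * pi * z / real ?q + 2 * pi" for z
      using False by (simp add: field_simps)
    then show "(\<Sum>l<?q. \<Phi> (h (real (b + 1) / real m, 2 * pi * real l / real ?q))) =
      (\<Sum>l<?q. \<Phi> (h (real (b + 1) / real m, 2 * pi * (real l - real (?q div 2)) / real ?q)))"
      using sum_periodic_shift[of "\<lambda>z. \<Phi> (h (real (b + 1) / real m, 2 * pi * z / real ?q))" ?q "?q div 2"] assms
      by (simp add: nice_def)
  qed
  finally show ?thesis .
qed simp

text \<open>Each grid value stands for a cell of area 2 pi / (m q), q = n div m. The function
  \<open>\<Phi>\<close> will be a test function \<open>F\<close> when spectra are computed, and a
  cutoff when large grid values are counted.\<close>

lemma grid_integral:
  fixes \<Phi> :: "complex \<Rightarrow> complex"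
  assumes h: "nice h" and m: "1 \<le> m" "m \<le> n" and osc: "mesh_osc n m h \<eta>"
    and \<Phi>: "continuous_on UNIV \<Phi>" "\<And>z w. cmod (z - w) \<le> \<eta> \<Longrightarrow> cmod (\<Phi> z - \<Phi> w) \<le> \<delta>"
  shows "cmod ((LINT z|lebesgue_on GLT_domain. \<Phi> (h z)) -
    (\<Sum>i<m * (n div m). \<Phi> (gridval n m h i)) * of_real (2 * pi / real (m * (n div m)))) \<le> 2 * pi * \<delta>"
proof -
  have q: "0 < n div m" using m by (simp add: div_greater_zero_iff)
  have cont: "continuous_on S (\<lambda>z. \<Phi> (h z))" for S
    using h \<Phi>(1) by (auto simp: nice_def intro: continuous_on_compose2[of UNIV \<Phi>] continuous_on_subset)
  have "(LINT z|lebesgue_on GLT_domain. \<Phi> (h z)) = integral GLT_domain (\<lambda>z. \<Phi> (h z))"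
    unfolding GLT_domain_cbox by (intro lebesgue_integral_eq_integral continuous_imp_integrable cont) simp
  moreover have "cmod (integral (cbox (0, -pi) (1, pi)) (\<lambda>z. \<Phi> (h z)) -
     (\<Sum>b<m. \<Sum>l<n div m. \<Phi> (h (real (b + 1) / real m, 2 * pi * (real l - real (n div m div 2)) / real (n div m))))
      * of_real (2 * pi / (real m * real (n div m)))) \<le> 2 * pi * \<delta>"
    by (rule integral_riemann_sum_2d) (use m q cont osc in \<open>auto simp: mesh_osc_def intro!: \<Phi>(2)\<close>)
  ultimately show ?thesis unfolding sum_gridval[OF h] GLT_domain_cbox by simp
qed

text \<open>\<open>2 * (q div 2)\<close> is at most \<open>q\<close> and falls short of it by at
  most one, so -2 pi (q div 2) / q lies between -pi and -pi + 2 pi / q; the other points are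
  translates.\<close>

lemma mesh_point_in_cell:
  assumes "l < q"
  shows "2 * pi * (real l - real (q div 2)) / real q \<in> {- pi + real l * (2 * pi / real q)..- pi + real (l + 1) * (2 * pi / real q)}"
proof -
  define s where "s = 2 * pi / real q"
  define p where "p = pi / real q"
  let ?t = "real (q div 2)"
  have q: "0 < real q" using assms by simp
  have "real (2 * (q div 2)) \<le> real q" "real q \<le> real (2 * (q div 2) + 2)"
    unfolding of_nat_le_iff by auto
  then have t: "2 * ?t \<le> real q" "real q \<le> 2 * ?t + 2" by simp_all
  have sp: "s = 2 * p" "real q * p = pi" "0 \<le> p" using q by (simp_all add: s_def p_def)
  have "2 * ?t * p \<le> real q * p" "real q * p \<le> (2 * ?t + 2) * p"
    using t sp(3) by (intro mult_right_mono; simp)+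
  then have "?t * s \<le> pi" "pi \<le> ?t * s + s"
    using sp by (simp_all add: algebra_simps)
  moreover have "2 * pi * (real l - ?t) / real q = real l * s - ?t * s" "real (l + 1) * s = real l * s + s"
    by (simp_all add: s_def algebra_simps diff_divide_distrib add_divide_distrib)
  ultimately show ?thesis unfolding atLeastAtMost_iff s_def[symmetric] by (intro conjI) linarith+
qed

lemma mesh_interval_subset:
  assumes "l < q"
  shows "{- pi + real l * (2 * pi / real q)..- pi + real (l + 1) * (2 * pi / real q)} \<subseteq> {-pi..pi}"
proof -
  have "real (l + 1) * (2 * pi / real q) \<le> real q * (2 * pi / real q)"
    using assms by (intro mult_right_mono) auto
  also have "\<dots> = 2 * pi" using assms by simp
  finally show ?thesis by auto
qed

text \<open>Uniform continuity on the compact domain. Both side lengths 1 / m and 2 pi / (n div m)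
  of a cell must shrink; \<open>M\<close> and \<open>M'\<close> push each of them below
  \<open>d / 2\<close>.\<close>

lemma eventually_mesh_osc:
  assumes h: "nice h" and \<eta>: "0 < \<eta>" and m: "filterlim m at_top sequentially"
    and q: "filterlim (\<lambda>n. n div m n) at_top sequentially"
  shows "\<forall>\<^sub>F n in sequentially. mesh_osc n (m n) h \<eta>"
proof -
  have "uniformly_continuous_on GLT_domain h"
    using h by (intro compact_uniformly_continuous compact_GLT_domain) (auto simp: nice_def intro: continuous_on_subset)
  then obtain d where d: "0 < d" "\<And>x y. x \<in> GLT_domain \<Longrightarrow> y \<in> GLT_domain \<Longrightarrow> dist y x < d \<Longrightarrow> dist (h y) (h x) < \<eta>"
    using \<eta> unfolding uniformly_continuous_on_def by meson
  obtain M :: nat where M: "2 / d < real M" using reals_Archimedean2 by blast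
  obtain M' :: nat where M': "4 * pi / d < real M'" using reals_Archimedean2 by blast
  have "\<forall>\<^sub>F n in sequentially. M + 1 \<le> m n" "\<forall>\<^sub>F n in sequentially. M' + 1 \<le> n div m n"
    using m q by (auto simp: filterlim_at_top)
  then show ?thesis
  proof eventually_elim
    case (elim n)
    let ?q = "n div m n"
    have m0: "0 < real (m n)" "real M < real (m n)" and q0: "0 < real ?q" "real M' < real ?q"
      using elim by auto
    have md: "1 / real (m n) < d / 2"
    proof -
      have "2 / d < real (m n)" using M m0 by linarith
      then show ?thesis using d(1) m0 by (simp add: field_simps)
    qed
    have qd: "2 * pi / real ?q < d / 2"
    proof -
      have "4 * pi / d < real ?q" using M' q0 by linarith
      then show ?thesis using d(1) q0 by (simp add: field_simps)
    qed
    show ?case unfolding mesh_osc_def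
    proof (intro allI impI ballI)
      fix b l x \<theta> assume b: "b < m n" and l: "l < ?q" and x: "x \<in> {real b / real (m n)..real (b + 1) / real (m n)}"
        and \<theta>: "\<theta> \<in> {- pi + real l * (2 * pi / real ?q)..- pi + real (l + 1) * (2 * pi / real ?q)}"
      let ?x = "real (b + 1) / real (m n)" and ?\<theta> = "2 * pi * (real l - real (?q div 2)) / real ?q"
      have \<theta>2: "?\<theta> \<in> {- pi + real l * (2 * pi / real ?q)..- pi + real (l + 1) * (2 * pi / real ?q)}"
        by (rule mesh_point_in_cell[OF l])
      have x1: "?x \<le> 1" using b m0 by (simp add: field_simps)
      have x2: "?x - real b / real (m n) = 1 / real (m n)" by (simp flip: diff_divide_distrib)
      have x3: "0 \<le> real b / real (m n)" by simp
      have "(x, \<theta>) \<in> GLT_domain" "(?x, ?\<theta>) \<in> GLT_domain"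
      proof -
        have "0 \<le> x" "x \<le> 1" using x x1 x3 unfolding atLeastAtMost_iff by linarith+
        then have "x \<in> {0..1}" "?x \<in> {0..1}" using x1 by auto
        moreover have "\<theta> \<in> {-pi..pi}" "?\<theta> \<in> {-pi..pi}"
          using mesh_interval_subset[OF l] \<theta> \<theta>2 by blast+
        ultimately show "(x, \<theta>) \<in> GLT_domain" "(?x, ?\<theta>) \<in> GLT_domain" by blast+
      qed
      moreover have "dist (x, \<theta>) (?x, ?\<theta>) < d"
      proof -
        have "dist (x, \<theta>) (?x, ?\<theta>) \<le> dist x ?x + dist \<theta> ?\<theta>"
          unfolding dist_Pair_Pair by (rule sqrt_sum_squares_le_sum) auto
        moreover have "dist x ?x \<le> 1 / real (m n)" using x x2 unfolding dist_real_def by auto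
        moreover have "dist \<theta> ?\<theta> \<le> 2 * pi / real ?q"
        proof -
          define s where "s = 2 * pi / real ?q"
          define \<psi> where "\<psi> = ?\<theta>"
          have "real (l + 1) * s = real l * s + s" by (simp add: algebra_simps)
          then have "- pi + real l * s \<le> \<theta>" "\<theta> \<le> - pi + real l * s + s"
            "- pi + real l * s \<le> \<psi>" "\<psi> \<le> - pi + real l * s + s"
            using \<theta> \<theta>2 unfolding atLeastAtMost_iff s_def[symmetric] \<psi>_def[symmetric] by simp_all
          then show ?thesis unfolding dist_real_def s_def[symmetric] \<psi>_def[symmetric] by linarith
        qed
        ultimately show ?thesis using md qd by linarith
      qed
      ultimately have "dist (h (x, \<theta>)) (h (?x, ?\<theta>)) < \<eta>" using d(2) by blast
      then show "cmod (h (x, \<theta>) - h (?x, ?\<theta>)) \<le> \<eta>" by (simp add: dist_norm)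
    qed
  qed
qed

subsection \<open>Toeplitz matrices of integrable functions\<close>

lemma integrable_mult_cis:
  assumes "integrable (lebesgue_on {-pi..pi}) f"
  shows "integrable (lebesgue_on {-pi..pi}) (\<lambda>\<theta>. f \<theta> * cis (k * \<theta>))"
proof -
  have "(\<lambda>\<theta>. cis (k * \<theta>)) \<in> borel_measurable (lebesgue_on {-pi..pi})"
    by (intro continuous_imp_measurable_on_sets_lebesgue continuous_intros) auto
  then show ?thesis
    by (intro Bochner_Integration.integrable_bound[OF assms] borel_measurable_times borel_measurable_integrable[OF assms])
      (auto simp: norm_mult)
qed

lemma fourier_coeff_cis:
  "fourier_coeff f k = (LINT \<theta>|lebesgue_on {-pi..pi}. f \<theta> * cis (- of_int k * \<theta>)) / of_real (2 * pi)"
  by (simp add: fourier_coeff_def cis_conv_exp mult_ac)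

lemma fourier_coeff_add:
  assumes "integrable (lebesgue_on {-pi..pi}) f" "integrable (lebesgue_on {-pi..pi}) g"
  shows "fourier_coeff (\<lambda>\<theta>. f \<theta> + g \<theta>) k = fourier_coeff f k + fourier_coeff g k"
  unfolding fourier_coeff_cis distrib_right
  by (simp only: Bochner_Integration.integral_add[OF integrable_mult_cis[OF assms(1)] integrable_mult_cis[OF assms(2)]]
      add_divide_distrib)

lemma fourier_coeff_diff:
  assumes "integrable (lebesgue_on {-pi..pi}) f" "integrable (lebesgue_on {-pi..pi}) g"
  shows "fourier_coeff (\<lambda>\<theta>. f \<theta> - g \<theta>) k = fourier_coeff f k - fourier_coeff g k"
  unfolding fourier_coeff_cis left_diff_distrib
  by (simp only: Bochner_Integration.integral_diff[OF integrable_mult_cis[OF assms(1)] integrable_mult_cis[OF assms(2)]]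
      diff_divide_distrib)

lemma fourier_coeff_scale:
  "fourier_coeff (\<lambda>\<theta>. c * f \<theta>) k = c * fourier_coeff f k"
  by (simp add: fourier_coeff_cis mult.assoc)

lemma integral_cis_period:
  fixes j :: int
  shows "(LINT \<theta>|lebesgue_on {-pi..pi}. cis (of_int j * \<theta>)) = (if j = 0 then of_real (2 * pi) else 0)"
proof -
  have int: "integrable (lebesgue_on {-pi..pi}) (\<lambda>\<theta>. cis (of_int j * \<theta>))"
    by (rule continuous_imp_integrable_real) (intro continuous_intros)
  have "(LINT \<theta>|lebesgue_on {-pi..pi}. cis (of_int j * \<theta>)) = integral {-pi..pi} (\<lambda>\<theta>. cis (of_int j * \<theta>))"
    by (rule lebesgue_integral_eq_integral[OF int]) simp
  also have "\<dots> = (if j = 0 then of_real (2 * pi) else 0)"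
  proof (cases "j = 0")
    case True
    then show ?thesis by (simp add: scaleR_conv_of_real)
  next
    case False
    define F where "F \<theta> = cis (of_int j * \<theta>) / (\<i> * of_int j)" for \<theta> :: real
    have "((\<lambda>\<theta>. cis (of_int j * \<theta>)) has_integral (F pi - F (-pi))) {-pi..pi}"
    proof (rule fundamental_theorem_of_calculus)
      fix x
      have "((\<lambda>z. exp (\<i> * of_int j * z) / (\<i> * of_int j)) has_field_derivative exp (\<i> * of_int j * of_real x)) (at (of_real x))"
        using False by (auto intro!: derivative_eq_intros)
      then have "((\<lambda>\<theta>. exp (\<i> * of_int j * of_real \<theta>) / (\<i> * of_int j)) has_vector_derivative exp (\<i> * of_int j * of_real x)) (at x within {-pi..pi})"
        by (rule has_vector_derivative_real_field)
      then show "(F has_vector_derivative cis (of_int j * x)) (at x within {-pi..pi})"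
        unfolding F_def[abs_def] cis_conv_exp by (simp add: mult.assoc)
    qed simp
    moreover have "F pi = F (-pi)"
    proof -
      have "cis (of_int j * pi) = cis (of_int j * (-pi)) * cis (2 * pi * of_int j)"
        unfolding cis_mult by (intro arg_cong[of _ _ cis]) (simp add: algebra_simps)
      then show ?thesis by (simp add: F_def)
    qed
    ultimately show ?thesis using False by (simp add: integral_unique)
  qed
  finally show ?thesis .
qed

definition trigpoly :: "nat \<Rightarrow> (int \<Rightarrow> complex) \<Rightarrow> real \<Rightarrow> complex" where
  "trigpoly r c \<theta> = (\<Sum>k\<in>{- int r..int r}. c k * cis (of_int k * \<theta>))"

lemma trigpoly_continuous: "continuous_on S (trigpoly r c)"
  unfolding trigpoly_def[abs_def] by (intro continuous_intros)

lemma trigpoly_integrable: "integrable (lebesgue_on {-pi..pi}) (trigpoly r c)"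
  by (intro continuous_imp_integrable_real trigpoly_continuous)

lemma fourier_coeff_trigpoly:
  "fourier_coeff (trigpoly r c) j = (if \<bar>j\<bar> \<le> int r then c j else 0)"
proof -
  have int: "integrable (lebesgue_on {-pi..pi}) (\<lambda>\<theta>. cis (x * \<theta>))" for x
    by (rule continuous_imp_integrable_real) (intro continuous_intros)
  have "fourier_coeff (trigpoly r c) j =
      (LINT \<theta>|lebesgue_on {-pi..pi}. (\<Sum>k\<in>{- int r..int r}. c k * cis (of_int (k - j) * \<theta>))) / of_real (2 * pi)"
    unfolding fourier_coeff_cis trigpoly_def sum_distrib_right mult.assoc cis_mult
    by (simp add: algebra_simps)
  also have "(LINT \<theta>|lebesgue_on {-pi..pi}. (\<Sum>k\<in>{- int r..int r}. c k * cis (of_int (k - j) * \<theta>))) =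
      (\<Sum>k\<in>{- int r..int r}. c k * (if k - j = 0 then of_real (2 * pi) else 0))"
  proof -
    have "(LINT \<theta>|lebesgue_on {-pi..pi}. (\<Sum>k\<in>{- int r..int r}. c k * cis (of_int (k - j) * \<theta>))) =
        (\<Sum>k\<in>{- int r..int r}. (LINT \<theta>|lebesgue_on {-pi..pi}. c k * cis (of_int (k - j) * \<theta>)))"
      by (rule Bochner_Integration.integral_sum) (intro integrable_mult_right int)
    then show ?thesis by (simp only: integral_mult_right_zero integral_cis_period)
  qed
  also have "\<dots> = (\<Sum>k\<in>{- int r..int r}. if k = j then c k * of_real (2 * pi) else 0)"
    by (intro sum.cong) auto
  also have "\<dots> = (if \<bar>j\<bar> \<le> int r then c j * of_real (2 * pi) else 0)"
    by (auto simp: sum.delta')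
  finally show ?thesis by simp
qed

abbreviation toep :: "(real \<Rightarrow> complex) \<Rightarrow> cmfun" where
  "toep f \<equiv> \<lambda>i j. fourier_coeff f (int i - int j)"

text \<open>The quadratic form at \<open>v\<close> is the mean of \<open>g(\<theta>) |\<Sum>\<^sub>j v\<^sub>j e\<^sup>i\<^sup>j\<^sup>\<theta>|\<^sup>2\<close>.\<close>

lemma psd_toep:
  fixes g :: "real \<Rightarrow> real"
  assumes int: "integrable (lebesgue_on {-pi..pi}) g" and pos: "\<And>\<theta>. 0 \<le> g \<theta>"
  shows "psd n (toep (\<lambda>\<theta>. of_real (g \<theta>)))"
  unfolding psd_def
proof (intro conjI allI impI)
  have intc: "integrable (lebesgue_on {-pi..pi}) (\<lambda>\<theta>. complex_of_real (g \<theta>))" using int by simp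
  show "toep (\<lambda>\<theta>. of_real (g \<theta>)) j i = cnj (toep (\<lambda>\<theta>. of_real (g \<theta>)) i j)" for i j
  proof -
    have "cnj (LINT \<theta>|lebesgue_on {-pi..pi}. complex_of_real (g \<theta>) * cis (- of_int (int i - int j) * \<theta>)) =
        (LINT \<theta>|lebesgue_on {-pi..pi}. cnj (complex_of_real (g \<theta>) * cis (- of_int (int i - int j) * \<theta>)))"
      by (rule Bochner_Integration.integral_cnj[symmetric])
    also have "\<dots> = (LINT \<theta>|lebesgue_on {-pi..pi}. complex_of_real (g \<theta>) * cis (- of_int (int j - int i) * \<theta>))"
      by (simp add: cis_cnj algebra_simps)
    finally show ?thesis by (simp add: fourier_coeff_cis)
  qed
  fix v :: "nat \<Rightarrow> complex"
  define P where "P \<theta> = (\<Sum>j<n. v j * cis (real j * \<theta>))" for \<theta>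
  have *: "cnj (v i) * (of_real (g \<theta>) * cis (- of_int (int i - int j) * \<theta>)) * v j =
      of_real (g \<theta>) * (cnj (v i * cis (real i * \<theta>)) * (v j * cis (real j * \<theta>)))" for i j \<theta>
  proof -
    have "cis (- of_int (int i - int j) * \<theta>) = cis (- (real i * \<theta>)) * cis (real j * \<theta>)"
      unfolding cis_mult by (intro arg_cong[of _ _ cis]) (simp add: algebra_simps)
    then show ?thesis by (simp add: cis_cnj mult_ac)
  qed
  have "hform n (toep (\<lambda>\<theta>. of_real (g \<theta>))) v v =
      (LINT \<theta>|lebesgue_on {-pi..pi}. (\<Sum>i<n. \<Sum>j<n. cnj (v i) * (of_real (g \<theta>) * cis (- of_int (int i - int j) * \<theta>)) * v j)) / of_real (2 * pi)"
  proof -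
    let ?G = "\<lambda>i j \<theta>. cnj (v i) * (complex_of_real (g \<theta>) * cis (- of_int (int i - int j) * \<theta>)) * v j"
    have intG: "integrable (lebesgue_on {-pi..pi}) (?G i j)" for i j
      by (intro integrable_mult_left integrable_mult_right integrable_mult_cis intc)
    have "(LINT \<theta>|lebesgue_on {-pi..pi}. (\<Sum>i<n. \<Sum>j<n. ?G i j \<theta>)) = (\<Sum>i<n. (LINT \<theta>|lebesgue_on {-pi..pi}. (\<Sum>j<n. ?G i j \<theta>)))"
      by (rule Bochner_Integration.integral_sum) (intro Bochner_Integration.integrable_sum intG)
    also have "\<dots> = (\<Sum>i<n. \<Sum>j<n. (LINT \<theta>|lebesgue_on {-pi..pi}. ?G i j \<theta>))"
      by (intro sum.cong refl Bochner_Integration.integral_sum intG)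
    finally show ?thesis
      unfolding hform_def fourier_coeff_cis
      by (simp only: integral_mult_left_zero integral_mult_right_zero sum_divide_distrib times_divide_eq_right times_divide_eq_left)
  qed
  also have "\<dots> = (LINT \<theta>|lebesgue_on {-pi..pi}. complex_of_real (g \<theta> * (cmod (P \<theta>))\<^sup>2)) / of_real (2 * pi)"
  proof -
    have "(\<Sum>i<n. \<Sum>j<n. cnj (v i) * (of_real (g \<theta>) * cis (- of_int (int i - int j) * \<theta>)) * v j) =
        complex_of_real (g \<theta> * (cmod (P \<theta>))\<^sup>2)" for \<theta>
    proof -
      have "(\<Sum>i<n. \<Sum>j<n. cnj (v i) * (of_real (g \<theta>) * cis (- of_int (int i - int j) * \<theta>)) * v j) =
          of_real (g \<theta>) * (cnj (P \<theta>) * P \<theta>)"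
        unfolding * P_def cnj_sum sum_product by (simp add: sum_distrib_left)
      also have "cnj (P \<theta>) * P \<theta> = complex_of_real ((cmod (P \<theta>))\<^sup>2)"
        by (metis complex_norm_square mult.commute)
      finally show ?thesis by simp
    qed
    then show ?thesis by simp
  qed
  also have "\<dots> = complex_of_real ((LINT \<theta>|lebesgue_on {-pi..pi}. g \<theta> * (cmod (P \<theta>))\<^sup>2) / (2 * pi))"
    unfolding integral_complex_of_real by simp
  finally have "Re (hform n (toep (\<lambda>\<theta>. of_real (g \<theta>))) v v) = (LINT \<theta>|lebesgue_on {-pi..pi}. g \<theta> * (cmod (P \<theta>))\<^sup>2) / (2 * pi)"
    by (simp only: Re_complex_of_real)
  moreover have "0 \<le> (LINT \<theta>|lebesgue_on {-pi..pi}. g \<theta> * (cmod (P \<theta>))\<^sup>2)"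
    by (rule Bochner_Integration.integral_nonneg) (simp add: pos)
  ultimately show "0 \<le> Re (hform n (toep (\<lambda>\<theta>. of_real (g \<theta>))) v v)" by simp
qed

text \<open>All diagonal entries equal the mean of \<open>g\<close>, which is at most r t; so the
  trace is at most n r t, and dividing it by \<open>t\<close> gives the rank bound.\<close>

lemma splits_toep_nonneg:
  fixes g :: "real \<Rightarrow> real"
  assumes int: "integrable (lebesgue_on {-pi..pi}) g" and pos: "\<And>\<theta>. 0 \<le> g \<theta>" and t: "0 < t"
    and le: "(LINT \<theta>|lebesgue_on {-pi..pi}. g \<theta>) \<le> r * t"
  shows "splits n (real n * r) t (toep (\<lambda>\<theta>. of_real (g \<theta>)))"
proof (rule psd_splits[OF psd_toep[OF int pos] t])
  have "Re (toep (\<lambda>\<theta>. of_real (g \<theta>)) i i) \<le> r * t" for i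
  proof -
    have "toep (\<lambda>\<theta>. of_real (g \<theta>)) i i = complex_of_real ((LINT \<theta>|lebesgue_on {-pi..pi}. g \<theta>) / (2 * pi))"
      by (simp add: fourier_coeff_cis)
    then have "Re (toep (\<lambda>\<theta>. of_real (g \<theta>)) i i) = (LINT \<theta>|lebesgue_on {-pi..pi}. g \<theta>) / (2 * pi)"
      by (simp only: Re_complex_of_real)
    also have "\<dots> \<le> (LINT \<theta>|lebesgue_on {-pi..pi}. g \<theta>) / 1"
    proof (rule divide_left_mono)
      show "1 \<le> 2 * pi" using pi_ge_two by linarith
    qed (use pos in \<open>auto intro!: Bochner_Integration.integral_nonneg\<close>)
    finally show ?thesis using le by simp
  qed
  then have "(\<Sum>i<n. Re (toep (\<lambda>\<theta>. of_real (g \<theta>)) i i)) \<le> (\<Sum>i<n. r * t)" by (intro sum_mono)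
  then show "(\<Sum>i<n. Re (toep (\<lambda>\<theta>. of_real (g \<theta>)) i i)) \<le> real n * r * t" by simp
qed

text \<open>Split \<open>f\<close> into the positive and negative parts of its real and imaginary parts.\<close>

lemma splits_toep:
  assumes int: "integrable (lebesgue_on {-pi..pi}) f" and t: "0 < t"
    and le: "(LINT \<theta>|lebesgue_on {-pi..pi}. cmod (f \<theta>)) \<le> r * t"
  shows "splits n (real n * (4 * r)) (4 * t) (toep f)"
proof -
  define p where "p = (\<lambda>\<theta>. max 0 (Re (f \<theta>)))"
  define q where "q = (\<lambda>\<theta>. max 0 (- Re (f \<theta>)))"
  define a where "a = (\<lambda>\<theta>. max 0 (Im (f \<theta>)))"
  define b where "b = (\<lambda>\<theta>. max 0 (- Im (f \<theta>)))"
  let ?c = "\<lambda>g \<theta>. complex_of_real (g \<theta>)"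
  have ints: "integrable (lebesgue_on {-pi..pi}) p" "integrable (lebesgue_on {-pi..pi}) q"
    "integrable (lebesgue_on {-pi..pi}) a" "integrable (lebesgue_on {-pi..pi}) b"
    unfolding p_def q_def a_def b_def using int by (auto intro!: integrable_max integrable_Re integrable_Im)
  have S: "splits n (real n * r) t (toep (?c g))"
    if "integrable (lebesgue_on {-pi..pi}) g" "\<And>\<theta>. 0 \<le> g \<theta>" "\<And>\<theta>. g \<theta> \<le> cmod (f \<theta>)" for g
  proof (rule splits_toep_nonneg[OF that(1,2) t])
    have "(LINT \<theta>|lebesgue_on {-pi..pi}. g \<theta>) \<le> (LINT \<theta>|lebesgue_on {-pi..pi}. cmod (f \<theta>))"
      using that int by (intro integral_mono) auto
    then show "(LINT \<theta>|lebesgue_on {-pi..pi}. g \<theta>) \<le> r * t" using le by linarith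
  qed
  have bounds: "0 \<le> p \<theta>" "p \<theta> \<le> cmod (f \<theta>)" "0 \<le> q \<theta>" "q \<theta> \<le> cmod (f \<theta>)"
     "0 \<le> a \<theta>" "a \<theta> \<le> cmod (f \<theta>)" "0 \<le> b \<theta>" "b \<theta> \<le> cmod (f \<theta>)" for \<theta>
    using abs_Re_le_cmod[of "f \<theta>"] abs_Im_le_cmod[of "f \<theta>"] by (auto simp: p_def q_def a_def b_def)
  have sp: "splits n (real n * r) t (toep (?c p))" and sq: "splits n (real n * r) t (\<lambda>i j. -1 * toep (?c q) i j)"
    and sa: "splits n (real n * r) t (\<lambda>i j. \<i> * toep (?c a) i j)" and sb: "splits n (real n * r) t (\<lambda>i j. - \<i> * toep (?c b) i j)"
    using splits_scale[OF S[OF ints(2)], of "-1"] splits_scale[OF S[OF ints(3)], of \<i>]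
      splits_scale[OF S[OF ints(4)], of "-\<i>"] S[OF ints(1)] bounds by auto
  have S4: "splits n (real n * r + real n * r + (real n * r + real n * r)) (t + t + (t + t))
     (\<lambda>i j. (toep (?c p) i j + -1 * toep (?c q) i j) + (\<i> * toep (?c a) i j + - \<i> * toep (?c b) i j))"
    by (intro splits_add sp sq sa sb)
  have E: "toep f i j = (toep (?c p) i j + -1 * toep (?c q) i j) + (\<i> * toep (?c a) i j + - \<i> * toep (?c b) i j)" for i j
  proof -
    have "f = (\<lambda>\<theta>. (?c p \<theta> - ?c q \<theta>) + \<i> * (?c a \<theta> - ?c b \<theta>))"
      by (rule ext) (auto simp: p_def q_def a_def b_def complex_eq_iff)
    moreover have "fourier_coeff (\<lambda>\<theta>. (?c p \<theta> - ?c q \<theta>) + \<i> * (?c a \<theta> - ?c b \<theta>)) k =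
        (fourier_coeff (?c p) k - fourier_coeff (?c q) k) + \<i> * (fourier_coeff (?c a) k - fourier_coeff (?c b) k)" for k
      using ints by (simp add: fourier_coeff_add fourier_coeff_diff fourier_coeff_scale)
    ultimately show ?thesis by (simp add: algebra_simps)
  qed
  show ?thesis
    by (rule splits_mono[OF splits_cong[OF E[symmetric] S4]]) auto
qed

subsection \<open>Density of trigonometric polynomials\<close>

definition is_trigpoly :: "(real \<Rightarrow> complex) \<Rightarrow> bool" where
  "is_trigpoly f \<longleftrightarrow> (\<exists>r c. f = trigpoly r c)"

lemma is_trigpoly_monomial: "is_trigpoly (\<lambda>\<theta>. a * cis (of_int k * \<theta>))"
proof -
  have "(\<lambda>\<theta>. a * cis (of_int k * \<theta>)) = trigpoly (nat \<bar>k\<bar>) (\<lambda>j. if j = k then a else 0)"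
  proof
    fix \<theta>
    have "trigpoly (nat \<bar>k\<bar>) (\<lambda>j. if j = k then a else 0) \<theta> =
        (\<Sum>j\<in>{- int (nat \<bar>k\<bar>)..int (nat \<bar>k\<bar>)}. if j = k then a * cis (of_int k * \<theta>) else 0)"
      unfolding trigpoly_def by (intro sum.cong refl) simp
    also have "\<dots> = a * cis (of_int k * \<theta>)"
    proof -
      have "k \<in> {- int (nat \<bar>k\<bar>)..int (nat \<bar>k\<bar>)}" by auto
      then show ?thesis by (simp del: atLeastAtMost_iff)
    qed
    finally show "a * cis (of_int k * \<theta>) = trigpoly (nat \<bar>k\<bar>) (\<lambda>j. if j = k then a else 0) \<theta>" by simp
  qed
  then show ?thesis unfolding is_trigpoly_def by blast
qed

lemma trigpoly_extend:
  assumes "r \<le> s"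
  shows "trigpoly r c = trigpoly s (\<lambda>k. if \<bar>k\<bar> \<le> int r then c k else 0)"
proof
  fix \<theta>
  show "trigpoly r c \<theta> = trigpoly s (\<lambda>k. if \<bar>k\<bar> \<le> int r then c k else 0) \<theta>"
    unfolding trigpoly_def by (rule sum.mono_neutral_cong_left) (use assms in auto)
qed

lemma is_trigpoly_add:
  assumes "is_trigpoly f" "is_trigpoly g"
  shows "is_trigpoly (\<lambda>\<theta>. f \<theta> + g \<theta>)"
proof -
  from assms obtain r c r' c' where f: "f = trigpoly r c" and g: "g = trigpoly r' c'" unfolding is_trigpoly_def by blast
  let ?c = "\<lambda>k. (if \<bar>k\<bar> \<le> int r then c k else 0)" and ?c' = "\<lambda>k. (if \<bar>k\<bar> \<le> int r' then c' k else 0)"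
  have f': "f = trigpoly (max r r') ?c" and g': "g = trigpoly (max r r') ?c'"
    unfolding f g by (rule trigpoly_extend; simp)+
  have "(\<lambda>\<theta>. f \<theta> + g \<theta>) = trigpoly (max r r') (\<lambda>k. ?c k + ?c' k)"
    unfolding f' g' by (rule ext) (simp only: trigpoly_def sum.distrib distrib_right)
  then show ?thesis unfolding is_trigpoly_def by blast
qed

lemma is_trigpoly_const: "is_trigpoly (\<lambda>\<theta>. a)"
  using is_trigpoly_monomial[of a 0] by simp

lemma is_trigpoly_sum: "finite I \<Longrightarrow> (\<And>i. i \<in> I \<Longrightarrow> is_trigpoly (f i)) \<Longrightarrow> is_trigpoly (\<lambda>\<theta>. \<Sum>i\<in>I. f i \<theta>)"
  by (induction I rule: finite_induct) (auto intro: is_trigpoly_add is_trigpoly_const)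

lemma is_trigpoly_mult:
  assumes "is_trigpoly f" "is_trigpoly g"
  shows "is_trigpoly (\<lambda>\<theta>. f \<theta> * g \<theta>)"
proof -
  from assms obtain r c r' c' where f: "f = trigpoly r c" and g: "g = trigpoly r' c'" unfolding is_trigpoly_def by blast
  have *: "(c k * cis (of_int k * \<theta>)) * (c' l * cis (of_int l * \<theta>)) = (c k * c' l) * cis (of_int (k + l) * \<theta>)" for k l \<theta>
  proof -
    have "cis (of_int k * \<theta>) * cis (of_int l * \<theta>) = cis (of_int (k + l) * \<theta>)"
      unfolding cis_mult by (simp add: distrib_right)
    then show ?thesis by (metis mult.assoc mult.left_commute)
  qed
  have eq: "(\<lambda>\<theta>. f \<theta> * g \<theta>) = (\<lambda>\<theta>. \<Sum>k\<in>{- int r..int r}. \<Sum>l\<in>{- int r'..int r'}. (c k * c' l) * cis (of_int (k + l) * \<theta>))"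
    unfolding f g trigpoly_def sum_product by (intro ext sum.cong refl *)
  show ?thesis unfolding eq by (intro is_trigpoly_sum is_trigpoly_monomial) auto
qed

lemma is_trigpoly_integrable: "is_trigpoly f \<Longrightarrow> integrable (lebesgue_on {-pi..pi}) f"
  by (auto simp: is_trigpoly_def trigpoly_integrable)

text \<open>On the unit circle a real linear functional is a combination of cos and sin, hence a
  trigonometric polynomial of degree one; sums and products then follow from closure.\<close>

lemma is_trigpoly_real_polynomial_cis:
  assumes "real_polynomial_function (g :: complex \<Rightarrow> real)"
  shows "is_trigpoly (\<lambda>\<theta>. of_real (g (cis \<theta>)))"
  using assms
proof induction
  case (linear g)
  have "g (cis \<theta>) = cos \<theta> * g 1 + sin \<theta> * g \<i>" for \<theta>
  proof -
    interpret bounded_linear g by (rule linear)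
    have "g (cos \<theta> *\<^sub>R 1 + sin \<theta> *\<^sub>R \<i>) = cos \<theta> * g 1 + sin \<theta> * g \<i>"
      by (simp add: add scaleR)
    moreover have "cis \<theta> = cos \<theta> *\<^sub>R 1 + sin \<theta> *\<^sub>R \<i>" by (simp add: complex_eq_iff)
    ultimately show ?thesis by simp
  qed
  moreover have "complex_of_real (cos \<theta>) = (1/2) * cis (of_int 1 * \<theta>) + (1/2) * cis (of_int (-1) * \<theta>)"
    "complex_of_real (sin \<theta>) = (-\<i>/2) * cis (of_int 1 * \<theta>) + (\<i>/2) * cis (of_int (-1) * \<theta>)" for \<theta>
    by (auto simp: complex_eq_iff)
  ultimately have eq: "(\<lambda>\<theta>. complex_of_real (g (cis \<theta>))) =
     (\<lambda>\<theta>. ((1/2) * cis (of_int 1 * \<theta>) + (1/2) * cis (of_int (-1) * \<theta>)) * of_real (g 1) +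
      ((-\<i>/2) * cis (of_int 1 * \<theta>) + (\<i>/2) * cis (of_int (-1) * \<theta>)) * of_real (g \<i>))"
    by (simp only: of_real_add of_real_mult)
  show ?case unfolding eq by (intro is_trigpoly_add is_trigpoly_mult is_trigpoly_monomial is_trigpoly_const)
qed (auto intro: is_trigpoly_add is_trigpoly_mult is_trigpoly_const)

lemma cis_mem_sphere: "cis \<theta> \<in> sphere 0 1"
  by simp

text \<open>Transport \<open>\<phi>\<close> to the unit circle and apply the Stone--Weierstrass theorem there.\<close>

lemma is_trigpoly_uniform_approx:
  fixes \<phi> :: "real \<Rightarrow> real"
  assumes \<phi>: "continuous_on {-pi..pi} \<phi>" "\<phi> (-pi) = \<phi> pi" and e: "0 < e"
  obtains p where "is_trigpoly p" "\<And>\<theta>. \<theta> \<in> {-pi..pi} \<Longrightarrow> cmod (of_real (\<phi> \<theta>) - p \<theta>) < e"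
proof -
  \<comment> \<open>The angle is \<open>arccos (Re z)\<close> on the upper half circle and its
    negative on the lower one. The halves meet at 1 and -1; at -1 the two formulas agree because
    \<open>\<phi> (-pi) = \<phi> pi\<close>.\<close>
  define \<psi> where "\<psi> z = (if 0 \<le> Im z then \<phi> (arccos (Re z)) else \<phi> (- arccos (Re z)))" for z
  have re: "\<bar>Re z\<bar> \<le> 1" if "z \<in> sphere 0 1" for z using that abs_Re_le_cmod[of z] by simp
  have "continuous_on (({z. 0 \<le> Im z} \<inter> sphere 0 1) \<union> ({z. Im z \<le> 0} \<inter> sphere 0 1)) \<psi>"
    unfolding \<psi>_def
  proof (rule continuous_on_cases)
    show "closed ({z. 0 \<le> Im z} \<inter> sphere 0 1)" "closed ({z. Im z \<le> 0} \<inter> sphere 0 1)"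
      by (auto intro!: closed_Int closed_Collect_le continuous_intros)
    show "continuous_on ({z. 0 \<le> Im z} \<inter> sphere 0 1) (\<lambda>z. \<phi> (arccos (Re z)))"
      by (rule continuous_on_compose2[OF \<phi>(1)])
        (use re arccos_bounded in \<open>force intro!: continuous_intros simp: abs_le_iff\<close>)+
    show "continuous_on ({z. Im z \<le> 0} \<inter> sphere 0 1) (\<lambda>z. \<phi> (- arccos (Re z)))"
      by (rule continuous_on_compose2[OF \<phi>(1)])
        (use re arccos_bounded in \<open>force intro!: continuous_intros simp: abs_le_iff\<close>)+
    show "\<forall>z. z \<in> {z. 0 \<le> Im z} \<inter> sphere 0 1 \<and> \<not> 0 \<le> Im z \<or> z \<in> {z. Im z \<le> 0} \<inter> sphere 0 1 \<and> 0 \<le> Im z \<longrightarrow>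
        \<phi> (arccos (Re z)) = \<phi> (- arccos (Re z))"
    proof (intro allI impI)
      fix z :: complex
      assume "z \<in> {z. 0 \<le> Im z} \<inter> sphere 0 1 \<and> \<not> 0 \<le> Im z \<or> z \<in> {z. Im z \<le> 0} \<inter> sphere 0 1 \<and> 0 \<le> Im z"
      then have "Im z = 0" "cmod z = 1" by auto
      then have "Re z = 1 \<or> Re z = -1" by (auto simp: cmod_def abs_if split: if_splits)
      then show "\<phi> (arccos (Re z)) = \<phi> (- arccos (Re z))" using \<phi>(2) by auto
    qed
  qed
  moreover have "({z. 0 \<le> Im z} \<inter> sphere 0 1) \<union> ({z. Im z \<le> 0} \<inter> sphere 0 1) = sphere (0::complex) 1" by auto
  ultimately have cont: "continuous_on (sphere 0 1) \<psi>" by simp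
  obtain g where g: "real_polynomial_function g" "\<And>z. z \<in> sphere 0 1 \<Longrightarrow> \<bar>\<psi> z - g z\<bar> < e"
    by (rule Stone_Weierstrass_real_polynomial_function[OF _ cont e]) auto
  have \<psi>_cis: "\<psi> (cis \<theta>) = \<phi> \<theta>" if \<theta>: "\<theta> \<in> {-pi..pi}" for \<theta>
  proof (cases "0 \<le> \<theta>")
    case True
    then have "0 \<le> sin \<theta>" "arccos (cos \<theta>) = \<theta>" using \<theta> by (auto intro: sin_ge_zero arccos_cos)
    then show ?thesis by (simp add: \<psi>_def)
  next
    case False
    then have arc: "arccos (cos \<theta>) = - \<theta>" using \<theta> arccos_cos[of "- \<theta>"] by auto
    show ?thesis
    proof (cases "\<theta> = -pi")
      case True
      then show ?thesis using \<phi>(2) by (simp add: \<psi>_def)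
    next
      case False
      then have "0 < sin (- \<theta>)" using \<theta> \<open>\<not> 0 \<le> \<theta>\<close> by (intro sin_gt_zero) auto
      then show ?thesis using arc by (simp add: \<psi>_def)
    qed
  qed
  show thesis
  proof (rule that[OF is_trigpoly_real_polynomial_cis[OF g(1)]])
    fix \<theta> assume \<theta>: "\<theta> \<in> {-pi..pi}"
    have "\<bar>\<phi> \<theta> - g (cis \<theta>)\<bar> < e" using g(2)[OF cis_mem_sphere, of \<theta>] unfolding \<psi>_cis[OF \<theta>] .
    then show "cmod (of_real (\<phi> \<theta>) - of_real (g (cis \<theta>))) < e"
      by (simp flip: of_real_diff)
  qed
qed

lemma integrable_indicator_lebesgue_on:
  assumes "S \<in> lmeasurable" "S \<subseteq> {a..b::real}"
  shows "integrable (lebesgue_on {a..b}) (indicator S :: real \<Rightarrow> real)"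
proof (rule integrable_real_indicator)
  show "S \<in> sets (lebesgue_on {a..b})" using assms by (subst sets_restrict_space_iff) auto
  show "emeasure (lebesgue_on {a..b}) S < \<infinity>"
    using assms fmeasurableD2[OF assms(1)] by (subst emeasure_restrict_space) (auto simp: less_top)
qed

lemma measure_le_of_emeasure:
  assumes "S \<in> lmeasurable" "emeasure lebesgue S < ennreal e"
  shows "measure lebesgue S \<le> e"
proof -
  have "emeasure lebesgue S = ennreal (measure lebesgue S)"
    using fmeasurableD2[OF assms(1)] by (simp add: emeasure_eq_ennreal_measure)
  then show ?thesis using assms(2) by (simp add: ennreal_less_iff)
qed

text \<open>Regularity of Lebesgue measure and a Urysohn function between a closed set inside and an
  open set outside. Removing the end points and keeping \<open>V\<close> inside the open interval
  forces \<open>\<phi>\<close> to vanish at -pi and pi, so it is periodic and accessible to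
  trigonometric approximation. \<open>D\<close> contains all points of the interval where
  \<open>\<phi>\<close> may differ from the indicator.\<close>

lemma indicator_approx_continuous:
  fixes A :: "real set"
  assumes A: "A \<in> sets lebesgue" "A \<subseteq> {-pi..pi}" and e: "0 < e"
  obtains \<phi> :: "real \<Rightarrow> real" where "continuous_on UNIV \<phi>" "\<phi> (-pi) = \<phi> pi"
    "(LINT \<theta>|lebesgue_on {-pi..pi}. \<bar>indicator A \<theta> - \<phi> \<theta>\<bar>) \<le> e"
proof -
  define A' where "A' = A \<inter> {-pi<..<pi}"
  have A': "A' \<in> sets lebesgue" using A by (auto simp: A'_def)
  obtain K where K: "closed K" "K \<subseteq> A'" "A' - K \<in> lmeasurable" "emeasure lebesgue (A' - K) < ennreal (e / 2)"
    using sets_lebesgue_inner_closed[OF A', of "e / 2"] e by auto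
  obtain U where U: "open U" "A' \<subseteq> U" "U - A' \<in> lmeasurable" "emeasure lebesgue (U - A') < ennreal (e / 2)"
    using sets_lebesgue_outer_open[OF A', of "e / 2"] e by auto
  define V where "V = U \<inter> {-pi<..<pi}"
  have V: "open V" "A' \<subseteq> V" "K \<subseteq> V" using U K by (auto simp: V_def A'_def)
  obtain \<phi> :: "real \<Rightarrow> real" where \<phi>: "continuous_on UNIV \<phi>" "\<And>x. \<phi> x \<in> closed_segment 1 0"
    "\<And>x. x \<in> K \<Longrightarrow> \<phi> x = 1" "\<And>x. x \<in> - V \<Longrightarrow> \<phi> x = 0"
    using Urysohn[of K "- V" 1 0] K V by (auto simp: closed_Compl)
  have \<phi>01: "0 \<le> \<phi> x" "\<phi> x \<le> 1" for x using \<phi>(2)[of x] by (auto simp: closed_segment_eq_real_ivl)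
  have ends: "\<phi> (-pi) = 0" "\<phi> pi = 0" using \<phi>(4) by (auto simp: V_def)
  define D where "D = (A' - K) \<union> (U - A') \<union> {-pi, pi}"
  have null: "negligible {-pi, pi}" by (rule negligible_finite) simp
  have D: "D \<in> lmeasurable"
    unfolding D_def using K U negligible_imp_measurable[OF null] by (intro fmeasurable.Un) auto
  have mK: "measure lebesgue (A' - K) \<le> e / 2" "measure lebesgue (U - A') \<le> e / 2"
    by (rule measure_le_of_emeasure[OF K(3,4)], rule measure_le_of_emeasure[OF U(3,4)])
  have "measure lebesgue D \<le> measure lebesgue ((A' - K) \<union> (U - A')) + measure lebesgue {-pi, pi}"
    unfolding D_def using K U negligible_imp_measurable[OF null] by (intro measure_Un_le) auto
  also have "measure lebesgue {-pi, pi} = 0" by (rule negligible_imp_measure0[OF null])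
  also have "measure lebesgue ((A' - K) \<union> (U - A')) \<le> measure lebesgue (A' - K) + measure lebesgue (U - A')"
    using K U by (intro measure_Un_le) auto
  finally have mD: "measure lebesgue D \<le> e" using mK by simp
  have "(LINT \<theta>|lebesgue_on {-pi..pi}. \<bar>indicator A \<theta> - \<phi> \<theta>\<bar>) \<le> (LINT \<theta>|lebesgue_on {-pi..pi}. indicator (D \<inter> {-pi..pi}) \<theta>)"
  proof (rule integral_mono)
    have "A \<in> lmeasurable" using A by (meson bounded_set_imp_lmeasurable bounded_subset bounded_closed_interval)
    then have "integrable (lebesgue_on {-pi..pi}) (indicator A :: real \<Rightarrow> real)"
      by (rule integrable_indicator_lebesgue_on[OF _ A(2)])
    moreover have "integrable (lebesgue_on {-pi..pi}) \<phi>"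
      by (intro continuous_imp_integrable_real continuous_on_subset[OF \<phi>(1)]) auto
    ultimately show "integrable (lebesgue_on {-pi..pi}) (\<lambda>\<theta>. \<bar>indicator A \<theta> - \<phi> \<theta>\<bar>)" by auto
    show "integrable (lebesgue_on {-pi..pi}) (indicator (D \<inter> {-pi..pi}) :: real \<Rightarrow> real)"
      by (rule integrable_indicator_lebesgue_on[OF fmeasurable_Int_fmeasurable[OF D]]) auto
    fix x assume "x \<in> space (lebesgue_on {-pi..pi})"
    then have x: "x \<in> {-pi..pi}" by simp
    show "\<bar>indicator A x - \<phi> x\<bar> \<le> (indicator (D \<inter> {-pi..pi}) x :: real)"
    proof (cases "x \<in> D")
      case True
      then show ?thesis using x \<phi>01[of x] by (auto simp: indicator_def)
    next
      case False
      then have "x \<in> {-pi<..<pi}" using x by (auto simp: D_def)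
      then have "x \<in> K \<and> x \<in> A \<or> x \<notin> V \<and> x \<notin> A" using False K V by (auto simp: A'_def V_def D_def)
      then show ?thesis using \<phi>(3,4) by auto
    qed
  qed
  also have "\<dots> = measure lebesgue (D \<inter> {-pi..pi})"
  proof -
    have "D \<inter> {-pi..pi} \<in> sets lebesgue" using D by (intro sets.Int) auto
    then show ?thesis by (simp add: measure_restrict_space Int_absorb2)
  qed
  also have "\<dots> \<le> measure lebesgue D" using D by (intro measure_mono_fmeasurable sets.Int) auto
  also have "\<dots> \<le> e" by (rule mD)
  finally show thesis using that[of \<phi>] \<phi>(1) ends by simp
qed

lemma is_trigpoly_dense_L1:
  assumes "integrable (lebesgue_on {-pi..pi}) f" "0 < e"
  shows "\<exists>p. is_trigpoly p \<and> (LINT \<theta>|lebesgue_on {-pi..pi}. cmod (f \<theta> - p \<theta>)) < e"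
  using assms
proof (induction f arbitrary: e rule: integrable_induct)
  case (base A c)
  have A: "A \<in> sets lebesgue" "A \<subseteq> {-pi..pi}" using base(1) by (auto simp: sets_restrict_space)
  \<comment> \<open>Two errors add up: \<open>d\<close> in the L^1 distance to
    \<open>\<phi>\<close>, and a uniform error \<open>d\<close> over length 2 pi. With factor |c|
    they total at most e / 2; the summand 1 beside \<open>cmod c\<close> admits c = 0.\<close>
  define d where "d = e / (2 * (1 + 2 * pi) * (cmod c + 1))"
  have pos: "0 < 2 * (1 + 2 * pi) * (cmod c + 1)" by (intro mult_pos_pos) (auto intro: add_pos_nonneg add_nonneg_pos)
  then have d: "0 < d" using base(3) by (simp add: d_def)
  obtain \<phi> :: "real \<Rightarrow> real" where \<phi>: "continuous_on UNIV \<phi>" "\<phi> (-pi) = \<phi> pi"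
    "(LINT \<theta>|lebesgue_on {-pi..pi}. \<bar>indicator A \<theta> - \<phi> \<theta>\<bar>) \<le> d"
    by (rule indicator_approx_continuous[OF A d])
  obtain p where p: "is_trigpoly p" "\<And>\<theta>. \<theta> \<in> {-pi..pi} \<Longrightarrow> cmod (of_real (\<phi> \<theta>) - p \<theta>) < d"
    by (rule is_trigpoly_uniform_approx[OF continuous_on_subset[OF \<phi>(1)] \<phi>(2) d]) auto
  have fA: "A \<in> lmeasurable" using A by (meson bounded_set_imp_lmeasurable bounded_subset bounded_closed_interval)
  have iA: "integrable (lebesgue_on {-pi..pi}) (indicator A :: real \<Rightarrow> real)"
    by (rule integrable_indicator_lebesgue_on[OF fA A(2)])
  have i\<phi>: "integrable (lebesgue_on {-pi..pi}) \<phi>"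
    by (intro continuous_imp_integrable_real continuous_on_subset[OF \<phi>(1)]) auto
  have i1: "integrable (lebesgue_on {-pi..pi}) (\<lambda>\<theta>. \<bar>indicator A \<theta> - \<phi> \<theta>\<bar>)" using iA i\<phi> by auto
  have ic: "integrable (lebesgue_on {-pi..pi}) (\<lambda>\<theta>. d)"
    by (rule continuous_imp_integrable_real) auto
  have "(LINT \<theta>|lebesgue_on {-pi..pi}. cmod (indicator A \<theta> *\<^sub>R c - p \<theta> * c)) \<le>
      (LINT \<theta>|lebesgue_on {-pi..pi}. cmod c * (\<bar>indicator A \<theta> - \<phi> \<theta>\<bar> + d))"
  proof (rule integral_mono)
    show "integrable (lebesgue_on {-pi..pi}) (\<lambda>\<theta>. cmod (indicator A \<theta> *\<^sub>R c - p \<theta> * c))"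
      using iA is_trigpoly_integrable[OF p(1)] by auto
    show "integrable (lebesgue_on {-pi..pi}) (\<lambda>\<theta>. cmod c * (\<bar>indicator A \<theta> - \<phi> \<theta>\<bar> + d))"
      using i1 ic by (intro integrable_mult_right Bochner_Integration.integrable_add)
    fix \<theta> assume "\<theta> \<in> space (lebesgue_on {-pi..pi})"
    then have \<theta>: "\<theta> \<in> {-pi..pi}" by simp
    have "indicator A \<theta> *\<^sub>R c - p \<theta> * c = c * (of_real (indicator A \<theta> - \<phi> \<theta>) + (of_real (\<phi> \<theta>) - p \<theta>))"
      by (simp add: scaleR_conv_of_real algebra_simps)
    then have "cmod (indicator A \<theta> *\<^sub>R c - p \<theta> * c) = cmod c * cmod (of_real (indicator A \<theta> - \<phi> \<theta>) + (of_real (\<phi> \<theta>) - p \<theta>))"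
      by (simp only: norm_mult)
    also have "\<dots> \<le> cmod c * (\<bar>indicator A \<theta> - \<phi> \<theta>\<bar> + d)"
      using p(2)[OF \<theta>] norm_of_real[of "indicator A \<theta> - \<phi> \<theta>"]
      by (intro mult_left_mono order_trans[OF norm_triangle_ineq] add_mono) (auto simp del: of_real_diff)
    finally show "cmod (indicator A \<theta> *\<^sub>R c - p \<theta> * c) \<le> cmod c * (\<bar>indicator A \<theta> - \<phi> \<theta>\<bar> + d)" .
  qed
  also have "\<dots> = cmod c * ((LINT \<theta>|lebesgue_on {-pi..pi}. \<bar>indicator A \<theta> - \<phi> \<theta>\<bar>) + 2 * pi * d)"
    using i1 ic by (simp add: measure_restrict_space)
  also have "\<dots> \<le> cmod c * (d + 2 * pi * d)" using \<phi>(3) by (intro mult_left_mono) auto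
  also have "\<dots> \<le> (cmod c + 1) * (d * (1 + 2 * pi))"
    using d by (simp add: algebra_simps)
  also have "\<dots> = e / 2" using pos by (simp add: d_def field_simps)
  also have "\<dots> < e" using base(3) by simp
  finally show ?case using is_trigpoly_mult[OF p(1) is_trigpoly_const[of c]] by blast
next
  case (add f g)
  obtain p q where p: "is_trigpoly p" "(LINT \<theta>|lebesgue_on {-pi..pi}. cmod (f \<theta> - p \<theta>)) < e / 2"
    and q: "is_trigpoly q" "(LINT \<theta>|lebesgue_on {-pi..pi}. cmod (g \<theta> - q \<theta>)) < e / 2"
    using add(3)[of "e / 2"] add(4)[of "e / 2"] add(5) by auto
  have i: "integrable (lebesgue_on {-pi..pi}) (\<lambda>\<theta>. cmod (f \<theta> - p \<theta>))" "integrable (lebesgue_on {-pi..pi}) (\<lambda>\<theta>. cmod (g \<theta> - q \<theta>))"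
    using add is_trigpoly_integrable[OF p(1)] is_trigpoly_integrable[OF q(1)] by auto
  have "(LINT \<theta>|lebesgue_on {-pi..pi}. cmod (f \<theta> + g \<theta> - (p \<theta> + q \<theta>))) \<le>
      (LINT \<theta>|lebesgue_on {-pi..pi}. cmod (f \<theta> - p \<theta>) + cmod (g \<theta> - q \<theta>))"
  proof (rule integral_mono)
    show "integrable (lebesgue_on {-pi..pi}) (\<lambda>\<theta>. cmod (f \<theta> + g \<theta> - (p \<theta> + q \<theta>)))"
      using add is_trigpoly_integrable[OF p(1)] is_trigpoly_integrable[OF q(1)] by auto
    show "cmod (f \<theta> + g \<theta> - (p \<theta> + q \<theta>)) \<le> cmod (f \<theta> - p \<theta>) + cmod (g \<theta> - q \<theta>)" for \<theta>
      using norm_triangle_ineq[of "f \<theta> - p \<theta>" "g \<theta> - q \<theta>"] by (simp add: algebra_simps)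
  qed (use i in auto)
  also have "\<dots> < e" using i p(2) q(2) by simp
  finally show ?case using is_trigpoly_add[OF p(1) q(1)] by blast
next
  case (lim f s)
  let ?M = "lebesgue_on {-pi..pi}"
  have "(\<lambda>i. LINT \<theta>|?M. cmod (f \<theta> - s i \<theta>)) \<longlonglongrightarrow> (LINT \<theta>|?M. 0)"
  \<comment> \<open>The induction rule supplies |s i| <= 2 |f|, whence the majorant 3 |f|.\<close>
  proof (rule integral_dominated_convergence[where w = "\<lambda>\<theta>. 3 * cmod (f \<theta>)"])
    show "(\<lambda>\<theta>. cmod (f \<theta> - s i \<theta>)) \<in> borel_measurable ?M" for i
      using lim(1)[of i] lim(4) by auto
    show "integrable ?M (\<lambda>\<theta>. 3 * cmod (f \<theta>))" using lim(4) by auto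
    show "AE \<theta> in ?M. (\<lambda>i. cmod (f \<theta> - s i \<theta>)) \<longlonglongrightarrow> 0"
    proof (rule AE_I2)
      fix \<theta> assume "\<theta> \<in> space ?M"
      from tendsto_norm[OF tendsto_diff[OF tendsto_const[of "f \<theta>"] lim(2)[OF this]]]
      show "(\<lambda>i. cmod (f \<theta> - s i \<theta>)) \<longlonglongrightarrow> 0" by simp
    qed
    show "AE \<theta> in ?M. norm (cmod (f \<theta> - s i \<theta>)) \<le> 3 * cmod (f \<theta>)" for i
    proof (rule AE_I2)
      fix \<theta> assume "\<theta> \<in> space ?M"
      then show "norm (cmod (f \<theta> - s i \<theta>)) \<le> 3 * cmod (f \<theta>)"
        using lim(3)[of \<theta> i] norm_triangle_ineq4[of "f \<theta>" "s i \<theta>"] by simp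
    qed
  qed simp
  then have "\<forall>\<^sub>F i in sequentially. (LINT \<theta>|?M. cmod (f \<theta> - s i \<theta>)) < e / 2"
    using lim(6) by (intro order_tendstoD(2)) auto
  then obtain i where i: "(LINT \<theta>|?M. cmod (f \<theta> - s i \<theta>)) < e / 2"
    by (auto simp: eventually_sequentially)
  obtain p where p: "is_trigpoly p" "(LINT \<theta>|?M. cmod (s i \<theta> - p \<theta>)) < e / 2"
    using lim(5)[of "e / 2" i] lim(6) by auto
  have ii: "integrable ?M (\<lambda>\<theta>. cmod (f \<theta> - s i \<theta>))" "integrable ?M (\<lambda>\<theta>. cmod (s i \<theta> - p \<theta>))"
    using lim(1)[of i] lim(4) is_trigpoly_integrable[OF p(1)] by auto
  have "(LINT \<theta>|?M. cmod (f \<theta> - p \<theta>)) \<le> (LINT \<theta>|?M. cmod (f \<theta> - s i \<theta>) + cmod (s i \<theta> - p \<theta>))"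
  proof (rule integral_mono)
    show "integrable ?M (\<lambda>\<theta>. cmod (f \<theta> - p \<theta>))" using lim(4) is_trigpoly_integrable[OF p(1)] by auto
    show "cmod (f \<theta> - p \<theta>) \<le> cmod (f \<theta> - s i \<theta>) + cmod (s i \<theta> - p \<theta>)" for \<theta>
      using norm_triangle_ineq[of "f \<theta> - s i \<theta>" "s i \<theta> - p \<theta>"] by simp
  qed (use ii in auto)
  also have "\<dots> < e" using ii i p(2) by simp
  finally show ?case using p(1) by blast
qed

subsection \<open>Sequences of matrices controlled together with their symbols\<close>

text \<open>Bounding the matrices and the symbol by the same parameters lets every approximation
  step be carried out once for both.\<close>

definition small_off :: "real \<Rightarrow> real \<Rightarrow> (real \<times> real \<Rightarrow> complex) \<Rightarrow> bool" where
  "small_off c w g \<longleftrightarrow> (\<exists>S\<in>lmeasurable. measure lebesgue S \<le> c \<and> (\<forall>z\<in>GLT_domain - S. cmod (g z) \<le> w))"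

definition controlled :: "real \<Rightarrow> real \<Rightarrow> (nat \<Rightarrow> cmfun) \<Rightarrow> (real \<times> real \<Rightarrow> complex) \<Rightarrow> bool" where
  "controlled c w A g \<longleftrightarrow> small_off c w g \<and> (\<forall>\<^sub>F n in sequentially. splits n (c * real n) w (A n))"

lemma small_off_add:
  assumes "small_off c w g" "small_off c' w' h"
  shows "small_off (c + c') (w + w') (\<lambda>z. g z + h z)"
proof -
  obtain S T where S: "S \<in> lmeasurable" "measure lebesgue S \<le> c" "\<And>z. z \<in> GLT_domain - S \<Longrightarrow> cmod (g z) \<le> w"
    and T: "T \<in> lmeasurable" "measure lebesgue T \<le> c'" "\<And>z. z \<in> GLT_domain - T \<Longrightarrow> cmod (h z) \<le> w'"
    using assms unfolding small_off_def by blast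
  have "measure lebesgue (S \<union> T) \<le> measure lebesgue S + measure lebesgue T"
    using S T by (intro measure_Un_le) auto
  moreover have "cmod (g z + h z) \<le> w + w'" if "z \<in> GLT_domain - (S \<union> T)" for z
    using norm_triangle_ineq[of "g z" "h z"] S(3)[of z] T(3)[of z] that by auto
  ultimately show ?thesis
    unfolding small_off_def using S T by (intro bexI[of _ "S \<union> T"]) auto
qed

lemma small_off_mult:
  assumes "small_off c w g" "small_off c' w' h"
  shows "small_off (c + c') (w * w') (\<lambda>z. g z * h z)"
proof -
  obtain S T where S: "S \<in> lmeasurable" "measure lebesgue S \<le> c" "\<And>z. z \<in> GLT_domain - S \<Longrightarrow> cmod (g z) \<le> w"
    and T: "T \<in> lmeasurable" "measure lebesgue T \<le> c'" "\<And>z. z \<in> GLT_domain - T \<Longrightarrow> cmod (h z) \<le> w'"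
    using assms unfolding small_off_def by blast
  have "measure lebesgue (S \<union> T) \<le> measure lebesgue S + measure lebesgue T"
    using S T by (intro measure_Un_le) auto
  moreover have "cmod (g z * h z) \<le> w * w'" if "z \<in> GLT_domain - (S \<union> T)" for z
  proof -
    have "cmod (g z) \<le> w" "cmod (h z) \<le> w'" using S(3)[of z] T(3)[of z] that by auto
    then show ?thesis unfolding norm_mult by (intro mult_mono) (auto intro: order_trans[OF norm_ge_zero])
  qed
  ultimately show ?thesis
    unfolding small_off_def using S T by (intro bexI[of _ "S \<union> T"]) auto
qed

lemma small_off_mono: "small_off c w g \<Longrightarrow> c \<le> c' \<Longrightarrow> w \<le> w' \<Longrightarrow> small_off c' w' g"
  unfolding small_off_def by (meson order_trans)

lemma small_off_bounded: "(\<And>z. z \<in> GLT_domain \<Longrightarrow> cmod (g z) \<le> w) \<Longrightarrow> 0 \<le> c \<Longrightarrow> small_off c w g"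
  unfolding small_off_def by (intro bexI[of _ "{}"]) auto

lemma controlled_add:
  assumes "controlled c w A g" "controlled c' w' B h"
  shows "controlled (c + c') (w + w') (\<lambda>n i j. A n i j + B n i j) (\<lambda>z. g z + h z)"
proof -
  have "\<forall>\<^sub>F n in sequentially. splits n ((c + c') * real n) (w + w') (\<lambda>i j. A n i j + B n i j)"
    using assms[unfolded controlled_def, THEN conjunct2]
    by eventually_elim (simp add: distrib_right splits_add)
  then show ?thesis using assms by (simp add: controlled_def small_off_add)
qed

lemma controlled_mult:
  assumes "controlled c w A g" "controlled c' w' B h"
  shows "controlled (c + c') (w * w') (\<lambda>n. mm n (A n) (B n)) (\<lambda>z. g z * h z)"
proof -
  have "\<forall>\<^sub>F n in sequentially. splits n ((c + c') * real n) (w * w') (mm n (A n) (B n))"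
    using assms[unfolded controlled_def, THEN conjunct2]
    by eventually_elim (simp add: distrib_right splits_mult)
  then show ?thesis using assms by (simp add: controlled_def small_off_mult)
qed

lemma controlled_mono:
  assumes "controlled c w A g" "c \<le> c'" "w \<le> w'"
  shows "controlled c' w' A g"
proof -
  have "\<forall>\<^sub>F n in sequentially. splits n (c' * real n) w' (A n)"
    using assms(1)[unfolded controlled_def, THEN conjunct2]
  proof eventually_elim
    case (elim n)
    then show ?case by (rule splits_mono) (use assms(2,3) in \<open>auto intro: mult_right_mono\<close>)
  qed
  then show ?thesis using assms small_off_mono by (auto simp: controlled_def)
qed

lemma controlled_cong:
  assumes "controlled c w A g" "\<And>n i j. i < n \<Longrightarrow> j < n \<Longrightarrow> A n i j = B n i j" "\<And>z. g z = h z"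
  shows "controlled c w B h"
proof -
  have "\<forall>\<^sub>F n in sequentially. splits n (c * real n) w (B n)"
    using assms(1)[unfolded controlled_def, THEN conjunct2]
    by eventually_elim (rule splits_cong[OF assms(2)])
  moreover have "g = h" using assms(3) by blast
  ultimately show ?thesis using assms(1) by (simp add: controlled_def)
qed

lemma measure_Times_lebesgue:
  fixes A B :: "real set"
  assumes "A \<in> sets borel" "B \<in> sets borel" "A \<in> lmeasurable" "B \<in> lmeasurable"
  shows "A \<times> B \<in> lmeasurable" "measure lebesgue (A \<times> B) = measure lebesgue A * measure lebesgue B"
proof -
  have AB: "A \<times> B \<in> sets borel" using assms(1,2) by (simp add: borel_prod[symmetric])
  have "emeasure lborel (A \<times> B) = emeasure lborel A * emeasure lborel B"
    unfolding lborel_prod[symmetric] using assms(1,2) by (subst lborel.emeasure_pair_measure_Times) auto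
  then have em: "emeasure lebesgue (A \<times> B) = emeasure lebesgue A * emeasure lebesgue B"
    using assms(1,2) AB by simp
  have "emeasure lebesgue A < \<infinity>" "emeasure lebesgue B < \<infinity>"
    unfolding less_top[symmetric] infinity_ennreal_def by (rule fmeasurableD2[OF assms(3)], rule fmeasurableD2[OF assms(4)])
  then have "emeasure lebesgue (A \<times> B) < \<infinity>"
    unfolding em by (simp only: ennreal_mult_less_top infinity_ennreal_def) blast
  then show "A \<times> B \<in> lmeasurable" using AB by (intro fmeasurableI) simp
  show "measure lebesgue (A \<times> B) = measure lebesgue A * measure lebesgue B"
    unfolding measure_def em by (simp add: enn2real_mult)
qed

text \<open>An open superset is Borel, so its product with an interval falls under
  \<open>measure_Times_lebesgue\<close>. Exceptional sets of one variable are enlarged in this way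
  before they are turned into sets in the plane.\<close>

lemma open_superset_measure:
  fixes T :: "real set"
  assumes "T \<in> lmeasurable" "measure lebesgue T < c"
  obtains U where "open U" "T \<subseteq> U" "U \<in> lmeasurable" "measure lebesgue U \<le> c"
proof -
  obtain U where U: "open U" "T \<subseteq> U" "U - T \<in> lmeasurable" "emeasure lebesgue (U - T) < ennreal (c - measure lebesgue T)"
    using sets_lebesgue_outer_open[OF fmeasurableD[OF assms(1)], of "c - measure lebesgue T"] assms(2) by auto
  have eq: "U = T \<union> (U - T)" using U(2) by auto
  have "U \<in> lmeasurable" using U(3) assms(1) eq by (metis fmeasurable.Un)
  moreover have "measure lebesgue U \<le> measure lebesgue T + measure lebesgue (U - T)"
    using measure_Un_le[of T lebesgue "U - T"] U(3) assms(1) eq by auto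
  moreover have "measure lebesgue (U - T) \<le> c - measure lebesgue T" by (rule measure_le_of_emeasure[OF U(3,4)])
  ultimately show thesis using U that by simp
qed

text \<open>For the matrices, \<open>splits_toep\<close> is used with r = t = e / 4. For the symbol,
  Markov's inequality gives e |T| <= e^2 / 16, which leaves room for an open set \<open>U\<close>
  around \<open>T\<close>.\<close>

lemma controlled_toep:
  assumes f: "integrable (lebesgue_on {-pi..pi}) f" and e: "0 < e"
    and le: "(LINT \<theta>|lebesgue_on {-pi..pi}. cmod (f \<theta>)) \<le> e / 4 * (e / 4)"
  shows "controlled e e (\<lambda>n. toep f) (\<lambda>(x, \<theta>). f \<theta>)"
  unfolding controlled_def
proof
  have "splits n (e * real n) e (toep f)" for n
    using splits_toep[OF f _ le, of n] e by (simp add: mult.commute)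
  then show "\<forall>\<^sub>F n in sequentially. splits n (e * real n) e (toep f)" by simp
  define T where "T = {\<theta>\<in>{-pi..pi}. e < cmod (f \<theta>)}"
  have "T = {\<theta>\<in>space (lebesgue_on {-pi..pi}). e < cmod (f \<theta>)}" by (simp add: T_def)
  also have "\<dots> \<in> sets (lebesgue_on {-pi..pi})"
  proof -
    have [measurable]: "f \<in> borel_measurable (lebesgue_on {-pi..pi})" by (rule borel_measurable_integrable[OF f])
    show ?thesis by measurable
  qed
  finally have "T \<in> sets (lebesgue_on {-pi..pi})" .
  then have Ts: "T \<in> sets lebesgue" using sets_restrict_space_iff[of "{-pi..pi}" lebesgue T] by simp
  have T2: "T \<subseteq> {-pi..pi}" by (auto simp: T_def)
  have T: "T \<in> lmeasurable" "T \<subseteq> {-pi..pi}"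
    by (rule bounded_set_imp_lmeasurable[OF bounded_subset[OF bounded_closed_interval T2] Ts]) (rule T2)
  have "e * measure lebesgue T = (LINT \<theta>|lebesgue_on {-pi..pi}. e * indicator T \<theta>)"
    using T by (simp add: measure_restrict_space Int_absorb2)
  also have "\<dots> \<le> (LINT \<theta>|lebesgue_on {-pi..pi}. cmod (f \<theta>))"
  proof (rule integral_mono)
    show "integrable (lebesgue_on {-pi..pi}) (\<lambda>\<theta>. e * indicator T \<theta>)"
      by (intro integrable_mult_right integrable_indicator_lebesgue_on T)
    show "e * indicator T \<theta> \<le> cmod (f \<theta>)" for \<theta> using e by (auto simp: indicator_def T_def)
  qed (use f in auto)
  also have "\<dots> \<le> e * (e / 16)" using le by simp
  finally have "measure lebesgue T < e" using e by simp
  then obtain U where U: "open U" "T \<subseteq> U" "U \<in> lmeasurable" "measure lebesgue U \<le> e"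
    using open_superset_measure[OF T(1)] by blast
  have V: "{0..1::real} \<times> U \<in> lmeasurable" "measure lebesgue ({0..1::real} \<times> U) = measure lebesgue {0..1::real} * measure lebesgue U"
    by (rule measure_Times_lebesgue[OF _ borel_open[OF U(1)] _ U(3)]; simp)+
  have "measure lebesgue ({0..1::real} \<times> U) \<le> e" unfolding V(2) using U(4) by simp
  then show "small_off e e (\<lambda>(x, \<theta>). f \<theta>)"
    unfolding small_off_def using V(1) U(2) by (intro bexI[of _ "{0..1} \<times> U"]) (auto simp: T_def not_less)
qed

abbreviation diag_fun :: "(nat \<Rightarrow> complex) \<Rightarrow> cmfun" where
  "diag_fun d \<equiv> \<lambda>i j. if i = j then d i else 0"

lemma mm_diag_fun: "i < n \<Longrightarrow> mm n (diag_fun d) T i j = d i * T i j"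
proof -
  assume i: "i < n"
  have "mm n (diag_fun d) T i j = (\<Sum>l<n. if l = i then d i * T l j else 0)"
    unfolding mm_def by (rule sum.cong) auto
  then show ?thesis using i by simp
qed

lemma controlled_diag_continuous:
  assumes "continuous_on UNIV b"
  obtains M where "0 \<le> M" "controlled 0 M (\<lambda>n. diag_fun (\<lambda>i. b (real (i + 1) / real n))) (\<lambda>(x, \<theta>). b x)"
proof -
  have "compact (b ` {0..1})" by (intro compact_continuous_image continuous_on_subset[OF assms]) auto
  then obtain M where M: "\<And>x. x \<in> {0..1} \<Longrightarrow> cmod (b x) \<le> M"
    using compact_imp_bounded bounded_iff by (metis imageI)
  have M0: "0 \<le> M" using M[of 0] by (auto intro: order_trans[OF norm_ge_zero])
  have "splits n (0 * real n) M (diag_fun (\<lambda>i. b (real (i + 1) / real n)))" for n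
  proof (rule splits_op_bounded[OF op_bounded_diag[OF M0]])
    fix i assume "i < n"
    then show "cmod (b (real (i + 1) / real n)) \<le> M" by (intro M) (auto simp: field_simps)
  qed simp
  then have "controlled 0 M (\<lambda>n. diag_fun (\<lambda>i. b (real (i + 1) / real n))) (\<lambda>(x, \<theta>). b x)"
    unfolding controlled_def using M by (auto intro!: small_off_bounded)
  then show thesis using that M0 by blast
qed

text \<open>The Toeplitz matrix is a sum of 2r + 1 weighted shifts, so the sum of the moduli of the
  coefficients bounds its norm for every n, and bounds \<open>p\<close> as well.\<close>

lemma controlled_toep_trigpoly:
  assumes "is_trigpoly p"
  obtains M where "0 \<le> M" "controlled 0 M (\<lambda>n. toep p) (\<lambda>(x, \<theta>). p \<theta>)"
proof -
  from assms obtain r c where p: "p = trigpoly r c" unfolding is_trigpoly_def by blast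
  let ?M = "\<Sum>k\<in>{- int r..int r}. cmod (c k)"
  have shift: "op_bounded n (cmod (c k)) (\<lambda>i j. if int i - int j = k then c k else 0)" for n k
  proof (rule op_bounded_cong)
    show "op_bounded n (cmod (c k)) (\<lambda>i j. if i \<in> {i. k \<le> int i} \<and> j = nat (int i - k) then c k else 0)"
      by (rule op_bounded_weighted_partial_injection) (auto simp: inj_on_def)
  qed auto
  have sum: "op_bounded n (\<Sum>k\<in>I. w k) (\<lambda>i j. \<Sum>k\<in>I. A k i j)" if "finite I" "\<And>k. op_bounded n (w k) (A k)" for n w I and A :: "int \<Rightarrow> cmfun"
    using that(1) by induction (auto intro: op_bounded_add that(2) op_bounded_zero)
  have "op_bounded n ?M (toep p)" for n
  proof (rule op_bounded_cong)
    show "op_bounded n ?M (\<lambda>i j. \<Sum>k\<in>{- int r..int r}. if int i - int j = k then c k else 0)"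
      by (rule sum) (simp_all only: shift finite_atLeastAtMost_int)
  qed (auto simp: p fourier_coeff_trigpoly)
  then have "splits n (0 * real n) ?M (toep p)" for n by (simp add: splits_op_bounded)
  moreover have "cmod (p \<theta>) \<le> ?M" for \<theta>
    unfolding p trigpoly_def by (rule order_trans[OF norm_sum]) (simp add: norm_mult)
  ultimately have "controlled 0 ?M (\<lambda>n. toep p) (\<lambda>(x, \<theta>). p \<theta>)"
    unfolding controlled_def by (auto intro!: small_off_bounded)
  then show thesis by (intro that[of ?M]) (auto intro: sum_nonneg)
qed

text \<open>Outside an open set \<open>U\<close> of small measure containing the discontinuities, \<open>a\<close> agrees with a
  continuous \<open>b\<close>, and near that complement \<open>a\<close> stays close to \<open>b\<close>. The exceptional points thus
  lie in a compact subset of \<open>U\<close>, whose sampling points are counted by a Riemann sum.\<close>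

lemma ae_continuous_approx:
  fixes a :: "real \<Rightarrow> complex"
  assumes ae: "AE x in lebesgue_on {0..1}. continuous (at x within {0..1}) a" and e: "0 < e"
  obtains b where "continuous_on UNIV b"
    "controlled e e (\<lambda>n. diag_fun (\<lambda>i. a (real (i + 1) / real n) - b (real (i + 1) / real n))) (\<lambda>(x, \<theta>). a x - b x)"
proof -
  obtain N where N: "{x \<in> space (lebesgue_on {0..1}). \<not> continuous (at x within {0..1}) a} \<subseteq> N"
    "emeasure (lebesgue_on {0..1}) N = 0" "N \<in> sets (lebesgue_on {0..1})"
    using AE_E[OF ae] by blast
  have N2: "N \<in> sets lebesgue" "N \<subseteq> {0..1}" using N(3) by (auto simp: sets_restrict_space)
  have "emeasure lebesgue N = 0" using N(2) N2 by (simp add: emeasure_restrict_space)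
  then have Nnull: "negligible N" using N2 by (simp add: negligible_iff_null_sets null_sets_def)
  then have Nl: "N \<in> lmeasurable" "measure lebesgue N = 0"
    by (auto intro: negligible_imp_measurable negligible_imp_measure0)
  \<comment> \<open>The fraction e / 8 accounts for the product with [-pi, pi], whose length is
    below 8.\<close>
  obtain U where U: "open U" "N \<subseteq> U" "U \<in> lmeasurable" "measure lebesgue U \<le> e / 8"
    using open_superset_measure[OF Nl(1), of "e / 8"] Nl(2) e by auto
  define K where "K = {0..1} - U"
  have K: "closed K" "K \<subseteq> {0..1}" using U(1) by (auto simp: K_def intro: closed_Diff)
  have contK: "continuous (at x within {0..1}) a" if "x \<in> K" for x
    using that N(1) U(2) by (auto simp: K_def)
  have "continuous_on K a"
    unfolding continuous_on_eq_continuous_within using contK K(2) continuous_within_subset by blast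
  then obtain b where b: "continuous_on UNIV b" "\<And>x. x \<in> K \<Longrightarrow> b x = a x"
    using Tietze_unbounded[of K a UNIV] K(1) by auto
  have "\<exists>d>0. \<forall>y\<in>{0..1}. dist y x < d \<longrightarrow> cmod (a y - b y) < e" if x: "x \<in> K" for x
  proof -
    have "continuous (at x within {0..1}) (\<lambda>y. a y - b y)"
      using b(1) by (intro continuous_diff contK x) (simp add: continuous_on_eq_continuous_at continuous_at_imp_continuous_at_within)
    then show ?thesis
      using e b(2)[OF x] unfolding continuous_within_eps_delta by (auto simp: dist_norm)
  qed
  then obtain d where d: "\<And>x. x \<in> K \<Longrightarrow> 0 < d x" "\<And>x y. x \<in> K \<Longrightarrow> y \<in> {0..1} \<Longrightarrow> dist y x < d x \<Longrightarrow> cmod (a y - b y) < e"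
    by metis
  \<comment> \<open>A small measure of \<open>U\<close> says nothing about how many points i / n lie
    in \<open>U\<close>. The exceptional points are confined to the closed set
    \<open>{0..1} - W\<close> inside \<open>U\<close>, which leaves space for a continuous cutoff,
    and for continuous functions Riemann sums do converge.\<close>
  define W where "W = (\<Union>x\<in>K. ball x (d x))"
  have W: "open W" "K \<subseteq> W" using d(1) by (auto simp: W_def)
  have off: "cmod (a y - b y) < e" if "y \<in> {0..1}" "y \<in> W" for y
    using that d(2) by (auto simp: W_def dist_commute)
  have "closed ({0..1} - W)" "closed (- U)" "({0..1} - W) \<inter> - U = {}"
    using U(1) W by (auto simp: K_def intro: closed_Diff)
  then obtain \<phi> :: "real \<Rightarrow> real" where \<phi>: "continuous_on UNIV \<phi>" "\<And>x. \<phi> x \<in> closed_segment 1 0"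
    "\<And>x. x \<in> {0..1} - W \<Longrightarrow> \<phi> x = 1" "\<And>x. x \<in> - U \<Longrightarrow> \<phi> x = 0"
    by (rule Urysohn[where a = 1 and b = 0]) (rule that)
  have \<phi>01: "0 \<le> \<phi> x" "\<phi> x \<le> 1" for x using \<phi>(2)[of x] by (auto simp: closed_segment_eq_real_ivl)
  have i\<phi>: "integrable (lebesgue_on {0..1}) \<phi>"
    by (intro continuous_imp_integrable_real continuous_on_subset[OF \<phi>(1)]) auto
  have "integral {0..1} \<phi> = (LINT x|lebesgue_on {0..1}. \<phi> x)"
    by (rule lebesgue_integral_eq_integral[OF i\<phi>, symmetric]) simp
  also have "\<dots> \<le> (LINT x|lebesgue_on {0..1}. indicator (U \<inter> {0..1}) x)"
  proof (rule integral_mono[OF i\<phi>])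
    show "integrable (lebesgue_on {0..1}) (indicator (U \<inter> {0..1}) :: real \<Rightarrow> real)"
      by (rule integrable_indicator_lebesgue_on[OF fmeasurable_Int_fmeasurable[OF U(3)]]) auto
    show "\<phi> x \<le> indicator (U \<inter> {0..1}) x" if "x \<in> space (lebesgue_on {0..1})" for x
      using that \<phi>(4)[of x] \<phi>01[of x] by (cases "x \<in> U") auto
  qed
  also have "\<dots> = measure lebesgue (U \<inter> {0..1})"
  proof -
    have "U \<inter> {0..1} \<in> sets lebesgue" using U(3) by (intro sets.Int) auto
    then show ?thesis by (simp add: measure_restrict_space Int_absorb2)
  qed
  also have "\<dots> \<le> measure lebesgue U" using U(3) by (intro measure_mono_fmeasurable sets.Int) auto
  also have "\<dots> < e" using U(4) e by simp
  finally have "integral {0..1} \<phi> < e" .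
  then have "\<forall>\<^sub>F n in sequentially. (\<Sum>i<n. \<phi> (real (i + 1) / real n)) / real n < e"
    by (rule order_tendstoD(2)[OF riemann_sum_unit_interval[OF continuous_on_subset[OF \<phi>(1)]], rotated]) auto
  then have "\<forall>\<^sub>F n in sequentially. splits n (e * real n) e (diag_fun (\<lambda>i. a (real (i + 1) / real n) - b (real (i + 1) / real n)))"
    using eventually_gt_at_top[of 0]
  proof eventually_elim
    case (elim n)
    let ?S = "{i. i < n \<and> e < cmod (a (real (i + 1) / real n) - b (real (i + 1) / real n))}"
    have "real (card ?S) = (\<Sum>i\<in>?S. 1)" by simp
    also have "\<dots> \<le> (\<Sum>i\<in>?S. \<phi> (real (i + 1) / real n))"
    proof (rule sum_mono)
      fix i assume i: "i \<in> ?S"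
      have "real (i + 1) / real n \<in> {0..1}" using i by (auto simp: field_simps)
      moreover have "real (i + 1) / real n \<notin> W"
      proof
        assume "real (i + 1) / real n \<in> W"
        from off[OF \<open>real (i + 1) / real n \<in> {0..1}\<close> this] i show False by simp
      qed
      ultimately show "1 \<le> \<phi> (real (i + 1) / real n)" using \<phi>(3)[of "real (i + 1) / real n"] by simp
    qed
    also have "\<dots> \<le> (\<Sum>i<n. \<phi> (real (i + 1) / real n))"
      by (rule sum_mono2) (use \<phi>01 in auto)
    also have "\<dots> \<le> e * real n" using elim by (simp add: field_simps)
    finally show ?case using e by (intro splits_diag) auto
  qed
  moreover have "small_off e e (\<lambda>(x, \<theta>). a x - b x)"
  proof -
    have S: "U \<times> {-pi..pi} \<in> lmeasurable" "measure lebesgue (U \<times> {-pi..pi}) = measure lebesgue U * measure lebesgue {-pi..pi}"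
      by (rule measure_Times_lebesgue[OF borel_open[OF U(1)] _ U(3)]; simp)+
    have "measure lebesgue (U \<times> {-pi..pi}) = measure lebesgue U * (2 * pi)" unfolding S(2) by simp
    also have "\<dots> \<le> e / 8 * 8" using U(4) pi_less_4 e by (intro mult_mono) auto
    finally have "measure lebesgue (U \<times> {-pi..pi}) \<le> e" by simp
    moreover have "\<forall>z\<in>GLT_domain - U \<times> {-pi..pi}. cmod (case z of (x, \<theta>) \<Rightarrow> a x - b x) \<le> e"
    proof
      fix z assume z: "z \<in> GLT_domain - U \<times> {-pi..pi}"
      then have "fst z \<in> K" by (cases z) (auto simp: K_def)
      then show "cmod (case z of (x, \<theta>) \<Rightarrow> a x - b x) \<le> e" using b(2)[of "fst z"] e by (simp add: case_prod_beta)
    qed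
    ultimately show ?thesis unfolding small_off_def using S(1) by blast
  qed
  ultimately show thesis using that[OF b(1)] by (simp add: controlled_def)
qed

subsection \<open>Approximation of GLT sequences by diagonalized sequences\<close>

definition grid_mat :: "(nat \<Rightarrow> nat) \<Rightarrow> (real \<times> real \<Rightarrow> complex) \<Rightarrow> nat \<Rightarrow> cmfun" where
  "grid_mat m h n = Q_conj n (m n) (gridval n (m n) h)"

text \<open>The property that is carried from monomials to all diagonal times Toeplitz sequences, by
  closure under sums and under limits in the sense of \<open>controlled\<close>.\<close>

definition grid_approx :: "(nat \<Rightarrow> nat) \<Rightarrow> (nat \<Rightarrow> cmfun) \<Rightarrow> (real \<times> real \<Rightarrow> complex) \<Rightarrow> bool" where
  "grid_approx m A g \<longleftrightarrow> (\<forall>e>0. \<exists>h. nice h \<and> controlled e e (\<lambda>n i j. A n i j - grid_mat m h n i j) (\<lambda>z. g z - h z))"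

lemma nice_add: "nice g \<Longrightarrow> nice h \<Longrightarrow> nice (\<lambda>z. g z + h z)"
  by (auto simp: nice_def intro: continuous_intros)

lemma nice_diff: "nice g \<Longrightarrow> nice h \<Longrightarrow> nice (\<lambda>z. g z - h z)"
  by (auto simp: nice_def intro: continuous_intros)

lemma grid_mat_add: "grid_mat m (\<lambda>z. g z + h z) n i j = grid_mat m g n i j + grid_mat m h n i j"
  unfolding grid_mat_def Q_conj_def sum.distrib[symmetric]
  by (rule sum.cong) (auto simp: gridval_def algebra_simps)

lemma grid_mat_diff: "grid_mat m (\<lambda>z. g z - h z) n i j = grid_mat m g n i j - grid_mat m h n i j"
  unfolding grid_mat_def Q_conj_def sum_subtractf[symmetric]
  by (rule sum.cong) (auto simp: gridval_def algebra_simps)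

lemma grid_approx_add:
  assumes "grid_approx m A g" "grid_approx m B h"
  shows "grid_approx m (\<lambda>n i j. A n i j + B n i j) (\<lambda>z. g z + h z)"
  unfolding grid_approx_def
proof (intro allI impI)
  fix e :: real assume "0 < e"
  then have e2: "0 < e / 2" by simp
  obtain g' h' where g': "nice g'" "controlled (e/2) (e/2) (\<lambda>n i j. A n i j - grid_mat m g' n i j) (\<lambda>z. g z - g' z)"
    and h': "nice h'" "controlled (e/2) (e/2) (\<lambda>n i j. B n i j - grid_mat m h' n i j) (\<lambda>z. h z - h' z)"
    using assms e2 unfolding grid_approx_def by meson
  have "controlled (e/2 + e/2) (e/2 + e/2) (\<lambda>n i j. (A n i j - grid_mat m g' n i j) + (B n i j - grid_mat m h' n i j)) (\<lambda>z. (g z - g' z) + (h z - h' z))"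
    by (rule controlled_add[OF g'(2) h'(2)])
  then have "controlled e e (\<lambda>n i j. A n i j + B n i j - grid_mat m (\<lambda>z. g' z + h' z) n i j) (\<lambda>z. g z + h z - (g' z + h' z))"
    by (simp add: grid_mat_add algebra_simps)
  then show "\<exists>f. nice f \<and> controlled e e (\<lambda>n i j. A n i j + B n i j - grid_mat m f n i j) (\<lambda>z. g z + h z - f z)"
    using nice_add[OF g'(1) h'(1)] by blast
qed

lemma grid_approx_limit:
  assumes "\<And>e. 0 < e \<Longrightarrow> \<exists>B h. grid_approx m B h \<and> controlled e e (\<lambda>n i j. A n i j - B n i j) (\<lambda>z. g z - h z)"
  shows "grid_approx m A g"
  unfolding grid_approx_def
proof (intro allI impI)
  fix e :: real assume "0 < e"
  then have e2: "0 < e / 2" by simp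
  obtain B h where B: "grid_approx m B h" "controlled (e/2) (e/2) (\<lambda>n i j. A n i j - B n i j) (\<lambda>z. g z - h z)"
    using assms[OF e2] by blast
  obtain h' where h': "nice h'" "controlled (e/2) (e/2) (\<lambda>n i j. B n i j - grid_mat m h' n i j) (\<lambda>z. h z - h' z)"
    using B(1) e2 unfolding grid_approx_def by blast
  have "controlled (e/2 + e/2) (e/2 + e/2) (\<lambda>n i j. (A n i j - B n i j) + (B n i j - grid_mat m h' n i j)) (\<lambda>z. (g z - h z) + (h z - h' z))"
    by (rule controlled_add[OF B(2) h'(2)])
  then show "\<exists>f. nice f \<and> controlled e e (\<lambda>n i j. A n i j - grid_mat m f n i j) (\<lambda>z. g z - f z)"
    using h'(1) by auto
qed

lemma grid_approx_zero: "grid_approx m (\<lambda>n i j. 0) (\<lambda>z. 0)"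
  unfolding grid_approx_def
proof (intro allI impI)
  fix e :: real assume e: "0 < e"
  have "grid_mat m (\<lambda>z. 0) n i j = 0" for n i j by (simp add: grid_mat_def Q_conj_def gridval_def)
  moreover have "nice (\<lambda>z. 0)" by (simp add: nice_def)
  moreover have "controlled e e (\<lambda>n i j. 0) (\<lambda>z. 0)"
    unfolding controlled_def using e by (auto intro!: small_off_bounded splits_zero always_eventually)
  ultimately show "\<exists>h. nice h \<and> controlled e e (\<lambda>n i j. 0 - grid_mat m h n i j) (\<lambda>z. 0 - h z)"
    by (intro exI[of _ "\<lambda>z. 0"]) simp
qed

lemma grid_approx_sum:
  assumes "finite I" "\<And>i. i \<in> I \<Longrightarrow> grid_approx m (A i) (g i)"
  shows "grid_approx m (\<lambda>n k l. \<Sum>i\<in>I. A i n k l) (\<lambda>z. \<Sum>i\<in>I. g i z)"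
  using assms by (induction I rule: finite_induct) (auto intro: grid_approx_zero grid_approx_add)

text \<open>In row \<open>i\<close> of block \<open>b\<close> the coefficient is sampled at (i + 1)
  / n on one side and at (b + 1) / m on the other. The points differ by at most 1 / m + m / n: one
  block length, plus the drift caused by the fewer than m rows left over when n is divided by
  m.\<close>

lemma grid_approx_monomial:
  assumes a: "continuous_on UNIV a" and m1: "\<And>n. 1 \<le> n \<Longrightarrow> 1 \<le> m n \<and> m n \<le> n"
    and m: "filterlim m at_top sequentially" and mo: "(\<lambda>n. real (m n) / real n) \<longlonglongrightarrow> 0"
  shows "grid_approx m (\<lambda>n i j. if int i - int j = k then a (real (i + 1) / real n) else 0) (\<lambda>(x, \<theta>). a x * cis (of_int k * \<theta>))"
  unfolding grid_approx_def
proof (intro allI impI)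
  fix e :: real assume e: "0 < e"
  let ?h = "\<lambda>(x, \<theta>). a x * cis (of_int k * \<theta>)"
  have nice: "nice ?h"
    unfolding nice_def
  proof (intro conjI allI)
    have "continuous_on UNIV (\<lambda>z :: real \<times> real. a (fst z))"
      by (rule continuous_on_compose2[OF a]) (auto intro: continuous_intros)
    then show "continuous_on UNIV ?h" unfolding case_prod_beta by (intro continuous_intros)
    fix x \<theta>
    have "cis (of_int k * (\<theta> + 2 * pi)) = cis (of_int k * \<theta>) * cis (2 * pi * of_int k)"
      unfolding cis_mult by (intro arg_cong[of _ _ cis]) (simp add: algebra_simps)
    also have "\<dots> = cis (of_int k * \<theta>)" by simp
    finally show "?h (x, \<theta> + 2 * pi) = ?h (x, \<theta>)" by simp
  qed
  have "uniformly_continuous_on {0..1} a"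
    by (intro compact_uniformly_continuous continuous_on_subset[OF a]) auto
  then obtain d where d: "0 < d" "\<And>x y. x \<in> {0..1} \<Longrightarrow> y \<in> {0..1} \<Longrightarrow> dist y x < d \<Longrightarrow> dist (a y) (a x) < e"
    using e unfolding uniformly_continuous_on_def by meson
  obtain M :: nat where M: "2 / d < real M" using reals_Archimedean2 by blast
  let ?c = "2 * real (nat \<bar>k\<bar>) + 1"
  have "\<forall>\<^sub>F n in sequentially. M + 1 \<le> m n" using m by (auto simp: filterlim_at_top)
  \<comment> \<open>The first entry turns the rank bound m (2 |k| + 1) into e n; the second,
    together with \<open>M\<close>, keeps the two sample points closer than
    \<open>d / 2 + d / 4\<close>.\<close>
  moreover have "\<forall>\<^sub>F n in sequentially. real (m n) / real n < min (e / ?c) (d / 4)"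
    using e d(1) by (intro order_tendstoD(2)[OF mo]) (auto intro!: divide_pos_pos)
  ultimately have "\<forall>\<^sub>F n in sequentially. splits n (e * real n) e (\<lambda>i j. (if int i - int j = k then a (real (i + 1) / real n) else 0) - grid_mat m ?h n i j)"
    using eventually_ge_at_top[of 1]
  proof eventually_elim
    case (elim n)
    have n: "0 < real n" and mn: "1 \<le> m n" "m n \<le> n" using elim m1[of n] by auto
    let ?q = "n div m n"
    have q: "0 < ?q" using mn by (simp add: div_greater_zero_iff)
    have mM: "real M < real (m n)" "0 < real (m n)" using elim by auto
    have md: "1 / real (m n) < d / 2"
    proof -
      have "2 / d < real (m n)" using M mM by linarith
      then show ?thesis using d(1) mM by (simp add: field_simps)
    qed
    have mnd: "real (m n) / real n < d / 4" "1 / real n \<le> real (m n) / real n"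
      using elim mM by (auto intro!: divide_right_mono)
    have mq: "m n * ?q \<le> n" by simp
    have "splits n (real (m n) * ?c) e (\<lambda>i j. (if int i - int j = k then a (real (i + 1) / real n) else 0) -
        Q_conj n (m n) (gridval n (m n) ?h) i j)"
    proof (rule splits_monomial[OF mn(1)])
      fix i assume i: "i < m n * ?q"
      define b where "b = i div ?q"
      have b: "b < m n" using i q by (simp add: b_def div_less_iff_less_mult)
      have ib: "b * ?q \<le> i" "i < b * ?q + ?q"
        using q by (simp_all add: b_def) (metis add.commute div_mult_mod_eq mod_less_divisor nat_add_left_cancel_less)
      have "n < m n * ?q + m n" using mn by (metis add.commute div_mult_mod_eq mod_less_divisor mult.commute nat_add_left_cancel_less not_one_le_zero not_gr_zero)
      have "i + 1 \<le> n" using i mq by linarith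
      then have "real (i + 1) \<le> real n" by (rule of_nat_mono)
      then have x1: "real (i + 1) / real n \<in> {0..1}" using n by (auto simp: field_simps)
      have x2: "real (b + 1) / real (m n) \<in> {0..1}" using b mM by (auto simp: field_simps)
      have qn: "real ?q * real (m n) \<le> real n" using mq by (metis mult.commute of_nat_le_iff of_nat_mult)
      have nq: "real n \<le> real (m n) * real ?q + real (m n)"
        using \<open>n < m n * ?q + m n\<close> by (metis less_imp_le of_nat_add of_nat_le_iff of_nat_mult)
      have up: "real (i + 1) / real n \<le> real (b + 1) / real (m n)"
      proof -
        have "real (i + 1) \<le> real (b + 1) * real ?q"
          using ib(2) by (metis Suc_eq_plus1 Suc_leI add_mult_distrib mult_1 of_nat_le_iff of_nat_mult)
        then have "real (i + 1) * real (m n) \<le> real (b + 1) * real ?q * real (m n)" by (intro mult_right_mono) auto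
        also have "\<dots> \<le> real (b + 1) * real n" using qn by (simp only: mult.assoc) (intro mult_left_mono, auto)
        finally show ?thesis using n mM by (simp add: field_simps)
      qed
      have low: "real (b + 1) / real (m n) - real (i + 1) / real n \<le> 1 / real (m n) + real (m n) / real n"
      proof -
        have "real b * real n \<le> real b * (real (m n) * real ?q + real (m n))" by (intro mult_left_mono nq) auto
        also have "\<dots> = real (b * ?q) * real (m n) + real b * real (m n)" by (simp add: algebra_simps)
        also have "\<dots> \<le> real (i + 1) * real (m n) + real (m n) * real (m n)"
        proof (intro add_mono mult_right_mono)
          show "real (b * ?q) \<le> real (i + 1)" using ib(1) by (intro of_nat_mono) linarith
        qed (use b in auto)
        finally have "real b / real (m n) \<le> (real (i + 1) + real (m n)) / real n" using n mM by (simp add: field_simps)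
        then show ?thesis by (simp add: add_divide_distrib)
      qed
      have "dist (real (i + 1) / real n) (real (b + 1) / real (m n)) < d"
        using up low md mnd d(1) unfolding dist_real_def by linarith
      from d(2)[OF x2 x1 this] show "cmod (a (real (i + 1) / real n) - a (real (i div ?q + 1) / real (m n))) \<le> e"
        by (simp add: dist_norm b_def)
    qed (use e in simp)
    moreover have "real (m n) * ?c \<le> e * real n"
    proof -
      have "real (m n) / real n < e / ?c" using elim by simp
      then show ?thesis using n by (simp add: field_simps)
    qed
    ultimately show ?case unfolding grid_mat_def by (rule splits_mono) simp
  qed
  \<comment> \<open>The monomial symbol is itself \<open>nice\<close> and serves as
    \<open>h\<close>, so there is no symbol error.\<close>
  moreover have "small_off e e (\<lambda>z. ?h z - ?h z)" using e by (intro small_off_bounded) auto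
  ultimately show "\<exists>h. nice h \<and> controlled e e (\<lambda>n i j. (if int i - int j = k then a (real (i + 1) / real n) else 0) - grid_mat m h n i j) (\<lambda>z. ?h z - h z)"
    using nice unfolding controlled_def by blast
qed

text \<open>The bounds start at \<open>n = 1\<close>, since \<open>1 \<le> m 0\<close> and
  \<open>m 0 \<le> 0\<close> exclude each other.\<close>

definition admissible :: "(nat \<Rightarrow> nat) \<Rightarrow> bool" where
  "admissible m \<longleftrightarrow> (\<forall>n\<ge>1. 1 \<le> m n \<and> m n \<le> n) \<and> filterlim m at_top sequentially \<and>
     (\<lambda>n. real (m n) / real n) \<longlonglongrightarrow> 0"

lemma admissible_bounds:
  assumes "admissible m" "1 \<le> n"
  shows "1 \<le> m n" "m n \<le> n"
  using assms unfolding admissible_def by blast+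

lemma grid_approx_continuous_trigpoly:
  assumes m: "admissible m" and a: "continuous_on UNIV a" and p: "is_trigpoly p"
  shows "grid_approx m (\<lambda>n i j. a (real (i + 1) / real n) * toep p i j) (\<lambda>(x, \<theta>). a x * p \<theta>)"
proof -
  from p obtain r c where p: "p = trigpoly r c" unfolding is_trigpoly_def by blast
  have "grid_approx m (\<lambda>n i j. \<Sum>k\<in>{- int r..int r}. if int i - int j = k then c k * a (real (i + 1) / real n) else 0)
      (\<lambda>z. \<Sum>k\<in>{- int r..int r}. (\<lambda>(x, \<theta>). (c k * a x) * cis (of_int k * \<theta>)) z)"
    by (intro grid_approx_sum grid_approx_monomial[where a = "\<lambda>x. c _ * a x"] continuous_intros a)
      (use m in \<open>auto simp: admissible_def\<close>)
  moreover have "(\<lambda>n i j. \<Sum>k\<in>{- int r..int r}. if int i - int j = k then c k * a (real (i + 1) / real n) else 0) =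
      (\<lambda>(n::nat) i j. a (real (i + 1) / real n) * toep p i j)"
    by (intro ext) (auto simp: p fourier_coeff_trigpoly)
  moreover have "(\<lambda>z. \<Sum>k\<in>{- int r..int r}. (\<lambda>(x, \<theta>). (c k * a x) * cis (of_int k * \<theta>)) z) = (\<lambda>(x, \<theta>). a x * p \<theta>)"
    by (auto simp: p trigpoly_def sum_distrib_left mult_ac)
  ultimately show ?thesis by simp
qed

text \<open>The error is written as a f - a1 p = a (f - p) + (a - a1) p. The choices depend on each
  other in this order: a crude \<open>a0\<close> within 1 of \<open>a\<close> gives the bound M + 1
  for \<open>a\<close> up to small rank; this fixes the L^1 accuracy of \<open>p\<close>; the bound
  \<open>P\<close> of \<open>p\<close> then fixes the accuracy of a second continuous function
  \<open>a1\<close>.\<close>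

lemma grid_approx_diag_toep:
  assumes m: "admissible m" and a: "AE x in lebesgue_on {0..1}. continuous (at x within {0..1}) a"
    and f: "integrable (lebesgue_on {-pi..pi}) f"
  shows "grid_approx m (\<lambda>n i j. a (real (i + 1) / real n) * toep f i j) (\<lambda>(x, \<theta>). a x * f \<theta>)"
proof (rule grid_approx_limit)
  fix e :: real assume e: "0 < e"
  let ?d = "\<lambda>a n. diag_fun (\<lambda>i. a (real (i + 1) / real n))"
  define e1 where "e1 = min (e / 4) 1"
  have e1: "0 < e1" "e1 \<le> e / 4" "e1 \<le> 1" using e by (auto simp: e1_def)
  obtain a0 where a0: "continuous_on UNIV a0"
    "controlled e1 e1 (\<lambda>n. diag_fun (\<lambda>i. a (real (i + 1) / real n) - a0 (real (i + 1) / real n))) (\<lambda>(x, \<theta>). a x - a0 x)"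
    by (rule ae_continuous_approx[OF a e1(1)])
  obtain M where M: "0 \<le> M" "controlled 0 M (?d a0) (\<lambda>(x, \<theta>). a0 x)"
    by (rule controlled_diag_continuous[OF a0(1)])
  have da: "controlled e1 (M + 1) (?d a) (\<lambda>(x, \<theta>). a x)"
    by (rule controlled_cong[OF controlled_mono[OF controlled_add[OF a0(2) M(2)]]]) (use e1 in auto)
  define e2 where "e2 = e / (4 * (M + 1))"
  have e2: "0 < e2" "(M + 1) * e2 = e / 4" "e2 \<le> e / 4"
    using e M(1) by (auto simp: e2_def field_simps intro: order_trans[of _ "M * e + e"])
  obtain p where p: "is_trigpoly p" "(LINT \<theta>|lebesgue_on {-pi..pi}. cmod (f \<theta> - p \<theta>)) < e2 / 4 * (e2 / 4)"
    using is_trigpoly_dense_L1[OF f, of "e2 / 4 * (e2 / 4)"] e2(1) by auto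
  have fp: "controlled e2 e2 (\<lambda>n. toep (\<lambda>\<theta>. f \<theta> - p \<theta>)) (\<lambda>(x, \<theta>). f \<theta> - p \<theta>)"
    using p f e2(1) is_trigpoly_integrable[OF p(1)] by (intro controlled_toep) auto
  obtain P where P: "0 \<le> P" "controlled 0 P (\<lambda>n. toep p) (\<lambda>(x, \<theta>). p \<theta>)"
    by (rule controlled_toep_trigpoly[OF p(1)])
  define e3 where "e3 = e / (4 * (P + 1))"
  have e3: "0 < e3" "e3 * P \<le> e / 4" "e3 \<le> e / 4"
    using e P(1) by (auto simp: e3_def field_simps intro: order_trans[of _ "P * e + e"])
  obtain a1 where a1: "continuous_on UNIV a1"
    "controlled e3 e3 (\<lambda>n. diag_fun (\<lambda>i. a (real (i + 1) / real n) - a1 (real (i + 1) / real n))) (\<lambda>(x, \<theta>). a x - a1 x)"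
    by (rule ae_continuous_approx[OF a e3(1)])
  \<comment> \<open>The exceptional fractions add up to at most 3e / 4, and each of the two norm
    products is at most e / 4.\<close>
  have "controlled ((e1 + e2) + (e3 + 0)) ((M + 1) * e2 + e3 * P)
     (\<lambda>n i j. mm n (?d a n) (toep (\<lambda>\<theta>. f \<theta> - p \<theta>)) i j +
        mm n (diag_fun (\<lambda>i. a (real (i + 1) / real n) - a1 (real (i + 1) / real n))) (toep p) i j)
     (\<lambda>z. (\<lambda>(x, \<theta>). a x) z * (\<lambda>(x, \<theta>). f \<theta> - p \<theta>) z + (\<lambda>(x, \<theta>). a x - a1 x) z * (\<lambda>(x, \<theta>). p \<theta>) z)"
    by (rule controlled_add[OF controlled_mult[OF da fp] controlled_mult[OF a1(2) P(2)]])
  then have "controlled e e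
     (\<lambda>n i j. mm n (?d a n) (toep (\<lambda>\<theta>. f \<theta> - p \<theta>)) i j +
        mm n (diag_fun (\<lambda>i. a (real (i + 1) / real n) - a1 (real (i + 1) / real n))) (toep p) i j)
     (\<lambda>z. (\<lambda>(x, \<theta>). a x) z * (\<lambda>(x, \<theta>). f \<theta> - p \<theta>) z + (\<lambda>(x, \<theta>). a x - a1 x) z * (\<lambda>(x, \<theta>). p \<theta>) z)"
    by (rule controlled_mono) (use e e1 e2 e3 in auto)
  then have "controlled e e (\<lambda>n i j. a (real (i + 1) / real n) * toep f i j - a1 (real (i + 1) / real n) * toep p i j)
     (\<lambda>z. (\<lambda>(x, \<theta>). a x * f \<theta>) z - (\<lambda>(x, \<theta>). a1 x * p \<theta>) z)"
    by (rule controlled_cong)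
      (simp_all only: mm_diag_fun fourier_coeff_diff[OF f is_trigpoly_integrable[OF p(1)]] case_prod_beta, simp_all add: algebra_simps)
  then show "\<exists>B h. grid_approx m B h \<and> controlled e e (\<lambda>n i j. a (real (i + 1) / real n) * toep f i j - B n i j)
      (\<lambda>z. (case z of (x, \<theta>) \<Rightarrow> a x * f \<theta>) - h z)"
    using grid_approx_continuous_trigpoly[OF m a1(1) p(1)] by blast
qed

section \<open>Back to matrices: approximation of a GLT sequence\<close>

definition qmat :: "(nat \<Rightarrow> nat) \<Rightarrow> (real \<times> real \<Rightarrow> complex) \<Rightarrow> nat \<Rightarrow> complex mat" where
  "qmat m h n = Q_mat n (m n) * mat_diag n (gridval n (m n) h) * mat_adjoint (Q_mat n (m n))"

lemma qmat_carrier: "qmat m h n \<in> carrier_mat n n"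
  unfolding qmat_def 
  by (rule mult_carrier_mat[OF mult_carrier_mat[OF Q_mat_carrier mat_diag_dim] mat_adjoint_carrier[OF Q_mat_carrier]])

lemma qmat_index: "i < n \<Longrightarrow> j < n \<Longrightarrow> qmat m h n $$ (i, j) = grid_mat m h n i j"
  unfolding qmat_def grid_mat_def by (rule Q_diag_adjoint_index)

text \<open>The condition in \<open>acs_conv\<close> at a single \<open>n\<close>, with one number
  bounding both the relative rank and the norm.\<close>

definition mat_split :: "real \<Rightarrow> nat \<Rightarrow> complex mat \<Rightarrow> complex mat \<Rightarrow> bool" where
  "mat_split e n A B \<longleftrightarrow> (\<exists>R\<in>carrier_mat n n. \<exists>N\<in>carrier_mat n n. A = B + R + N \<and>
     real (mat_rank R) \<le> e * real n \<and> spectral_norm N \<le> e)"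

lemma mat_split_trans:
  assumes "B \<in> carrier_mat n n" "C \<in> carrier_mat n n" "mat_split e n A B" "mat_split e' n B C"
  shows "mat_split (e + e') n A C"
proof -
  from assms(3) obtain R N where R: "R \<in> carrier_mat n n" "N \<in> carrier_mat n n" "A = B + R + N"
     "real (mat_rank R) \<le> e * real n" "spectral_norm N \<le> e" unfolding mat_split_def by blast
  from assms(4) obtain R' N' where R': "R' \<in> carrier_mat n n" "N' \<in> carrier_mat n n" "B = C + R' + N'"
     "real (mat_rank R') \<le> e' * real n" "spectral_norm N' \<le> e'" unfolding mat_split_def by blast
  have "A = C + (R + R') + (N + N')"
    unfolding R(3) R'(3) by (rule eq_matI) (use R R' assms in auto)
  moreover have "real (mat_rank (R + R')) \<le> (e + e') * real n"
    using mat_rank_add[OF R(1) R'(1)] R(4) R'(4) by (simp add: distrib_right)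
  moreover have "spectral_norm (N + N') \<le> e + e'"
    using spectral_norm_triangle[OF R(2) R'(2)] R(5) R'(5) by simp
  ultimately show ?thesis unfolding mat_split_def using R R'
    by (intro bexI[of _ "R + R'"] bexI[of _ "N + N'"]) auto
qed

lemma mat_split_of_splits:
  assumes "A \<in> carrier_mat n n" "B \<in> carrier_mat n n" "splits n (e * real n) e (\<lambda>i j. A $$ (i, j) - B $$ (i, j))"
  shows "mat_split e n A B"
proof -
  have "splits n (e * real n) e (\<lambda>i j. (A - B) $$ (i, j))"
    by (rule splits_cong[OF _ assms(3)]) (use assms in auto)
  then obtain R N where R: "R \<in> carrier_mat n n" "N \<in> carrier_mat n n" "A - B = R + N"
    "real (mat_rank R) \<le> e * real n" "spectral_norm N \<le> e"
    by (rule splits_mat[rotated]) (use assms in auto)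
  have "A = B + R + N"
  proof (rule eq_matI)
    fix i j assume ij: "i < dim_row (B + R + N)" "j < dim_col (B + R + N)"
    then have "i < n" "j < n" using R(1,2) assms(1,2) by auto
    then have "(A - B) $$ (i, j) = A $$ (i, j) - B $$ (i, j)" "(R + N) $$ (i, j) = R $$ (i, j) + N $$ (i, j)"
      using R(1,2) assms(1,2) by auto
    then have "A $$ (i, j) - B $$ (i, j) = R $$ (i, j) + N $$ (i, j)" by (metis R(3))
    moreover have "(B + R + N) $$ (i, j) = B $$ (i, j) + R $$ (i, j) + N $$ (i, j)" using ij R(1,2) assms by simp
    ultimately show "A $$ (i, j) = (B + R + N) $$ (i, j)" by (simp add: algebra_simps)
  qed (use R assms in auto)
  then show ?thesis unfolding mat_split_def using R by blast
qed

text \<open>A single index \<open>k\<close> of the defining approximation suffices: it is taken so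
  large that the error in measure and both a.c.s. bounds are below e / 2. The other half of
  \<open>e\<close> is spent on the grid approximation of the \<open>k\<close>-th sum, with the same
  \<open>h\<close> for matrices and symbol.\<close>

lemma GLT_approx:
  assumes m: "admissible m" and GLT: "GLT_sequence A \<kappa>" and e: "0 < e"
  obtains h where "nice h" "small_off e e (\<lambda>z. \<kappa> z - h z)"
    "\<forall>\<^sub>F n in sequentially. mat_split e n (A n) (qmat m h n)"
proof -
  let ?M = "lebesgue_on GLT_domain"
  from GLT obtain N :: "nat \<Rightarrow> nat" and a f :: "nat \<Rightarrow> nat \<Rightarrow> real \<Rightarrow> complex" where af: "\<forall>k. \<forall>i\<in>{1..N k}.
       (AE x in lebesgue_on {0..1}. continuous (at x within {0..1}) (a i k)) \<and> integrable (lebesgue_on {-pi..pi}) (f i k)"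
    and conv: "converges_in_measure ?M (\<lambda>k (x, \<theta>). \<Sum>i\<in>{1..N k}. a i k x * f i k \<theta>) \<kappa>"
    and acs: "acs_conv (\<lambda>k n. mat_sum n (\<lambda>i. diag_sampling n (a i k) * toeplitz_mat n (f i k)) {1..N k}) A"
    unfolding GLT_sequence_def by blast
  let ?g = "\<lambda>k (x, \<theta>). \<Sum>i\<in>{1..N k}. a i k x * f i k \<theta>"
  let ?B = "\<lambda>k n. mat_sum n (\<lambda>i. diag_sampling n (a i k) * toeplitz_mat n (f i k)) {1..N k}"
  from acs obtain n0 :: "nat \<Rightarrow> nat" and c \<omega> :: "nat \<Rightarrow> real" where c: "c \<longlonglongrightarrow> 0" and \<omega>: "\<omega> \<longlonglongrightarrow> 0" and
    split: "\<And>k n. n0 k \<le> n \<Longrightarrow> \<exists>R\<in>carrier_mat n n. \<exists>N\<in>carrier_mat n n.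
           A n = ?B k n + R + N \<and> real (mat_rank R) \<le> c k * real n \<and> spectral_norm N \<le> \<omega> k"
    unfolding acs_conv_def by blast
  have e2: "0 < e / 2" using e by simp
  have "(\<lambda>k. emeasure ?M {z \<in> space ?M. e / 2 < cmod (?g k z - \<kappa> z)}) \<longlonglongrightarrow> 0"
    using conv e2 unfolding converges_in_measure_def by blast
  then have "\<forall>\<^sub>F k in sequentially. emeasure ?M {z \<in> space ?M. e / 2 < cmod (?g k z - \<kappa> z)} < ennreal (e / 2)"
    by (rule order_tendstoD(2)) (use e2 in simp)
  moreover have "\<forall>\<^sub>F k in sequentially. c k < e / 2" "\<forall>\<^sub>F k in sequentially. \<omega> k < e / 2"
    using order_tendstoD(2)[OF c e2] order_tendstoD(2)[OF \<omega> e2] .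
  ultimately have "\<forall>\<^sub>F k in sequentially. emeasure ?M {z \<in> space ?M. e / 2 < cmod (?g k z - \<kappa> z)} < ennreal (e / 2) \<and> c k < e / 2 \<and> \<omega> k < e / 2"
    by eventually_elim simp
  then obtain k where k: "emeasure ?M {z \<in> space ?M. e / 2 < cmod (?g k z - \<kappa> z)} < ennreal (e / 2)" "c k < e / 2" "\<omega> k < e / 2"
    by (auto simp: eventually_sequentially)
  have small1: "small_off (e / 2) (e / 2) (\<lambda>z. \<kappa> z - ?g k z)"
  proof -
    define S where "S = {z \<in> space ?M. e / 2 < cmod (?g k z - \<kappa> z)}"
    have dom: "GLT_domain \<in> sets lebesgue" using compact_GLT_domain by (intro lmeasurable_compact fmeasurableD)
    have meas: "?g k \<in> borel_measurable ?M" "\<kappa> \<in> borel_measurable ?M"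
      using conv unfolding converges_in_measure_def by blast+
    have "(\<lambda>z. cmod (?g k z - \<kappa> z)) \<in> borel_measurable ?M"
      by (rule measurable_compose[OF borel_measurable_diff[OF meas] borel_measurable_norm])
    then have "S \<in> sets ?M" unfolding S_def by (rule borel_measurable_less[OF borel_measurable_const])
    then have S: "S \<in> sets lebesgue" "S \<subseteq> GLT_domain" using dom by (auto simp: sets_restrict_space_iff)
    have Sl: "S \<in> lmeasurable"
      by (rule bounded_set_imp_lmeasurable[OF bounded_subset[OF compact_imp_bounded[OF compact_GLT_domain] S(2)] S(1)])
    have "emeasure lebesgue S < ennreal (e / 2)"
      using k(1) unfolding S_def[symmetric] by (subst (asm) emeasure_restrict_space) (use dom S in auto)
    then have "measure lebesgue S \<le> e / 2" by (rule measure_le_of_emeasure[OF Sl])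
    moreover have "cmod (\<kappa> z - ?g k z) \<le> e / 2" if "z \<in> GLT_domain - S" for z
      using that by (auto simp: S_def not_less norm_minus_commute)
    ultimately show ?thesis unfolding small_off_def using Sl by blast
  qed
  have "grid_approx m (\<lambda>n p q. \<Sum>i\<in>{1..N k}. (\<lambda>n p q. a i k (real (p + 1) / real n) * toep (f i k) p q) n p q)
      (\<lambda>z. \<Sum>i\<in>{1..N k}. (\<lambda>(x, \<theta>). a i k x * f i k \<theta>) z)"
  proof (rule grid_approx_sum)
    fix i assume "i \<in> {1..N k}"
    then show "grid_approx m (\<lambda>n p q. a i k (real (p + 1) / real n) * toep (f i k) p q) (\<lambda>(x, \<theta>). a i k x * f i k \<theta>)"
      using af by (intro grid_approx_diag_toep m) auto
  qed simp
  then obtain h where h: "nice h" "controlled (e / 2) (e / 2) (\<lambda>n p q. (\<Sum>i\<in>{1..N k}. a i k (real (p + 1) / real n) * toep (f i k) p q) - grid_mat m h n p q)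
      (\<lambda>z. (\<Sum>i\<in>{1..N k}. (\<lambda>(x, \<theta>). a i k x * f i k \<theta>) z) - h z)"
    using e2 unfolding grid_approx_def by blast
  show thesis
  proof (rule that[OF h(1)])
    have "small_off (e / 2 + e / 2) (e / 2 + e / 2) (\<lambda>z. (\<kappa> z - ?g k z) + ((\<Sum>i\<in>{1..N k}. (\<lambda>(x, \<theta>). a i k x * f i k \<theta>) z) - h z))"
      by (intro small_off_add small1) (use h(2) in \<open>simp add: controlled_def\<close>)
    moreover have "(\<lambda>z. (\<kappa> z - ?g k z) + ((\<Sum>i\<in>{1..N k}. (\<lambda>(x, \<theta>). a i k x * f i k \<theta>) z) - h z)) = (\<lambda>z. \<kappa> z - h z)"
      by (auto simp: case_prod_beta)
    ultimately show "small_off e e (\<lambda>z. \<kappa> z - h z)" by simp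
    have "\<forall>\<^sub>F n in sequentially. splits n (e / 2 * real n) (e / 2) (\<lambda>p q. (\<Sum>i\<in>{1..N k}. a i k (real (p + 1) / real n) * toep (f i k) p q) - grid_mat m h n p q)"
      using h(2) by (simp add: controlled_def)
    then show "\<forall>\<^sub>F n in sequentially. mat_split e n (A n) (qmat m h n)"
      using eventually_ge_at_top[of "n0 k"]
    proof eventually_elim
      case (elim n)
      have Bc: "?B k n \<in> carrier_mat n n" by (simp add: mat_sum_def)
      have Bi: "?B k n $$ (p, q) = (\<Sum>i\<in>{1..N k}. a i k (real (p + 1) / real n) * toep (f i k) p q)" if "p < n" "q < n" for p q
      proof -
        have T: "mat_diag n d * toeplitz_mat n u = Matrix.mat n n (\<lambda>(i, j). d i * toeplitz_mat n u $$ (i, j))" for d u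
          by (rule mat_diag_mult_left) (simp add: toeplitz_mat_def)
        have "?B k n $$ (p, q) = (\<Sum>i\<in>{1..N k}. a i k (real (p + 1) / real n) * toeplitz_mat n (f i k) $$ (p, q))"
          using that by (simp add: mat_sum_def diag_sampling_def T)
        then show ?thesis using that by (simp add: toeplitz_mat_def)
      qed
      have "mat_split (e / 2) n (A n) (?B k n)"
      proof -
        obtain R N where RN: "R \<in> carrier_mat n n" "N \<in> carrier_mat n n" "A n = ?B k n + R + N"
          "real (mat_rank R) \<le> c k * real n" "spectral_norm N \<le> \<omega> k" using split[OF elim(2)] by blast
        have "c k * real n \<le> e / 2 * real n" using k(2) by (intro mult_right_mono) auto
        then have "real (mat_rank R) \<le> e / 2 * real n" "spectral_norm N \<le> e / 2" using RN k(3) by linarith+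
        then show ?thesis unfolding mat_split_def using RN by blast
      qed
      moreover have "mat_split (e / 2) n (?B k n) (qmat m h n)"
        by (rule mat_split_of_splits[OF Bc qmat_carrier], rule splits_cong[OF _ elim(1)]) (simp only: Bi qmat_index)
      ultimately have "mat_split (e / 2 + e / 2) n (A n) (qmat m h n)"
        by (rule mat_split_trans[OF Bc qmat_carrier])
      then show ?case by simp
    qed
  qed
qed

section \<open>From small symbols to small matrices, and real symbols\<close>

lemma op_bounded_isometry:
  assumes "\<And>i j. i < n \<Longrightarrow> j < n \<Longrightarrow> (\<Sum>l<n. cnj (U l i) * U l j) = (if i = j then 1 else 0)"
  shows "op_bounded n 1 U"
proof -
  have "(nrm n (mv n U v))\<^sup>2 = (nrm n v)\<^sup>2" for v
  proof -
    have "complex_of_real ((nrm n (mv n U v))\<^sup>2) = (\<Sum>l<n. cnj (mv n U v l) * mv n U v l)"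
      unfolding nrm_power2 of_real_sum by (intro sum.cong refl) (metis complex_norm_square mult.commute)
    also have "\<dots> = (\<Sum>l<n. \<Sum>i<n. \<Sum>j<n. cnj (v i) * v j * (cnj (U l i) * U l j))"
      unfolding mv_def cnj_sum sum_product by (simp add: mult_ac)
    also have "\<dots> = (\<Sum>i<n. \<Sum>l<n. \<Sum>j<n. cnj (v i) * v j * (cnj (U l i) * U l j))" by (rule sum.swap)
    also have "\<dots> = (\<Sum>i<n. \<Sum>j<n. \<Sum>l<n. cnj (v i) * v j * (cnj (U l i) * U l j))"
      by (rule sum.cong[OF refl]) (rule sum.swap)
    also have "\<dots> = (\<Sum>i<n. \<Sum>j<n. if j = i then cnj (v i) * v j else 0)"
      by (intro sum.cong refl) (simp add: assms flip: sum_distrib_left)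
    also have "\<dots> = (\<Sum>i<n. cnj (v i) * v i)" by simp
    also have "\<dots> = complex_of_real ((nrm n v)\<^sup>2)"
      unfolding nrm_power2 of_real_sum by (intro sum.cong refl) (metis complex_norm_square mult.commute)
    finally show ?thesis by (simp only: of_real_eq_iff)
  qed
  then have "nrm n (mv n U v) = nrm n v" for v by (simp add: power2_eq_iff_nonneg)
  then show ?thesis by (simp add: op_bounded_def)
qed

lemma op_bounded_Q_entry: "op_bounded n 1 (Q_entry n m)"
proof (rule op_bounded_isometry)
  fix i j assume ij: "i < n" "j < n"
  let ?Q = "Q_mat n m"
  have Q: "?Q \<in> carrier_mat n n" by (rule Q_mat_carrier)
  have adj: "mat_adjoint ?Q \<in> carrier_mat n n" by (rule mat_adjoint_carrier[OF Q])
  have "mat_adjoint ?Q * ?Q = 1\<^sub>m n" using unitary_Q_mat[of n m] Q by (simp add: unitary_mat_def)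
  then have "(mat_adjoint ?Q * ?Q) $$ (i, j) = (if i = j then 1 else 0)" using ij by simp
  moreover have "(mat_adjoint ?Q * ?Q) $$ (i, j) = (\<Sum>l<n. mat_adjoint ?Q $$ (i, l) * ?Q $$ (l, j))"
    using Q adj ij by (subst index_mult_mat) (auto simp: scalar_prod_def atLeast0LessThan intro!: sum.cong)
  moreover have "mat_adjoint ?Q $$ (i, l) = cnj (?Q $$ (l, i))" if "l < n" for l
    using Q ij that by (intro mat_adjoint_index) auto
  ultimately show "(\<Sum>l<n. cnj (Q_entry n m l i) * Q_entry n m l j) = (if i = j then 1 else 0)"
    by (simp add: Q_entry_def)
qed

lemma op_bounded_Q_entry_adjoint: "op_bounded n 1 (\<lambda>i j. cnj (Q_entry n m j i))"
  by (rule op_bounded_isometry) (use Q_conj_one[of _ n _ m] in \<open>simp add: Q_conj_def\<close>)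

text \<open>Conjugation by a unitary matrix costs neither rank nor norm, so only the number of large
  entries of \<open>d\<close> counts.\<close>

lemma splits_Q_conj:
  assumes "0 \<le> w" "real (card {i. i < n \<and> w < cmod (d i)}) \<le> r"
  shows "splits n r w (Q_conj n m d)"
proof -
  let ?Q' = "\<lambda>i j. cnj (Q_entry n m j i)"
  have S: "splits n (0 + (r + 0)) (1 * (w * 1)) (mm n (Q_entry n m) (mm n (diag_fun d) ?Q'))"
    by (intro splits_mult splits_op_bounded op_bounded_Q_entry op_bounded_Q_entry_adjoint splits_diag assms) auto
  have "mm n (Q_entry n m) (mm n (diag_fun d) ?Q') i j = Q_conj n m d i j" for i j
    unfolding mm_def[of n "Q_entry n m"] Q_conj_def by (intro sum.cong refl) (simp add: mm_diag_fun mult.assoc)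
  then show ?thesis using splits_cong[OF _ S] by simp
qed

lemma admissible_block_size:
  assumes "admissible m"
  shows "filterlim (\<lambda>n. n div m n) at_top sequentially"
  unfolding filterlim_at_top
proof
  fix K :: nat
  have "\<forall>\<^sub>F n in sequentially. real (m n) / real n < 1 / (real K + 1)"
    by (rule order_tendstoD(2)[OF conjunct2[OF conjunct2[OF assms[unfolded admissible_def]]]]) simp
  then show "\<forall>\<^sub>F n in sequentially. K \<le> n div m n"
    using eventually_ge_at_top[of 1]
  proof eventually_elim
    case (elim n)
    then have m: "1 \<le> m n" using assms by (auto simp: admissible_def)
    have "real (m n) / real n * (real K + 1) < 1"
      using elim(1) by (subst (asm) pos_less_divide_eq) auto
    then have "real (m n) * (real K + 1) < real n"
      using elim(2) by (simp add: pos_divide_less_eq)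
    moreover have "real (K * m n) \<le> real (m n) * (real K + 1)" by (simp add: algebra_simps)
    ultimately have "real (K * m n) \<le> real n" by linarith
    then have "K * m n \<le> n" by (simp only: of_nat_le_iff)
    then show ?case using m by (simp add: less_eq_div_iff_mult_less_eq)
  qed
qed

lemma integral_GLT_domain_const: "(LINT z|lebesgue_on GLT_domain. (c::real)) = 2 * pi * c"
  and measure_GLT_domain: "measure lebesgue GLT_domain = 2 * pi"
proof -
  have 1: "measure lebesgue ({0..1::real} \<times> {-pi..pi}) = measure lebesgue {0..1::real} * measure lebesgue {-pi..pi}"
    by (rule measure_Times_lebesgue) auto
  show "measure lebesgue GLT_domain = 2 * pi" unfolding 1 by simp
  moreover have "GLT_domain \<in> sets lebesgue" using compact_GLT_domain by (intro lmeasurable_compact fmeasurableD)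
  ultimately show "(LINT z|lebesgue_on GLT_domain. c) = 2 * pi * c" by (simp add: measure_restrict_space)
qed

lemma integral_le_small_off:
  fixes F :: "real \<times> real \<Rightarrow> real"
  assumes F: "F \<in> borel_measurable (lebesgue_on GLT_domain)"
    and S: "S \<in> lmeasurable" and bound: "\<And>z. z \<in> GLT_domain \<Longrightarrow> \<bar>F z\<bar> \<le> B"
    and off: "\<And>z. z \<in> GLT_domain - S \<Longrightarrow> \<bar>F z\<bar> \<le> \<delta>" and pos: "0 \<le> \<delta>" "0 \<le> B"
  shows "(LINT z|lebesgue_on GLT_domain. \<bar>F z\<bar>) \<le> 2 * pi * \<delta> + B * measure lebesgue S"
proof -
  let ?M = "lebesgue_on GLT_domain"
  have dom: "GLT_domain \<in> lmeasurable" by (rule lmeasurable_compact[OF compact_GLT_domain])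
  interpret finite_measure ?M
    by (rule finite_measure_lebesgue_on[OF dom])
  have SD: "S \<inter> GLT_domain \<in> lmeasurable" using S dom by (intro fmeasurable.Int) 
  have SM: "S \<inter> GLT_domain \<in> sets ?M" using SD dom by (subst sets_restrict_space_iff) auto
  have fin: "emeasure ?M (S \<inter> GLT_domain) < \<infinity>"
    unfolding infinity_ennreal_def less_top[symmetric] by (rule emeasure_finite)
  have "(LINT z|?M. \<bar>F z\<bar>) \<le> (LINT z|?M. \<delta> + B * indicator (S \<inter> GLT_domain) z)"
  proof (rule integral_mono)
    show "integrable ?M (\<lambda>z. \<bar>F z\<bar>)"
      using bound by (intro integrable_const_bound[of _ B] borel_measurable_abs F AE_I2) auto
    show "integrable ?M (\<lambda>z. \<delta> + B * indicator (S \<inter> GLT_domain) z)"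
      using SM fin by (intro Bochner_Integration.integrable_add integrable_mult_right integrable_real_indicator) auto
    show "\<bar>F z\<bar> \<le> \<delta> + B * indicator (S \<inter> GLT_domain) z" if "z \<in> space ?M" for z
      using bound[of z] off[of z] that pos by (auto simp: indicator_def)
  qed
  also have "\<dots> = (LINT z|?M. \<delta>) + B * measure ?M (S \<inter> GLT_domain)"
    using SM fin by (subst Bochner_Integration.integral_add) (auto intro!: integrable_real_indicator)
  also have "measure ?M (S \<inter> GLT_domain) = measure lebesgue (S \<inter> GLT_domain)"
    using dom by (subst measure_restrict_space) auto
  also have "B * measure lebesgue (S \<inter> GLT_domain) \<le> B * measure lebesgue S"
    using S SD pos by (intro mult_left_mono measure_mono_fmeasurable) auto
  finally show ?thesis unfolding integral_GLT_domain_const by simp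
qed

text \<open>\<open>\<rho>\<close> is 0 up to modulus w, 1 from modulus 2w on, and linear in between.
  The number of grid values above 2w is at most the sum of \<open>\<rho>\<close> over the grid, a
  Riemann sum for an integral that lives on the exceptional set of measure at most \<open>c\<close>.
  The doubling of \<open>w\<close> is the price for a continuous cutoff.\<close>

lemma eventually_splits_grid_mat:
  assumes m: "admissible m" and u: "nice u" and small: "small_off c w u" and w: "0 < w" and c: "0 < c"
  shows "\<forall>\<^sub>F n in sequentially. splits n (c * real n) (2 * w) (grid_mat m u n)"
proof -
  define \<rho> where "\<rho> z = min 1 (max 0 (cmod z / w - 1))" for z
  define \<Phi> where "\<Phi> z = complex_of_real (\<rho> z)" for z
  have lip: "\<bar>\<rho> z - \<rho> z'\<bar> \<le> cmod (z - z') / w" for z z'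
  proof -
    have "\<bar>\<rho> z - \<rho> z'\<bar> \<le> \<bar>cmod z / w - cmod z' / w\<bar>" unfolding \<rho>_def by linarith
    also have "\<dots> = \<bar>cmod z - cmod z'\<bar> / w" using w by (simp flip: diff_divide_distrib)
    also have "\<dots> \<le> cmod (z - z') / w" using w norm_triangle_ineq3[of z z'] by (intro divide_right_mono) auto
    finally show ?thesis .
  qed
  have \<rho>: "0 \<le> \<rho> z" "\<rho> z \<le> 1" for z by (auto simp: \<rho>_def)
  have cont: "continuous_on UNIV \<Phi>" unfolding \<Phi>_def[abs_def] \<rho>_def using w by (intro continuous_intros) auto
  have cu: "continuous_on GLT_domain u" using u by (auto simp: nice_def intro: continuous_on_subset)
  obtain S where S: "S \<in> lmeasurable" "measure lebesgue S \<le> c" "\<And>z. z \<in> GLT_domain - S \<Longrightarrow> cmod (u z) \<le> w"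
    using small unfolding small_off_def by blast
  have dom: "GLT_domain \<in> sets lebesgue" using compact_GLT_domain by (intro lmeasurable_compact fmeasurableD)
  have c\<rho>: "continuous_on GLT_domain (\<lambda>z. \<rho> (u z))"
    unfolding \<rho>_def using w by (intro continuous_intros cu) auto
  have "(LINT z|lebesgue_on GLT_domain. \<bar>\<rho> (u z)\<bar>) \<le> 2 * pi * 0 + 1 * measure lebesgue S"
  proof (rule integral_le_small_off[OF continuous_imp_measurable_on_sets_lebesgue[OF c\<rho> dom] S(1)])
    show "\<bar>\<rho> (u z)\<bar> \<le> 0" if "z \<in> GLT_domain - S" for z
      using S(3)[OF that] w by (simp add: \<rho>_def)
  qed (use \<rho> in auto)
  then have I: "(LINT z|lebesgue_on GLT_domain. \<rho> (u z)) \<le> c" using S(2) \<rho> by simp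
  \<comment> \<open>\<open>\<rho>\<close> has Lipschitz constant 1 / w, so this oscillation of
    \<open>u\<close> changes \<open>\<rho>\<close> by at most c / 2.\<close>
  have "\<forall>\<^sub>F n in sequentially. mesh_osc n (m n) u (c / 2 * w)"
    using m c w by (intro eventually_mesh_osc[OF u] admissible_block_size) (auto simp: admissible_def)
  then show ?thesis
    using eventually_ge_at_top[of 1]
  proof eventually_elim
    case (elim n)
    have mn: "1 \<le> m n" "m n \<le> n" using m elim(2) by (auto simp: admissible_def)
    let ?q = "n div m n" and ?d = "gridval n (m n) u"
    define T where "T = m n * ?q"
    have q: "0 < ?q" using mn by (simp add: div_greater_zero_iff)
    have T: "0 < real T" "T \<le> n" using mn q by (simp_all add: T_def)
    let ?X = "(\<Sum>i<T. \<rho> (?d i))"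
    define Y where "Y = ?X * (2 * pi / real T)"
    have A: "cmod ((LINT z|lebesgue_on GLT_domain. \<Phi> (u z)) - (\<Sum>i<m n * ?q. \<Phi> (?d i)) * of_real (2 * pi / real (m n * ?q))) \<le> 2 * pi * (c / 2)"
    proof (rule grid_integral[OF u mn elim(1) cont])
      fix z z' assume "cmod (z - z') \<le> c / 2 * w"
      then have "cmod (z - z') / w \<le> c / 2" using w by (simp add: field_simps)
      then have "\<bar>\<rho> z - \<rho> z'\<bar> \<le> c / 2" using lip[of z z'] by linarith
      then show "cmod (\<Phi> z - \<Phi> z') \<le> c / 2"
        unfolding \<Phi>_def of_real_diff[symmetric] norm_of_real .
    qed
    have B: "(LINT z|lebesgue_on GLT_domain. \<Phi> (u z)) = complex_of_real (LINT z|lebesgue_on GLT_domain. \<rho> (u z))"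
      unfolding \<Phi>_def by (rule integral_complex_of_real)
    have C: "(\<Sum>i<T. \<Phi> (?d i)) = complex_of_real ?X" by (simp add: \<Phi>_def)
    have "\<bar>(LINT z|lebesgue_on GLT_domain. \<rho> (u z)) - ?X * (2 * pi / real T)\<bar> \<le> 2 * pi * (c / 2)"
      using A unfolding B C T_def[symmetric] of_real_mult[symmetric] of_real_diff[symmetric] norm_of_real .
    from abs_le_D2[OF this] have "- ((LINT z|lebesgue_on GLT_domain. \<rho> (u z)) - Y) \<le> 2 * pi * (c / 2)"
      unfolding Y_def .
    \<comment> \<open>The integral contributes \<open>c\<close> and the Riemann sum error
      \<open>pi * c\<close>; since 1 <= pi, the total is at most 2 pi c, which cancels the area of
      the domain.\<close>
    then have "Y \<le> c + pi * c" using I by simp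
    then have "?X * (2 * pi) \<le> (c + pi * c) * real T" using T(1) by (simp add: Y_def field_simps)
    also have "\<dots> \<le> (2 * pi * c) * real T"
    proof -
      have "1 * c \<le> pi * c" using c pi_ge_two by (intro mult_right_mono) auto
      then show ?thesis by (intro mult_right_mono) auto
    qed
    finally have X: "?X \<le> c * real T" by simp
    have "splits n (c * real n) (2 * w) (Q_conj n (m n) ?d)"
    proof (rule splits_Q_conj)
      let ?B = "{i. i < n \<and> 2 * w < cmod (?d i)}"
      have "real (card ?B) = (\<Sum>i\<in>?B. 1)" by simp
      also have "\<dots> \<le> (\<Sum>i\<in>?B. \<rho> (?d i))"
      proof (rule sum_mono)
        fix i assume "i \<in> ?B"
        then have "2 \<le> cmod (?d i) / w" using w by (simp add: field_simps)
        then show "1 \<le> \<rho> (?d i)" by (simp add: \<rho>_def)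
      qed
      also have "\<dots> \<le> ?X"
      proof (rule sum_mono2)
        \<comment> \<open>The trailing positions carry the value 0, so they never count as
          large.\<close>
        show "?B \<subseteq> {..<T}"
        proof
          fix i assume "i \<in> ?B"
          then have "?d i \<noteq> 0" using w by auto
          then show "i \<in> {..<T}" by (auto simp: gridval_def T_def split: if_splits)
        qed
      qed (use \<rho> in auto)
      also have "\<dots> \<le> c * real T" by (rule X)
      also have "\<dots> \<le> c * real n" using T c by simp
      finally show "real (card ?B) \<le> c * real n" .
    qed (use w in simp)
    then show ?case by (simp add: grid_mat_def)
  qed
qed

text \<open>If \<kappa> is real, the distance from h to Re h is |Im (\<kappa> - h)|, hence small
  wherever \<open>h\<close> is close to \<kappa>; by \<open>eventually_splits_grid_mat\<close> the
  replacement is then harmless for the matrices too. That lemma doubles the norm bound, hence e = d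
  + 2d.\<close>

lemma GLT_approx_real:
  assumes m: "admissible m" and GLT: "GLT_sequence A \<kappa>" and e: "0 < e"
    and real: "\<And>z. z \<in> GLT_domain \<Longrightarrow> \<kappa> z \<in> \<real>"
  obtains h where "nice h" "small_off e e (\<lambda>z. \<kappa> z - h z)"
    "\<forall>\<^sub>F n in sequentially. mat_split e n (A n) (qmat m h n)" "\<And>z. h z \<in> \<real>"
proof -
  define d where "d = e / 3"
  have d: "0 < d" "d \<le> e" "e = d + 2 * d" using e by (auto simp: d_def)
  obtain h where h: "nice h" "small_off d d (\<lambda>z. \<kappa> z - h z)"
    "\<forall>\<^sub>F n in sequentially. mat_split d n (A n) (qmat m h n)"
    by (rule GLT_approx[OF m GLT d(1)])
  define h' where "h' z = complex_of_real (Re (h z))" for z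
  have h': "nice h'" using h(1) unfolding nice_def h'_def by (auto intro!: continuous_intros)
  obtain S where S: "S \<in> lmeasurable" "measure lebesgue S \<le> d" "\<And>z. z \<in> GLT_domain - S \<Longrightarrow> cmod (\<kappa> z - h z) \<le> d"
    using h(2) unfolding small_off_def by blast
  have 1: "cmod (\<kappa> z - h' z) \<le> e" "cmod (h z - h' z) \<le> d" if z: "z \<in> GLT_domain - S" for z
  proof -
    have im: "Im (\<kappa> z) = 0" using real[of z] z by (auto simp: complex_is_Real_iff)
    have "cmod (\<kappa> z - h' z) = \<bar>Re (\<kappa> z - h z)\<bar>" "cmod (h z - h' z) = \<bar>Im (\<kappa> z - h z)\<bar>"
      using im by (simp_all add: cmod_def h'_def)
    then show "cmod (\<kappa> z - h' z) \<le> e" "cmod (h z - h' z) \<le> d"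
      using S(3)[OF z] abs_Re_le_cmod[of "\<kappa> z - h z"] abs_Im_le_cmod[of "\<kappa> z - h z"] d by linarith+
  qed
  have "small_off d d (\<lambda>z. h z - h' z)" unfolding small_off_def using S 1 by blast
  then have "\<forall>\<^sub>F n in sequentially. splits n (d * real n) (2 * d) (grid_mat m (\<lambda>z. h z - h' z) n)"
    by (intro eventually_splits_grid_mat[OF m nice_diff[OF h(1) h']] d)
  then have "\<forall>\<^sub>F n in sequentially. mat_split e n (A n) (qmat m h' n)"
    using h(3)
  proof eventually_elim
    case (elim n)
    have "splits n (2 * d * real n) (2 * d) (\<lambda>i j. qmat m h n $$ (i, j) - qmat m h' n $$ (i, j))"
      by (rule splits_cong[OF _ splits_mono[OF elim(1)]]) (use d in \<open>simp_all add: qmat_index grid_mat_diff\<close>)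
    then have "mat_split (2 * d) n (qmat m h n) (qmat m h' n)" by (rule mat_split_of_splits[OF qmat_carrier qmat_carrier])
    then have "mat_split (d + 2 * d) n (A n) (qmat m h' n)"
      by (rule mat_split_trans[OF qmat_carrier qmat_carrier elim(2)])
    then show ?case using d(3) by simp
  qed
  moreover have "small_off e e (\<lambda>z. \<kappa> z - h' z)"
    unfolding small_off_def using S 1 d by (intro bexI[of _ S]) auto
  ultimately show thesis using that[OF h'] by (simp add: h'_def)
qed

subsection \<open>The diagonal matrices\<close>

lemma eigvals_mat_diag: "eigvals (mat_diag n d) = image_mset d (mset_set {..<n})"
proof -
  have "char_poly (mat_diag n d) = (\<Prod>a\<leftarrow>diag_mat (mat_diag n d). [:- a, 1:])"
    by (rule char_poly_upper_triangular[of _ n]) (auto simp: upper_triangular_def mat_diag_def)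
  moreover have "diag_mat (mat_diag n d) = map d [0..<n]"
    by (auto simp: diag_mat_def mat_diag_def)
  moreover have "proots (\<Prod>a\<leftarrow>xs. [:- a, 1:]) = mset xs" for xs :: "complex list"
  proof (induction xs)
    case (Cons a xs)
    have "(\<Prod>a\<leftarrow>xs. [:- a, 1:]) \<noteq> 0" by (auto simp: prod_list_zero_iff)
    then have "proots ([:- a, 1:] * (\<Prod>a\<leftarrow>xs. [:- a, 1:])) = {#a#} + mset xs"
      by (subst proots_mult) (simp_all add: Cons)
    then show ?case by (simp del: mult_pCons_left)
  qed simp
  ultimately have "eigvals (mat_diag n d) = mset (map d [0..<n])" by (simp only: eigvals_def)
  then show ?thesis by (simp add: atLeast0LessThan)
qed

text \<open>The diagonal argument: \<open>s n\<close> is the largest k <= n whose threshold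
  \<open>N k\<close> has been passed. The bound k <= n keeps the set finite, and the inserted 0
  keeps it nonempty; once \<open>N 0 \<le> n\<close>, the value 0 is legitimate as well.\<close>

lemma ex_slow_index:
  fixes E :: "nat \<Rightarrow> nat \<Rightarrow> bool"
  assumes "\<And>k. \<forall>\<^sub>F n in sequentially. E k n"
  obtains s where "filterlim s at_top sequentially" "\<forall>\<^sub>F n in sequentially. E (s n) n"
proof -
  obtain N where N: "\<And>k n. N k \<le> n \<Longrightarrow> E k n"
    using assms unfolding eventually_sequentially by metis
  define s where "s n = Max (insert 0 {k. k \<le> n \<and> N k \<le> n})" for n
  have fin: "finite (insert 0 {k. k \<le> n \<and> N k \<le> n})" for n by (rule finite_subset[of _ "{..n}"]) auto
  have "E (s n) n" if n: "N 0 \<le> n" for n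
  proof -
    have "s n \<in> insert 0 {k. k \<le> n \<and> N k \<le> n}" unfolding s_def by (rule Max_in[OF fin]) simp
    then show ?thesis using n N by auto
  qed
  then have "\<forall>\<^sub>F n in sequentially. E (s n) n" unfolding eventually_sequentially by blast
  moreover have "filterlim s at_top sequentially"
    unfolding filterlim_at_top eventually_sequentially
  proof
    fix K
    have "K \<le> s n" if "max K (N K) \<le> n" for n
      unfolding s_def by (rule Max_ge[OF fin]) (use that in auto)
    then show "\<exists>n0. \<forall>n\<ge>n0. K \<le> s n" by blast
  qed
  ultimately show thesis using that by blast
qed

lemma uniformly_continuous_bounded_support:
  fixes F :: "complex \<Rightarrow> complex"
  assumes F: "continuous_on UNIV F" and supp: "bounded {z. F z \<noteq> 0}"
  shows "\<exists>B\<ge>0. \<forall>z. cmod (F z) \<le> B" "uniformly_continuous_on UNIV F"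
proof -
  obtain r where r: "\<And>z. F z \<noteq> 0 \<Longrightarrow> cmod z \<le> r" using supp unfolding bounded_iff by blast
  have "compact (F ` cball 0 r)" by (intro compact_continuous_image continuous_on_subset[OF F]) auto
  then obtain B where B: "\<And>z. z \<in> cball 0 r \<Longrightarrow> cmod (F z) \<le> B"
    using compact_imp_bounded bounded_iff by (metis imageI)
  have "cmod (F z) \<le> max 0 B" for z
    using B[of z] r[of z] by (cases "F z = 0") auto
  then show "\<exists>B\<ge>0. \<forall>z. cmod (F z) \<le> B" by (intro exI[of _ "max 0 B"]) auto
  \<comment> \<open>The margin 1 handles pairs of points closer than 1: if one lies outside the
    larger ball, both lie outside the ball of radius \<open>r\<close>, where \<open>F\<close>
    vanishes.\<close>
  have uc: "uniformly_continuous_on (cball 0 (r + 1)) F"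
    by (intro compact_uniformly_continuous continuous_on_subset[OF F]) auto
  show "uniformly_continuous_on UNIV F"
    unfolding uniformly_continuous_on_def
  proof (intro allI impI)
    fix e :: real assume e: "0 < e"
    obtain d where d: "0 < d" "\<And>x y. x \<in> cball 0 (r + 1) \<Longrightarrow> y \<in> cball 0 (r + 1) \<Longrightarrow> dist y x < d \<Longrightarrow> dist (F y) (F x) < e"
      using uc e unfolding uniformly_continuous_on_def by meson
    have "dist (F y) (F x) < e" if xy: "dist y x < min d 1" for x y
    proof (cases "x \<in> cball 0 (r + 1) \<and> y \<in> cball 0 (r + 1)")
      case True
      then show ?thesis using d(2) xy by auto
    next
      case False
      have "\<bar>cmod y - cmod x\<bar> \<le> cmod (y - x)" by (rule norm_triangle_ineq3)
      then have "r < cmod x" "r < cmod y" using False xy by (auto simp: dist_norm)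
      then have "F x = 0" "F y = 0" using r[of x] r[of y] by (auto simp: not_le[symmetric])
      then show ?thesis using e by simp
    qed
    then show "\<exists>d>0. \<forall>x\<in>UNIV. \<forall>x'\<in>UNIV. dist x' x < d \<longrightarrow> dist (F x') (F x) < e"
      using d(1) by (intro exI[of _ "min d 1"]) auto
  qed
qed

text \<open>Off the exceptional set uniform continuity makes F(h k) close to F(\<kappa>); on it the
  difference is at most 2B, and the set is small.\<close>

lemma integral_tendsto_of_small_off:
  fixes F :: "complex \<Rightarrow> complex"
  assumes F: "continuous_on UNIV F" "bounded {z. F z \<noteq> 0}"
    and h: "\<And>k. nice (h k)" and \<kappa>: "\<kappa> \<in> borel_measurable (lebesgue_on GLT_domain)"
    and e: "\<And>k. small_off (e k) (e k) (\<lambda>z. \<kappa> z - h k z)" "e \<longlonglongrightarrow> 0"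
  shows "(\<lambda>k. LINT z|lebesgue_on GLT_domain. F (h k z)) \<longlonglongrightarrow> (LINT z|lebesgue_on GLT_domain. F (\<kappa> z))"
proof (rule LIMSEQ_I)
  fix r :: real assume r: "0 < r"
  let ?M = "lebesgue_on GLT_domain"
  obtain B where B: "0 \<le> B" "\<And>z. cmod (F z) \<le> B" using uniformly_continuous_bounded_support(1)[OF F] by blast
  define \<delta> where "\<delta> = r / 16"
  have \<delta>: "0 < \<delta>" using r by (simp add: \<delta>_def)
  obtain d where d: "0 < d" "\<And>x y. dist y x < d \<Longrightarrow> dist (F y) (F x) < \<delta>"
    using uniformly_continuous_bounded_support(2)[OF F] \<delta> unfolding uniformly_continuous_on_def by (metis UNIV_I)
  \<comment> \<open>\<open>d\<close> triggers the uniform continuity of \<open>F\<close>, and the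
    other entry keeps the contribution of the exceptional set below r / 4; the remaining part is at
    most 2 pi \<delta> <= r / 2.\<close>
  define c where "c = min d (r / (8 * (B + 1)))"
  have c: "0 < c" using d(1) r B(1) by (auto simp: c_def)
  obtain k0 where k0: "\<And>k. k0 \<le> k \<Longrightarrow> e k < c"
    using order_tendstoD(2)[OF e(2) c] by (auto simp: eventually_sequentially)
  have dom: "GLT_domain \<in> lmeasurable" by (rule lmeasurable_compact[OF compact_GLT_domain])
  interpret finite_measure ?M by (rule finite_measure_lebesgue_on[OF dom])
  have hm: "h k \<in> borel_measurable ?M" for k
    using h[of k] dom by (intro continuous_imp_measurable_on_sets_lebesgue) (auto simp: nice_def intro: continuous_on_subset)
  have Fm: "F \<in> borel_measurable borel" by (rule borel_measurable_continuous_onI[OF F(1)])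
  have Fi: "integrable ?M (\<lambda>z. F (g z))" if "g \<in> borel_measurable ?M" for g
    by (rule integrable_const_bound[of _ B]) (use B measurable_compose[OF that Fm] in auto)
  show "\<exists>no. \<forall>k\<ge>no. norm ((LINT z|?M. F (h k z)) - (LINT z|?M. F (\<kappa> z))) < r"
  proof (intro exI allI impI)
    fix k assume k: "k0 \<le> k"
    obtain S where S: "S \<in> lmeasurable" "measure lebesgue S \<le> e k" "\<And>z. z \<in> GLT_domain - S \<Longrightarrow> cmod (\<kappa> z - h k z) \<le> e k"
      using e(1)[of k] unfolding small_off_def by blast
    have "norm ((LINT z|?M. F (h k z)) - (LINT z|?M. F (\<kappa> z))) = norm (LINT z|?M. F (h k z) - F (\<kappa> z))"
      using Fi[OF hm[of k]] Fi[OF \<kappa>] by simp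
    also have "\<dots> \<le> (LINT z|?M. norm (F (h k z) - F (\<kappa> z)))" by (rule integral_norm_bound)
    also have "\<dots> = (LINT z|?M. \<bar>cmod (F (h k z) - F (\<kappa> z))\<bar>)" by simp
    also have "\<dots> \<le> 2 * pi * \<delta> + (2 * B) * measure lebesgue S"
    proof (rule integral_le_small_off[OF _ S(1)])
      show "(\<lambda>z. cmod (F (h k z) - F (\<kappa> z))) \<in> borel_measurable ?M"
        by (intro measurable_compose[OF _ borel_measurable_norm] borel_measurable_diff measurable_compose[OF _ Fm] hm \<kappa>)
      show "\<bar>cmod (F (h k z) - F (\<kappa> z))\<bar> \<le> 2 * B" for z
        using norm_triangle_ineq4[of "F (h k z)" "F (\<kappa> z)"] B(2)[of "h k z"] B(2)[of "\<kappa> z"] by simp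
      show "\<bar>cmod (F (h k z) - F (\<kappa> z))\<bar> \<le> \<delta>" if "z \<in> GLT_domain - S" for z
      proof -
        have "dist (h k z) (\<kappa> z) < d" using S(3)[OF that] k0[OF k] by (simp add: c_def dist_norm norm_minus_commute)
        from d(2)[OF this] show ?thesis by (simp add: dist_norm)
      qed
    qed (use \<delta> B in auto)
    also have "\<dots> \<le> r / 2 + r / 4"
    proof (rule add_mono)
      have "2 * pi * \<delta> \<le> 8 * \<delta>" using pi_less_4 \<delta> by (intro mult_right_mono) auto
      then show "2 * pi * \<delta> \<le> r / 2" by (simp add: \<delta>_def)
      have "measure lebesgue S \<le> r / (8 * (B + 1))" using S(2) k0[OF k] by (simp add: c_def)
      then have "(2 * B) * measure lebesgue S \<le> (2 * (B + 1)) * (r / (8 * (B + 1)))"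
        using B(1) by (intro mult_mono) auto
      also have "\<dots> = r / 4" using B(1) by (simp add: field_simps)
      finally show "(2 * B) * measure lebesgue S \<le> r / 4" .
    qed
    also have "\<dots> < r" using r by simp
    finally show "norm ((LINT z|?M. F (h k z)) - (LINT z|?M. F (\<kappa> z))) < r" .
  qed
qed

text \<open>Omitting the last n - T terms and renormalizing the others each cost at most B (n - T) /
  n.\<close>

lemma cmod_eigenvalue_mean_diff:
  assumes "0 < T" "T \<le> n" "\<And>i. cmod (f i) \<le> B"
  shows "cmod ((\<Sum>i<n. f i) / of_nat n - (\<Sum>i<T. f i) / of_nat T) \<le> 2 * B * (real (n - T) / real n)"
proof -
  have n: "0 < real n" "0 < real T" using assms by auto
  let ?X = "\<Sum>i<T. f i" and ?Y = "\<Sum>i=T..<n. f i"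
  have sum: "(\<Sum>i<n. f i) = ?X + ?Y"
    using assms(2) by (simp add: sum.atLeastLessThan_concat flip: atLeast0LessThan)
  have X: "cmod ?X \<le> real T * B" by (rule order_trans[OF norm_sum order_trans[OF sum_mono[OF assms(3)]]]) simp
  have Y: "cmod ?Y \<le> real (n - T) * B" by (rule order_trans[OF norm_sum order_trans[OF sum_mono[OF assms(3)]]]) simp
  have "(\<Sum>i<n. f i) / of_nat n - ?X / of_nat T = ?Y / of_nat n - ?X * of_real (real (n - T) / (real n * real T))"
    unfolding sum using n assms(2) by (simp add: of_nat_diff field_simps)
  then have "cmod ((\<Sum>i<n. f i) / of_nat n - ?X / of_nat T) \<le> cmod (?Y / of_nat n) + cmod (?X * of_real (real (n - T) / (real n * real T)))"
    by (metis norm_triangle_ineq4)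
  also have "\<dots> = cmod ?Y / real n + cmod ?X * (real (n - T) / (real n * real T))"
    using n by (simp add: norm_divide norm_mult)
  also have "\<dots> \<le> real (n - T) * B / real n + real T * B * (real (n - T) / (real n * real T))"
    using n X Y by (intro add_mono divide_right_mono mult_right_mono) auto
  also have "\<dots> = 2 * B * (real (n - T) / real n)" using n by (simp add: field_simps)
  finally show ?thesis .
qed

lemma Q_mat_asymptotically_diagonalizes:
  assumes m: "admissible m"
  shows "asymptotically_diagonalizes_GLT (\<lambda>n. Q_mat n (m n))"
  unfolding asymptotically_diagonalizes_GLT_def
proof (intro allI impI)
  fix \<kappa> :: "real \<times> real \<Rightarrow> complex" and A
  assume \<kappa>: "\<kappa> \<in> borel_measurable (lebesgue_on GLT_domain)" and GLT: "GLT_sequence A \<kappa>"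
  define e where "e k = 1 / (real k + 1)" for k :: nat
  have e: "0 < e k" for k by (simp add: e_def)
  have e0: "e \<longlonglongrightarrow> 0" unfolding e_def using lim_1_over_n LIMSEQ_Suc[OF lim_1_over_n] by (simp add: add.commute)
  \<comment> \<open>The realness clause is required of \<open>h\<close> for every \<open>k\<close>
    and at every point, which makes all the diagonal matrices real and not only those with large
    index.\<close>
  have "\<exists>h. nice h \<and> small_off (e k) (e k) (\<lambda>z. \<kappa> z - h z) \<and>
      (\<forall>\<^sub>F n in sequentially. mat_split (e k) n (A n) (qmat m h n)) \<and>
      ((\<forall>z\<in>GLT_domain. \<kappa> z \<in> \<real>) \<longrightarrow> (\<forall>z. h z \<in> \<real>))" for k
  proof (cases "\<forall>z\<in>GLT_domain. \<kappa> z \<in> \<real>")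
    case True
    then obtain h where "nice h" "small_off (e k) (e k) (\<lambda>z. \<kappa> z - h z)"
      "\<forall>\<^sub>F n in sequentially. mat_split (e k) n (A n) (qmat m h n)" "\<And>z. h z \<in> \<real>"
      using GLT_approx_real[OF m GLT e] by blast
    then show ?thesis by blast
  next
    case False
    obtain h where "nice h" "small_off (e k) (e k) (\<lambda>z. \<kappa> z - h z)"
      "\<forall>\<^sub>F n in sequentially. mat_split (e k) n (A n) (qmat m h n)"
      using GLT_approx[OF m GLT e] by blast
    then show ?thesis using False by blast
  qed
  then obtain h where h: "\<And>k. nice (h k)" "\<And>k. small_off (e k) (e k) (\<lambda>z. \<kappa> z - h k z)"
    "\<And>k. \<forall>\<^sub>F n in sequentially. mat_split (e k) n (A n) (qmat m (h k) n)"
    "\<And>k z. (\<forall>z\<in>GLT_domain. \<kappa> z \<in> \<real>) \<Longrightarrow> h k z \<in> \<real>"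
    by metis
  \<comment> \<open>The mesh condition joins the diagonal argument because \<open>h (s n)\<close>
    changes with \<open>n\<close>: convergence of Riemann sums for each fixed function would not
    suffice.\<close>
  have "\<forall>\<^sub>F n in sequentially. mat_split (e k) n (A n) (qmat m (h k) n) \<and> mesh_osc n (m n) (h k) (e k)" for k
    using m e by (intro eventually_conj h(3) eventually_mesh_osc h(1) admissible_block_size) (auto simp: admissible_def)
  then obtain s where s: "filterlim s at_top sequentially"
    "\<forall>\<^sub>F n in sequentially. mat_split (e (s n)) n (A n) (qmat m (h (s n)) n) \<and> mesh_osc n (m n) (h (s n)) (e (s n))"
    by (rule ex_slow_index)
  have es: "(\<lambda>n. e (s n)) \<longlonglongrightarrow> 0" by (rule filterlim_compose[OF e0 s(1)])
  define d where "d n = gridval n (m n) (h (s n))" for n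
  define D where "D n = mat_diag n (d n)" for n
  have QDQ: "Q_mat n (m n) * D n * mat_adjoint (Q_mat n (m n)) = qmat m (h (s n)) n" for n
    by (simp add: D_def d_def qmat_def)
  have A: "A n \<in> carrier_mat n n" for n using GLT by (simp add: GLT_sequence_def matrix_seq_def)
  have "acs_equiv A (\<lambda>n. Q_mat n (m n) * D n * mat_adjoint (Q_mat n (m n)))"
    unfolding acs_equiv_def zero_distributed_def QDQ
  proof -
    define Z where "Z n = A n - qmat m (h (s n)) n" for n
    have Z: "Z n \<in> carrier_mat n n" for n unfolding Z_def using qmat_carrier by (rule minus_carrier_mat)
    have "\<exists>R N. R \<in> carrier_mat n n \<and> N \<in> carrier_mat n n \<and> Z n = R + N \<and>
        (mat_split (e (s n)) n (A n) (qmat m (h (s n)) n) \<longrightarrow> real (mat_rank R) \<le> e (s n) * real n \<and> spectral_norm N \<le> e (s n))" for n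
    proof (cases "mat_split (e (s n)) n (A n) (qmat m (h (s n)) n)")
      case True
      then obtain R N where RN: "R \<in> carrier_mat n n" "N \<in> carrier_mat n n" "A n = qmat m (h (s n)) n + R + N"
        "real (mat_rank R) \<le> e (s n) * real n" "spectral_norm N \<le> e (s n)"
        unfolding mat_split_def by blast
      have "Z n = R + N"
        unfolding Z_def RN(3) by (rule eq_matI) (use RN(1,2) qmat_carrier[of m "h (s n)" n] in auto)
      then show ?thesis using RN by blast
    next
      \<comment> \<open>This occurs for finitely many \<open>n\<close> only; any decomposition will
        do, here the trivial one with all of \<open>Z n\<close> as rank part.\<close>
      case False
      then show ?thesis using Z[of n] by (intro exI[of _ "Z n"] exI[of _ "0\<^sub>m n n"]) auto
    qed
    then obtain R N where RN: "\<And>n. R n \<in> carrier_mat n n" "\<And>n. N n \<in> carrier_mat n n" "\<And>n. Z n = R n + N n"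
      "\<And>n. mat_split (e (s n)) n (A n) (qmat m (h (s n)) n) \<Longrightarrow> real (mat_rank (R n)) \<le> e (s n) * real n \<and> spectral_norm (N n) \<le> e (s n)"
      by metis
    have bounds: "\<forall>\<^sub>F n in sequentially. real (mat_rank (R n)) / real n \<le> e (s n) \<and> spectral_norm (N n) \<le> e (s n)"
      using s(2) eventually_gt_at_top[of 0]
    proof eventually_elim
      case (elim n)
      then show ?case using RN(4)[of n] by (simp add: field_simps)
    qed
    have "(\<lambda>n. real (mat_rank (R n)) / real n) \<longlonglongrightarrow> 0"
    proof (rule tendsto_sandwich[OF _ _ tendsto_const es])
      show "\<forall>\<^sub>F n in sequentially. real (mat_rank (R n)) / real n \<le> e (s n)"
        using bounds by (rule eventually_mono) blast
    qed simp
    moreover have "0 \<le> spectral_norm (N n)" for n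
      using op_bounded_spectral_norm[OF RN(2)[of n]] by (simp add: op_bounded_def)
    then have "(\<lambda>n. spectral_norm (N n)) \<longlonglongrightarrow> 0"
    proof (intro tendsto_sandwich[OF _ _ tendsto_const es])
      show "\<forall>\<^sub>F n in sequentially. spectral_norm (N n) \<le> e (s n)"
        using bounds by (rule eventually_mono) blast
    qed simp
    ultimately show "\<exists>R N. matrix_seq R \<and> matrix_seq N \<and> (\<forall>n. A n - qmat m (h (s n)) n = R n + N n) \<and>
        (\<lambda>n. real (mat_rank (R n)) / real n) \<longlonglongrightarrow> 0 \<and> (\<lambda>n. spectral_norm (N n)) \<longlonglongrightarrow> 0"
      using RN(1-3) unfolding matrix_seq_def Z_def by blast
  qed
  moreover have "spectral_distribution D GLT_domain \<kappa>"
    unfolding spectral_distribution_def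
  proof (intro allI impI)
    fix F :: "complex \<Rightarrow> complex" assume F: "continuous_on UNIV F" "bounded {z. F z \<noteq> 0}"
    obtain B where B: "0 \<le> B" "\<And>z. cmod (F z) \<le> B" using uniformly_continuous_bounded_support(1)[OF F] by blast
    define T where "T n = m n * (n div m n)" for n
    define I where "I k = (LINT z|lebesgue_on GLT_domain. F (h k z))" for k
    have T: "0 < T n" "T n \<le> n" if "1 \<le> n" for n
      using admissible_bounds[OF m that] by (auto simp: T_def div_greater_zero_iff)
    \<comment> \<open>The trailing \<open>n mod m n\<close> diagonal entries are no grid values of
      \<open>h\<close>. Being o(n) in number, they leave the limit of the means unchanged.\<close>
    have "(\<lambda>n. (\<Sum>i<n. F (d n i)) / of_nat n - (\<Sum>i<T n. F (d n i)) / of_nat (T n)) \<longlonglongrightarrow> 0"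
    proof (rule Lim_null_comparison)
      show "\<forall>\<^sub>F n in sequentially. norm ((\<Sum>i<n. F (d n i)) / of_nat n - (\<Sum>i<T n. F (d n i)) / of_nat (T n)) \<le> 2 * B * (real (m n) / real n)"
        using eventually_ge_at_top[of 1]
      proof eventually_elim
        case (elim n)
        have "n - T n \<le> m n"
        proof -
          have "0 < m n" using admissible_bounds[OF m elim] by simp
          then have "n mod m n < m n" by simp
          then show ?thesis by (simp add: T_def minus_mult_div_eq_mod)
        qed
        then have "2 * B * (real (n - T n) / real n) \<le> 2 * B * (real (m n) / real n)"
          using B(1) by (intro mult_left_mono divide_right_mono) auto
        then show ?case using cmod_eigenvalue_mean_diff[OF T[OF elim], of "\<lambda>i. F (d n i)" B] B(2) by (meson order_trans)
      qed
      have "(\<lambda>n. real (m n) / real n) \<longlonglongrightarrow> 0" using m by (simp add: admissible_def)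
      from tendsto_mult_right_zero[OF this, of "2 * B"] show "(\<lambda>n. 2 * B * (real (m n) / real n)) \<longlonglongrightarrow> 0" .
    qed
    moreover have "(\<lambda>n. (\<Sum>i<T n. F (d n i)) / of_nat (T n) - I (s n) / of_real (2 * pi)) \<longlonglongrightarrow> 0"
    proof (rule tendstoI)
      fix r :: real assume r: "0 < r"
      then have r2: "0 < r / 2" by simp
      obtain \<eta> where \<eta>: "0 < \<eta>" "\<And>x y. dist y x < \<eta> \<Longrightarrow> dist (F y) (F x) < r / 2"
        using uniformly_continuous_bounded_support(2)[OF F] r2 unfolding uniformly_continuous_on_def by (metis UNIV_I)
      have "\<forall>\<^sub>F n in sequentially. e (s n) < \<eta>" by (rule order_tendstoD(2)[OF es \<eta>(1)])
      then show "\<forall>\<^sub>F n in sequentially. dist ((\<Sum>i<T n. F (d n i)) / of_nat (T n) - I (s n) / of_real (2 * pi)) 0 < r"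
        using s(2) eventually_ge_at_top[of 1]
      proof eventually_elim
        case (elim n)
        note mn = admissible_bounds[OF m elim(3)]
        let ?X = "\<Sum>i<T n. F (d n i)"
        have "cmod (I (s n) - ?X * of_real (2 * pi / real (T n))) \<le> 2 * pi * (r / 2)"
          unfolding I_def T_def d_def
        proof (rule grid_integral[OF h(1) mn _ F(1)])
          show "mesh_osc n (m n) (h (s n)) (e (s n))" using elim(2) by blast
          show "cmod (F z - F w) \<le> r / 2" if "cmod (z - w) \<le> e (s n)" for z w
            using \<eta>(2)[of z w] that elim(1) by (simp add: dist_norm)
        qed
        moreover have "I (s n) - ?X * of_real (2 * pi / real (T n)) = - of_real (2 * pi) * (?X / of_nat (T n) - I (s n) / of_real (2 * pi))"
          using T(1)[OF elim(3)] by (simp add: field_simps)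
        ultimately have "2 * pi * cmod (?X / of_nat (T n) - I (s n) / of_real (2 * pi)) \<le> 2 * pi * (r / 2)"
          by (simp add: norm_mult)
        then have "cmod (?X / of_nat (T n) - I (s n) / of_real (2 * pi)) \<le> r / 2" by simp
        then show ?case using r by simp
      qed
    qed
    moreover have "(\<lambda>n. I (s n) / of_real (2 * pi)) \<longlonglongrightarrow> (LINT z|lebesgue_on GLT_domain. F (\<kappa> z)) / of_real (2 * pi)"
    proof -
      have "I \<longlonglongrightarrow> (LINT z|lebesgue_on GLT_domain. F (\<kappa> z))"
        unfolding I_def by (rule integral_tendsto_of_small_off[OF F h(1) \<kappa> h(2) e0])
      from filterlim_compose[OF this s(1)] show ?thesis by (intro tendsto_divide tendsto_const) auto
    qed
    ultimately have "(\<lambda>n. ((\<Sum>i<n. F (d n i)) / of_nat n - (\<Sum>i<T n. F (d n i)) / of_nat (T n)) +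
        ((\<Sum>i<T n. F (d n i)) / of_nat (T n) - I (s n) / of_real (2 * pi)) + I (s n) / of_real (2 * pi))
        \<longlonglongrightarrow> 0 + 0 + (LINT z|lebesgue_on GLT_domain. F (\<kappa> z)) / of_real (2 * pi)"
      by (intro tendsto_add)
    then show "(\<lambda>n. (\<Sum>z\<in>#eigvals (D n). F z) / of_nat n) \<longlonglongrightarrow>
        (LINT z|lebesgue_on GLT_domain. F (\<kappa> z)) / of_real (measure lebesgue GLT_domain)"
      unfolding measure_GLT_domain by (simp add: D_def eigvals_mat_diag image_mset.compositionality comp_def sum_unfold_sum_mset)
  qed
  moreover have "elements_mat (D n) \<subseteq> \<real>" if "\<forall>z\<in>GLT_domain. \<kappa> z \<in> \<real>" for n
    using h(4)[OF that] by (auto simp: elements_mat_def D_def d_def mat_diag_def gridval_def)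
  moreover have "matrix_seq D" "diagonal_mat (D n)" for n
    by (auto simp: matrix_seq_def D_def diagonal_mat_def mat_diag_def)
  ultimately show "\<exists>D. matrix_seq D \<and> (\<forall>n. diagonal_mat (D n)) \<and>
           acs_equiv A (\<lambda>n. Q_mat n (m n) * D n * mat_adjoint (Q_mat n (m n))) \<and>
           spectral_distribution D GLT_domain \<kappa> \<and>
           ((\<forall>z\<in>GLT_domain. \<kappa> z \<in> \<real>) \<longrightarrow> (\<forall>n. elements_mat (D n) \<subseteq> \<real>))"
    by blast
qed

section \<open>An admissible number of blocks, and the conclusion\<close>

text \<open>The existence claim needs one concrete sequence; with the integer part of the square
  root both the number of blocks and the block size grow like sqrt n.\<close>

lemma admissible_sqrt: "admissible (\<lambda>n. nat \<lfloor>sqrt (real n)\<rfloor>)"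
  unfolding admissible_def
proof (intro conjI allI impI)
  fix n :: nat assume n: "1 \<le> n"
  then show "1 \<le> nat \<lfloor>sqrt (real n)\<rfloor>" by (simp add: le_nat_iff le_floor_iff)
  have "sqrt (real n) \<le> real n" using n by (intro real_le_lsqrt) (auto simp: power2_eq_square)
  then show "nat \<lfloor>sqrt (real n)\<rfloor> \<le> n" by linarith
next
  have "filterlim (\<lambda>n. sqrt (real n)) at_top sequentially"
    by (rule filterlim_compose[OF sqrt_at_top filterlim_real_sequentially])
  then have "filterlim (\<lambda>n. \<lfloor>sqrt (real n)\<rfloor>) at_top sequentially"
    by (rule filterlim_compose[OF filterlim_floor_sequentially])
  then show "filterlim (\<lambda>n. nat \<lfloor>sqrt (real n)\<rfloor>) at_top sequentially"
    by (rule filterlim_compose[OF filterlim_nat_sequentially])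
  have "(\<lambda>n. 1 / sqrt (real n)) \<longlonglongrightarrow> 0"
    by (rule tendsto_divide_0[OF tendsto_const])
       (rule filterlim_at_top_imp_at_infinity[OF filterlim_compose[OF sqrt_at_top filterlim_real_sequentially]])
  then show "(\<lambda>n. real (nat \<lfloor>sqrt (real n)\<rfloor>) / real n) \<longlonglongrightarrow> 0"
  proof (rule Lim_null_comparison[rotated])
    show "\<forall>\<^sub>F n in sequentially. norm (real (nat \<lfloor>sqrt (real n)\<rfloor>) / real n) \<le> 1 / sqrt (real n)"
      using eventually_gt_at_top[of 0]
    proof eventually_elim
      case (elim n)
      have "real (nat \<lfloor>sqrt (real n)\<rfloor>) \<le> sqrt (real n)" by simp
      then have "real (nat \<lfloor>sqrt (real n)\<rfloor>) / real n \<le> sqrt (real n) / real n" by (intro divide_right_mono) auto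
      also have "\<dots> = 1 / sqrt (real n)" using elim by (simp add: field_simps flip: real_sqrt_mult)
      finally show ?case by simp
    qed
  qed
qed

theorem theorem3p1:
  shows "(\<exists>Q. matrix_seq Q \<and> (\<forall>n. unitary_mat (Q n)) \<and> asymptotically_diagonalizes_GLT Q) \<and>
    (\<forall>m :: nat \<Rightarrow> nat.
       (\<forall>n\<ge>1. 1 \<le> m n \<and> m n \<le> n) \<longrightarrow>
       filterlim m at_top sequentially \<longrightarrow>
       (\<lambda>n. real (m n)) \<in> o(\<lambda>n. real n) \<longrightarrow>
       matrix_seq (\<lambda>n. Q_mat n (m n)) \<and> (\<forall>n. unitary_mat (Q_mat n (m n))) \<and>
       asymptotically_diagonalizes_GLT (\<lambda>n. Q_mat n (m n)))"
proof (intro conjI allI impI)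
  have seq: "matrix_seq (\<lambda>n. Q_mat n (m n))" for m by (simp add: matrix_seq_def Q_mat_carrier)
  show "\<exists>Q. matrix_seq Q \<and> (\<forall>n. unitary_mat (Q n)) \<and> asymptotically_diagonalizes_GLT Q"
    by (intro exI[of _ "\<lambda>n. Q_mat n (nat \<lfloor>sqrt (real n)\<rfloor>)"] conjI allI seq unitary_Q_mat
        Q_mat_asymptotically_diagonalizes[OF admissible_sqrt])
  fix m :: "nat \<Rightarrow> nat"
  assume m: "\<forall>n\<ge>1. 1 \<le> m n \<and> m n \<le> n" "filterlim m at_top sequentially" "(\<lambda>n. real (m n)) \<in> o(\<lambda>n. real n)"
  show "matrix_seq (\<lambda>n. Q_mat n (m n))" by (rule seq)
  show "unitary_mat (Q_mat n (m n))" for n by (rule unitary_Q_mat)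
  have "admissible m" using m smalloD_tendsto[OF m(3)] by (simp add: admissible_def)
  then show "asymptotically_diagonalizes_GLT (\<lambda>n. Q_mat n (m n))" by (rule Q_mat_asymptotically_diagonalizes)
qed

end
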